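(* Let $\mu\in\mathcal{P}(\mathbb{R})$ be a self-similar measure defined by an iterated function system satisfying strong separation and such that the contraction ratios generate a dense multiplicative subgroup of $\mathbb{R}^{+}=(0,\infty)$. Then $\mu$ dissonates with every a.e.-Ahlfors measure $\nu\in\mathcal{P}(\mathbb{R})$, i.e. $\dim(\mu*\nu)=\min\{1,\dim\mu+\dim\nu\}$.
   Context: An iterated function system (IFS) on $\mathbb{R}$ is a finite family $\{f_i\}_{i\in\Lambda}$ of contracting similarities $f_i(x)=r_iU_i(x)+v_i$ with $0<r_i<1$, $U_i\in\{\pm1\}$, $v_i\in\mathbb{R}$; the $r_i$ are the contraction ratios. Its attractor is the unique non-empty compact set $X$ with $X=\bigcup_{i\in\Lambda}f_i(X)$. The IFS satisfies strong separation if the sets $f_i(X)$, $i\in\Lambda$, are pairwise disjoint. Let $\varphi:\Lambda^{\mathbb{N}}\to X$ be the coding map $\varphi(a)=\lim_{n\to\infty}f_{a_1}\circ\cdots\circ f_{a_n}(x)$ (independent of $x$). A self-similar measure is the image under $\varphi$ of a product measure on $\Lambda^{\mathbb{N}}$ with marginal a probability vector $(p_i)_{i\in\Lambda}$, $p_i>0$. A measure $\nu$ is Ahlfors-regular if there are constants $\alpha,c>0$ such that $c^{-1}r^{\alpha}\le\nu(B_r(x))\le c\,r^{\alpha}$ for every $x\in\operatorname{supp}\nu$ and $0<r\le1$; it is a.e.-Ahlfors if this holds at $\nu$-a.e. $x$. A measure $\theta$ on $\mathbb{R}$ is exact dimensional with $\dim\theta=\alpha$ if $\lim_{r\searrow0}\frac{\log\theta(B_r(x))}{\log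 r}=\alpha$ for $\theta$-a.e. $x$. $\mu*\nu$ is convolution. Two exact dimensional measures $\mu,\nu\in\mathcal{P}(\mathbb{R})$ dissonate if $\dim(\mu*\nu)=\min\{1,\dim\mu+\dim\nu\}$. *)

theory Defs
  imports "HOL-Probability.Probability" "HOL-Algebra.Generated_Groups"
begin

section \<open>Iterated function systems on the line\<close>

text \<open>The index set \<open>\<Lambda>\<close> is a finite type, and the system is given by the families
  \<open>r\<close> (contraction ratios), \<open>u\<close> (orthogonal parts, i.e. signs) and \<open>v\<close> (translations).\<close>

definition ifs_map :: "('i \<Rightarrow> real) \<Rightarrow> ('i \<Rightarrow> real) \<Rightarrow> ('i \<Rightarrow> real) \<Rightarrow> 'i \<Rightarrow> real \<Rightarrow> real" where
  "ifs_map r u v i x = r i * (u i * x) + v i"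

definition is_ifs :: "('i::finite \<Rightarrow> real) \<Rightarrow> ('i \<Rightarrow> real) \<Rightarrow> ('i \<Rightarrow> real) \<Rightarrow> bool" where
  "is_ifs r u v \<longleftrightarrow> (\<forall>i. 0 < r i \<and> r i < 1 \<and> u i \<in> {-1, 1})"

definition attractor :: "('i \<Rightarrow> real \<Rightarrow> real) \<Rightarrow> real set" where
  "attractor f = (THE X. X \<noteq> {} \<and> compact X \<and> X = (\<Union>i. f i ` X))"

definition strong_separation :: "('i \<Rightarrow> real \<Rightarrow> real) \<Rightarrow> bool" where
  "strong_separation f \<longleftrightarrow> disjoint_family (\<lambda>i. f i ` attractor f)"

text \<open>Words are indexed from \<open>0\<close>, so \<open>word_map f a n\<close> is the composition of
  \<open>f (a 0)\<close>, ..., \<open>f (a (n - 1))\<close>, with \<open>f (a 0)\<close> outermost.\<close>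

primrec word_map :: "('i \<Rightarrow> real \<Rightarrow> real) \<Rightarrow> (nat \<Rightarrow> 'i) \<Rightarrow> nat \<Rightarrow> real \<Rightarrow> real" where
  "word_map f a 0 = id"
| "word_map f a (Suc n) = word_map f a n \<circ> f (a n)"

definition coding_map :: "('i \<Rightarrow> real \<Rightarrow> real) \<Rightarrow> (nat \<Rightarrow> 'i) \<Rightarrow> real" where
  "coding_map f a = (THE y. \<forall>x. (\<lambda>n. word_map f a n x) \<longlonglongrightarrow> y)"

definition positive_prob_vector :: "('i::finite \<Rightarrow> real) \<Rightarrow> bool" where
  "positive_prob_vector p \<longleftrightarrow> (\<forall>i. 0 < p i) \<and> (\<Sum>i\<in>UNIV. p i) = 1"

definition self_similar_measure ::
    "('i::finite \<Rightarrow> real \<Rightarrow> real) \<Rightarrow> ('i \<Rightarrow> real) \<Rightarrow> real measure" where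
  "self_similar_measure f p =
     distr (\<Pi>\<^sub>M n\<in>(UNIV :: nat set). point_measure UNIV (\<lambda>i. ennreal (p i))) borel (coding_map f)"

definition pos_real_mult_group :: "real monoid" where
  "pos_real_mult_group = \<lparr>carrier = {0<..}, mult = (*), one = 1\<rparr>"

definition generates_dense_subgroup :: "real set \<Rightarrow> bool" where
  "generates_dense_subgroup R \<longleftrightarrow> {0<..} \<subseteq> closure (generate pos_real_mult_group R)"

section \<open>Dimension, regularity and dissonance of measures\<close>

text \<open>\<open>ln 0 = 0\<close> does no harm here: almost every \<open>x\<close> lies in the support of \<open>\<theta>\<close>,
  where all balls have positive measure.\<close>

definition has_exact_dim :: "real measure \<Rightarrow> real \<Rightarrow> bool" where
  "has_exact_dim \<theta> \<alpha> \<longleftrightarrow>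
     (AE x in \<theta>. ((\<lambda>r. ln (measure \<theta> (cball x r)) / ln r) \<longlongrightarrow> \<alpha>) (at_right 0))"

definition exact_dimensional :: "real measure \<Rightarrow> bool" where
  "exact_dimensional \<theta> \<longleftrightarrow> (\<exists>\<alpha>. has_exact_dim \<theta> \<alpha>)"

definition measure_dim :: "real measure \<Rightarrow> real" where
  "measure_dim \<theta> = (THE \<alpha>. has_exact_dim \<theta> \<alpha>)"

text \<open>The constant \<open>c\<close> may depend on the point. With a uniform \<open>c\<close> the condition would
  pass from a set of full measure to the whole support (up to a change of \<open>c\<close>), and being
  a.e.-Ahlfors would be the same as being Ahlfors-regular.\<close>

definition ae_ahlfors :: "real measure \<Rightarrow> bool" where
  "ae_ahlfors \<nu> \<longleftrightarrow> (\<exists>\<alpha>>0. AE x in \<nu>. \<exists>c>0. \<forall>r. 0 < r \<and> r \<le> 1 \<longrightarrow>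
     inverse c * r powr \<alpha> \<le> measure \<nu> (cball x r) \<and> measure \<nu> (cball x r) \<le> c * r powr \<alpha>)"

text \<open>Since \<open>measure_dim\<close> is meaningful only for exact dimensional measures, dissonance
  includes exact dimensionality of both measures and of their convolution.\<close>

definition dissonate :: "real measure \<Rightarrow> real measure \<Rightarrow> bool" where
  "dissonate \<mu> \<nu> \<longleftrightarrow>
     exact_dimensional \<mu> \<and> exact_dimensional \<nu> \<and> exact_dimensional (\<mu> \<star> \<nu>) \<and>
     measure_dim (\<mu> \<star> \<nu>) = min 1 (measure_dim \<mu> + measure_dim \<nu>)"

section \<open>Well-definedness\<close>

lemma comm_group_pos_real_mult_group: "comm_group pos_real_mult_group"
proof (rule comm_groupI)
  fix x assume "x \<in> carrier pos_real_mult_group"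
  then show "\<exists>y\<in>carrier pos_real_mult_group.
      y \<otimes>\<^bsub>pos_real_mult_group\<^esub> x = \<one>\<^bsub>pos_real_mult_group\<^esub>"
    by (intro bexI[of _ "inverse x"]) (auto simp: pos_real_mult_group_def)
qed (auto simp: pos_real_mult_group_def)

lemma measure_dim_eqI:
  assumes "prob_space \<theta>" and \<alpha>: "has_exact_dim \<theta> \<alpha>"
  shows "measure_dim \<theta> = \<alpha>"
  unfolding measure_dim_def
proof (rule the_equality)
  interpret prob_space \<theta> by fact
  show "has_exact_dim \<theta> \<alpha>" by fact
  fix \<beta> assume "has_exact_dim \<theta> \<beta>"
  with \<alpha> have "AE x in \<theta>. \<beta> = \<alpha>"
    unfolding has_exact_dim_def
    by eventually_elim (rule tendsto_unique[OF trivial_limit_at_right_real])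
  then show "\<beta> = \<alpha>" by simp
qed

end

(* Write mu as the law of cod a for a random word a, and stop the word when its contraction first
   drops below a given scale.  The logarithm of the contraction of the stopped word is a random walk
   whose steps generate a dense group, so for large times it visits any window of length t with
   probability O(t): the supremum limit of the hitting probabilities is nearly attained along translates
   by a semigroup, and disjoint translates of one window share a bounded number of visits.  This
   replaces the equidistribution of scales by an upper bound, which is enough.

   Let gamma = min 1 (dim mu + dim nu).  Take rho = 2^(-m) small.  For a fixed y, two independent
   continuations a, b of the same word and a grid point y' of nu near y, the event
   |cod b - cod a - (y' - y)| <= rho^(k+1) confines the logarithm of the scale to a short window unless
   cod a and cod b are close.  Summing over y' by regularity of nu shows that the expected conditional
   mass near (a, y) is at most about rho^gamma; hence a step is "light" (has conditional mass at most
   zeta, slightly larger than rho^gamma) except with small probability, given everything up to a fixed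
   lag.  Almost every pair therefore has a proportion near 1 of light steps.  Going down the tree of
   pairs (word, grid cell of nu), the part near a point z of the line is multiplied by at most zeta at a
   light step and by bb + 1 over all, so pairs with many light steps project to a measure which gives
   balls of radius rho^n mass at most about rho^(n gamma).  Testing this against mu * nu itself and
   applying Borel-Cantelli gives the lower bound; the upper bound holds for any pair. *)
theory Submission imports Defs begin

section \<open>Symbolic coding\<close>

text \<open>The minimum with 1 comes out of a single sum. Let \<sigma> be slightly below dim mu,
  \<beta> = dim nu, and let y' lie e cells of size rho^(k+1) away from y. The event forces cod a and
  cod b to be within about e * rho, with probability about (e * rho)^\<sigma>, and for fixed tails
  it forces the logarithm of the scale into a window of length about 1 / e. About E^\<beta> cells
  have e of order E, so the sum of e^(\<sigma> - 1) over e up to 1 / rho is at most rho^(- max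
  (\<sigma> + \<beta> - 1) 0), up to the number of dyadic shells. Together with rho^\<beta> and
  rho^\<sigma> this is rho^(min 1 (\<sigma> + \<beta>)). The obstacle is uniformity. The renewal
  bound holds only after a time that depends on the window; hence the lag, and the splitting of
  times into residue classes in which conditional bounds can be multiplied. The Ahlfors constant
  depends on the point, so nu is exhausted by sets on which it is fixed. Constants that are not
  powers of rho have to be fixed before rho, so that a small power of rho absorbs them.\<close>

locale weighted_ifs =
  fixes r u v p :: "'i::finite \<Rightarrow> real"
  assumes ifs: "is_ifs r u v" and prob_vector: "positive_prob_vector p"
begin

lemma r_pos: "0 < r i" and r_less_1: "r i < 1"
  using ifs by (auto simp: is_ifs_def)

lemma abs_u: "\<bar>u i\<bar> = 1"
proof -
  have "u i = -1 \<or> u i = 1" using ifs by (auto simp: is_ifs_def)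
  then show ?thesis by auto
qed

lemma p_pos: "0 < p i" and sum_p: "(\<Sum>i\<in>UNIV. p i) = 1"
  using prob_vector by (auto simp: positive_prob_vector_def)

definition rmin :: real where "rmin = Min (range r)"
definition rmax :: real where "rmax = Max (range r)"

lemma rmin_pos: "0 < rmin" and rmin_le: "rmin \<le> r i" and le_rmax: "r i \<le> rmax" and rmax_less_1: "rmax < 1"
  using r_pos r_less_1 by (auto simp: rmin_def rmax_def)

lemma rmax_pos: "0 < rmax"
  using less_le_trans[OF r_pos le_rmax] .

lemma rmin_less_1: "rmin < 1"
  using le_less_trans[OF rmin_le r_less_1] .

text \<open>The first \<open>n\<close> maps of the word compose to the map that sends
  \<open>x\<close> to \<open>tr a n + sg a n * x\<close>. \<open>sc\<close> is the absolute value of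
  the linear part, and \<open>pr\<close> is the probability of the cylinder.\<close>

definition sc :: "(nat \<Rightarrow> 'i) \<Rightarrow> nat \<Rightarrow> real" where
  "sc a n = (\<Prod>i<n. r (a i))"

definition sg :: "(nat \<Rightarrow> 'i) \<Rightarrow> nat \<Rightarrow> real" where
  "sg a n = (\<Prod>i<n. r (a i) * u (a i))"

definition tr :: "(nat \<Rightarrow> 'i) \<Rightarrow> nat \<Rightarrow> real" where
  "tr a n = (\<Sum>i<n. sg a i * v (a i))"

definition pr :: "(nat \<Rightarrow> 'i) \<Rightarrow> nat \<Rightarrow> real" where
  "pr a n = (\<Prod>i<n. p (a i))"

definition shift :: "nat \<Rightarrow> (nat \<Rightarrow> 'i) \<Rightarrow> nat \<Rightarrow> 'i" where
  "shift n a = (\<lambda>i. a (n + i))"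

definition cod :: "(nat \<Rightarrow> 'i) \<Rightarrow> real" where
  "cod a = (\<Sum>i. sg a i * v (a i))"

text \<open>A geometric majorant of the coding series. The additional 1 keeps \<open>bnd\<close> at
  least 1, so that radii can be divided by it.\<close>

definition bnd :: real where
  "bnd = 1 + (\<Sum>n. rmax ^ n * Max (range (\<lambda>i. \<bar>v i\<bar>)))"

lemma sc_0 [simp]: "sc a 0 = 1" and sc_Suc: "sc a (Suc n) = sc a n * r (a n)"
  by (simp_all add: sc_def)

lemma sg_0 [simp]: "sg a 0 = 1" and sg_Suc: "sg a (Suc n) = sg a n * (r (a n) * u (a n))"
  by (simp_all add: sg_def)

lemma tr_0 [simp]: "tr a 0 = 0" and tr_Suc: "tr a (Suc n) = tr a n + sg a n * v (a n)"
  by (simp_all add: tr_def)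

lemma pr_0 [simp]: "pr a 0 = 1" and pr_Suc: "pr a (Suc n) = pr a n * p (a n)"
  by (simp_all add: pr_def)

lemma sc_pos: "0 < sc a n"
  by (simp add: sc_def prod_pos r_pos)

lemma pr_pos: "0 < pr a n"
  by (simp add: pr_def prod_pos p_pos)

lemma abs_sg: "\<bar>sg a n\<bar> = sc a n"
  by (simp add: sg_def sc_def abs_prod abs_mult abs_u abs_of_pos r_pos)

lemma sc_le: "sc a n \<le> rmax ^ n"
proof -
  have "sc a n \<le> (\<Prod>i<n. rmax)"
    unfolding sc_def by (rule prod_mono) (auto intro: le_rmax less_imp_le[OF r_pos])
  then show ?thesis by simp
qed

lemma sc_Suc_less: "sc a (Suc n) < sc a n"
  using sc_pos[of a n] r_less_1[of "a n"] by (simp add: sc_Suc)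

lemma sc_Suc_ge: "rmin * sc a n \<le> sc a (Suc n)"
  using mult_right_mono[OF rmin_le less_imp_le[OF sc_pos]] by (simp add: sc_Suc mult.commute)

lemma sc_antimono: "m \<le> n \<Longrightarrow> sc a n \<le> sc a m"
  by (rule lift_Suc_antimono_le[of "sc a"]) (auto intro: less_imp_le sc_Suc_less)

lemma rmax_power_tendsto: "(\<lambda>n. rmax ^ n) \<longlonglongrightarrow> 0"
  using rmax_pos rmax_less_1 by (intro LIMSEQ_realpow_zero) auto

lemma sc_tendsto: "sc a \<longlonglongrightarrow> 0"
  by (rule tendsto_sandwich[OF _ _ tendsto_const rmax_power_tendsto])
     (auto intro!: always_eventually sc_le less_imp_le[OF sc_pos])

lemma prefix_cong:
  assumes "\<And>i. i < n \<Longrightarrow> a i = b i"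
  shows "sc a n = sc b n" "sg a n = sg b n" "pr a n = pr b n" "tr a n = tr b n"
proof -
  have "sg a m = sg b m" if "m \<le> n" for m
    unfolding sg_def using assms that by (intro prod.cong) auto
  with assms show "sc a n = sc b n" "sg a n = sg b n" "pr a n = pr b n" "tr a n = tr b n"
    unfolding sc_def pr_def tr_def by (auto intro!: prod.cong sum.cong)
qed

lemma shift_apply [simp]: "shift n a i = a (n + i)"
  by (simp add: shift_def)

lemma shift_shift: "shift m (shift n a) = shift (n + m) a"
  by (simp add: shift_def add.assoc)

lemma shift_comb_seq: "shift n (comb_seq n a b) = b"
  by (auto simp: shift_def comb_seq_def)

lemma sc_add: "sc a (m + n) = sc a m * sc (shift m a) n"
  by (induction n) (simp_all add: sc_Suc shift_def)

lemma sg_add: "sg a (m + n) = sg a m * sg (shift m a) n"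
  by (induction n) (simp_all add: sg_Suc shift_def)

lemma tr_add: "tr a (m + n) = tr a m + sg a m * tr (shift m a) n"
proof (induction n)
  case (Suc n)
  show ?case
    unfolding add_Suc_right tr_Suc Suc.IH sg_add shift_apply by (simp add: distrib_left mult.assoc)
qed simp

lemma norm_term_le: "norm (sg a n * v (a n)) \<le> rmax ^ n * Max (range (\<lambda>i. \<bar>v i\<bar>))"
  by (auto simp: abs_mult abs_sg intro!: mult_mono sc_le zero_le_power less_imp_le[OF rmax_pos])

lemma summable_bnd: "summable (\<lambda>n. rmax ^ n * Max (range (\<lambda>i. \<bar>v i\<bar>)))"
  using rmax_pos rmax_less_1 by (intro summable_mult2 summable_geometric) auto

lemma summable_cod: "summable (\<lambda>n. sg a n * v (a n))"
  by (rule summable_comparison_test'[OF summable_bnd norm_term_le])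

lemma abs_cod_le: "\<bar>cod a\<bar> \<le> bnd"
proof -
  have "norm (cod a) \<le> (\<Sum>n. rmax ^ n * Max (range (\<lambda>i. \<bar>v i\<bar>)))"
    unfolding cod_def by (rule norm_suminf_le[OF norm_term_le summable_bnd])
  then show ?thesis by (simp add: bnd_def)
qed

lemma bnd_ge_1: "1 \<le> bnd"
proof -
  have "0 \<le> Max (range (\<lambda>i. \<bar>v i\<bar>))"
    by (auto simp: Max_ge_iff)
  then show ?thesis
    using rmax_pos unfolding bnd_def by (simp add: suminf_nonneg summable_bnd)
qed

lemma tr_tendsto: "tr a \<longlonglongrightarrow> cod a"
  unfolding tr_def cod_def using summable_LIMSEQ[OF summable_cod] by simp

lemma cod_split: "cod a = tr a n + sg a n * cod (shift n a)"
proof -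
  have "(\<lambda>m. tr a (m + n)) \<longlonglongrightarrow> cod a"
    by (rule LIMSEQ_ignore_initial_segment[OF tr_tendsto])
  moreover have "tr a (m + n) = tr a n + sg a n * tr (shift n a) m" for m
    using tr_add[of a n m] by (simp add: add.commute)
  ultimately have "(\<lambda>m. tr a n + sg a n * tr (shift n a) m) \<longlonglongrightarrow> cod a" by simp
  moreover have "(\<lambda>m. tr a n + sg a n * tr (shift n a) m) \<longlonglongrightarrow> tr a n + sg a n * cod (shift n a)"
    by (intro tendsto_intros tr_tendsto)
  ultimately show ?thesis by (rule LIMSEQ_unique)
qed

lemma cod_minus_tr: "\<bar>cod a - tr a n\<bar> \<le> sc a n * bnd"
  using cod_split[of a n] abs_cod_le[of "shift n a"] sc_pos[of a n]
  by (simp add: abs_mult abs_sg)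

lemma cod_diff_le: "(\<And>i. i < n \<Longrightarrow> a i = b i) \<Longrightarrow> \<bar>cod a - cod b\<bar> \<le> sc a n * (2 * bnd)"
  using cod_minus_tr[of a n] cod_minus_tr[of b n] prefix_cong[of n a b] by simp

lemma cod_comb_seq: "cod (comb_seq n a b) = tr a n + sg a n * cod b"
  using cod_split[of "comb_seq n a b" n] prefix_cong[of n "comb_seq n a b" a]
  by (simp add: shift_comb_seq comb_seq_less)

section \<open>The attractor as the range of the coding map\<close>

abbreviation f :: "'i \<Rightarrow> real \<Rightarrow> real" where "f \<equiv> ifs_map r u v"

lemma word_map_eq: "word_map f a n x = tr a n + sg a n * x"
  by (induction n arbitrary: x) (simp_all add: tr_Suc sg_Suc ifs_map_def algebra_simps)

lemma sg_tendsto: "sg a \<longlonglongrightarrow> 0"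
  by (rule tendsto_rabs_zero_cancel) (simp add: abs_sg sc_tendsto)

lemma word_map_tendsto: "(\<lambda>n. word_map f a n x) \<longlonglongrightarrow> cod a"
  unfolding word_map_eq using tendsto_add[OF tr_tendsto tendsto_mult[OF sg_tendsto tendsto_const], of a a x]
  by simp

lemma coding_map_eq: "coding_map f a = cod a"
  unfolding coding_map_def
proof (rule the_equality)
  show "y = cod a" if "\<forall>x. (\<lambda>n. word_map f a n x) \<longlonglongrightarrow> y" for y
    using LIMSEQ_unique[OF spec[OF that] word_map_tendsto] .
qed (simp add: word_map_tendsto)

lemma f_cod: "f i (cod a) = cod (case_nat i a)"
proof -
  have "cod (comb_seq 1 (\<lambda>_. i) a) = f i (cod a)"
    unfolding cod_comb_seq by (simp add: ifs_map_def tr_def sg_def)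
  then show ?thesis by simp
qed

lemma cod_eq_f: "cod a = f (a 0) (cod (shift 1 a))"
proof -
  have "case_nat (a 0) (shift 1 a) = a"
    by (auto split: nat.split)
  then show ?thesis by (simp add: f_cod)
qed

lemma cod_in: "cod a \<in> f (a 0) ` range cod"
  by (rule image_eqI, rule cod_eq_f, rule rangeI)

lemma range_cod_invariant: "range cod = (\<Union>i. f i ` range cod)"
proof (intro equalityI subsetI)
  fix x assume "x \<in> range cod"
  then obtain a where "x = cod a" by (rule rangeE)
  then have "x \<in> f (a 0) ` range cod" by (simp only: cod_in)
  then show "x \<in> (\<Union>i. f i ` range cod)" by (rule UN_I[OF UNIV_I])
next
  fix x assume "x \<in> (\<Union>i. f i ` range cod)"
  then obtain i a where "x = f i (cod a)" by auto
  then show "x \<in> range cod" by (simp add: f_cod)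
qed

lemma continuous_f: "continuous_on A (f i)"
  unfolding ifs_map_def by (intro continuous_intros)

text \<open>Uniqueness of the attractor by addresses in place of the Hausdorff metric. A point of
  \<open>X\<close> is pulled back inside \<open>X\<close> for ever; since \<open>X\<close> is
  bounded, the contracted remainder tends to 0, and the letters used form an address of the point.
  Conversely, the images of one point of \<open>X\<close> under the prefixes of a word stay in the
  closed set \<open>X\<close> and converge to the code of the word.\<close>

lemma compact_invariant_eq_range_cod:
  assumes X: "X \<noteq> {}" "compact X" "X = (\<Union>i. f i ` X)"
  shows "X = range cod"
proof (intro equalityI subsetI)
  fix x assume "x \<in> X"
  have ex: "\<exists>i y. y \<in> X \<and> z = f i y" if "z \<in> X" for z
    using that X(3) by blast
  \<comment> \<open>A backward orbit of \<open>x\<close> inside \<open>X\<close>; the word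
    \<open>a\<close> obtained below consists of the maps that lead forward again.\<close>
  define g where "g = rec_nat x (\<lambda>_ z. SOME y. y \<in> X \<and> (\<exists>i. z = f i y))"
  have gS: "g (Suc n) \<in> X \<and> (\<exists>i. g n = f i (g (Suc n)))" if "g n \<in> X" for n
  proof -
    have "\<exists>y. y \<in> X \<and> (\<exists>i. g n = f i y)" using ex[OF that] by blast
    from someI_ex[OF this] show ?thesis by (simp add: g_def)
  qed
  have gX: "g n \<in> X" for n
    by (induction n) (use gS \<open>x \<in> X\<close> in \<open>auto simp: g_def\<close>)
  then have "\<forall>n. \<exists>i. g n = f i (g (Suc n))" using gS by blast
  then obtain a where a: "g n = f (a n) (g (Suc n))" for n by metis
  have "word_map f a n (g n) = x" for n
  proof (induction n)
    case 0
    show ?case by (simp add: g_def)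
  next
    case (Suc n)
    then show ?case using a[of n] by simp
  qed
  then have eq: "tr a n + sg a n * g n = x" for n by (simp add: word_map_eq)
  obtain C where C: "\<And>z. z \<in> X \<Longrightarrow> \<bar>z\<bar> \<le> C"
    using compact_imp_bounded[OF X(2)] by (auto simp: bounded_iff)
  have "(\<lambda>n. sg a n * g n) \<longlonglongrightarrow> 0"
  proof (rule tendsto_rabs_zero_cancel, rule tendsto_sandwich[OF _ _ tendsto_const])
    show "(\<lambda>n. sc a n * C) \<longlonglongrightarrow> 0"
      using tendsto_mult[OF sc_tendsto[of a] tendsto_const[of C]] by simp
    have "\<bar>sg a n * g n\<bar> \<le> sc a n * C" for n
      using C[OF gX, of n] less_imp_le[OF sc_pos[of a n]]
      by (simp add: abs_mult abs_sg mult_left_mono)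
    then show "\<forall>\<^sub>F n in sequentially. \<bar>sg a n * g n\<bar> \<le> sc a n * C" by simp
  qed simp
  from tendsto_add[OF tr_tendsto[of a] this] have "(\<lambda>n. x) \<longlonglongrightarrow> cod a" by (simp add: eq)
  then show "x \<in> range cod" by (auto simp: LIMSEQ_const_iff)
next
  fix x assume "x \<in> range cod"
  then obtain a where a: "x = cod a" by blast
  obtain y where y: "y \<in> X" using X(1) by blast
  have "word_map f b n z \<in> X" if "z \<in> X" for b n z
    using that
  proof (induction n arbitrary: z)
    case (Suc n)
    then have "f (b n) z \<in> X" using X(3) by blast
    then show ?case using Suc by simp
  qed simp
  from closed_sequentially[OF compact_imp_closed[OF X(2)] this[OF y] word_map_tendsto, of a]
  show "x \<in> X" by (simp add: a)
qed

text \<open>No topology on words is used: the closure of the range is compact and again invariant,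
  so the uniqueness just proved identifies it with the range.\<close>

lemma compact_range_cod: "compact (range cod)"
proof -
  let ?X = "closure (range cod)"
  have "bounded (range cod)"
    by (rule boundedI[of _ bnd]) (auto simp: abs_cod_le)
  then have cX: "compact ?X" by (simp add: compact_closure)
  have "?X = closure (\<Union>i. f i ` range cod)"
    by (rule arg_cong[OF range_cod_invariant])
  also have "\<dots> = (\<Union>i. closure (f i ` range cod))"
  proof
    have "closed (\<Union>i. closure (f i ` range cod))"
      by (rule closed_UN) auto
    moreover have "(\<Union>i. f i ` range cod) \<subseteq> (\<Union>i. closure (f i ` range cod))"
      by (rule UN_mono[OF subset_refl closure_subset])
    ultimately show "closure (\<Union>i. f i ` range cod) \<subseteq> (\<Union>i. closure (f i ` range cod))"
      by (rule closure_minimal[rotated])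
    show "(\<Union>i. closure (f i ` range cod)) \<subseteq> closure (\<Union>i. f i ` range cod)"
      by (rule UN_least, rule closure_mono, rule UN_upper, rule UNIV_I)
  qed
  also have "\<dots> = (\<Union>i. f i ` ?X)"
  proof (rule SUP_cong[OF refl], rule equalityI)
    fix i
    show "closure (f i ` range cod) \<subseteq> f i ` ?X"
      by (rule closure_minimal[OF image_mono[OF closure_subset]
            compact_imp_closed[OF compact_continuous_image[OF continuous_f cX]]])
    show "f i ` ?X \<subseteq> closure (f i ` range cod)"
      by (rule image_closure_subset[OF continuous_f closed_closure closure_subset])
  qed
  finally have "?X = (\<Union>i. f i ` ?X)" .
  from compact_invariant_eq_range_cod[OF _ cX this] have "?X = range cod" by simp
  with cX show ?thesis by simp
qed

lemma attractor_eq: "attractor f = range cod"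
  unfolding attractor_def
proof (rule the_equality)
  show "range cod \<noteq> {} \<and> compact (range cod) \<and> range cod = (\<Union>i. f i ` range cod)"
    by (intro conjI range_cod_invariant compact_range_cod) simp
  show "X = range cod" if "X \<noteq> {} \<and> compact X \<and> X = (\<Union>i. f i ` X)" for X
    using that by (elim conjE) (rule compact_invariant_eq_range_cod)
qed

text \<open>Disjoint compact pieces have positive distance, and there are finitely many pairs of
  pieces.\<close>

lemma separation_gap:
  assumes "strong_separation f"
  obtains D where "D > 0" "\<And>a b. a 0 \<noteq> b 0 \<Longrightarrow> D \<le> \<bar>cod a - cod b\<bar>"
proof -
  define gap where "gap d i j \<longleftrightarrow> d > 0 \<and> (\<forall>x\<in>f i ` range cod. \<forall>y\<in>f j ` range cod. d \<le> \<bar>x - y\<bar>)"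
    for d i j
  have "\<exists>d. gap d i j" if "i \<noteq> j" for i j
  proof -
    have "f i ` range cod \<inter> f j ` range cod = {}"
      using assms that by (auto simp: strong_separation_def attractor_eq disjoint_family_on_def)
    moreover have "compact (f i ` range cod)" "closed (f j ` range cod)"
      by (intro compact_imp_closed compact_continuous_image continuous_f compact_range_cod)+
    ultimately show ?thesis
      using separate_compact_closed[of "f i ` range cod" "f j ` range cod"]
      by (simp add: dist_real_def gap_def)
  qed
  then obtain d where gap: "\<And>i j. i \<noteq> j \<Longrightarrow> gap (d i j) i j" by metis
  have d: "d i j > 0" "\<And>x y. x \<in> f i ` range cod \<Longrightarrow> y \<in> f j ` range cod \<Longrightarrow> d i j \<le> \<bar>x - y\<bar>"
    if "i \<noteq> j" for i j
    using gap[OF that] unfolding gap_def by blast+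
  \<comment> \<open>The 1 keeps the minimum meaningful when there is only one letter.\<close>
  define D where "D = Min (insert 1 ((\<lambda>(i, j). d i j) ` {(i, j). i \<noteq> j}))"
  have fin: "finite (insert 1 ((\<lambda>(i, j). d i j) ` {(i, j). i \<noteq> j}))"
    by (intro finite.insertI finite_imageI) (rule finite)
  have "D > 0"
    unfolding D_def using fin d(1) by (subst Min_gr_iff) auto
  moreover have "D \<le> \<bar>cod a - cod b\<bar>" if "a 0 \<noteq> b 0" for a b
  proof -
    have "d (a 0) (b 0) \<le> \<bar>cod a - cod b\<bar>" by (rule d(2)[OF that]; rule cod_in)
    moreover have "D \<le> d (a 0) (b 0)"
      unfolding D_def by (rule Min_le[OF fin], rule insertI2, rule image_eqI[of _ _ "(a 0, b 0)"])
        (simp_all add: that)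
    ultimately show ?thesis by simp
  qed
  ultimately show ?thesis using that by blast
qed

text \<open>At the first disagreement the codes enter different pieces of the attractor, scaled by
  the contraction of the common prefix. If this happened at or before index \<open>n\<close>, the
  distance would be at least \<open>D * sc a n\<close>.\<close>

lemma close_imp_prefix:
  assumes D: "\<And>a b. a 0 \<noteq> b 0 \<Longrightarrow> D \<le> \<bar>cod a - cod b\<bar>"
    and close: "\<bar>cod a - cod b\<bar> < D * sc a n" and D0: "D > 0" and "i \<le> n"
  shows "a i = b i"
proof (rule ccontr)
  assume "a i \<noteq> b i"
  define m where "m = (LEAST j. a j \<noteq> b j)"
  have m: "a m \<noteq> b m"
    using LeastI[of "\<lambda>j. a j \<noteq> b j", OF \<open>a i \<noteq> b i\<close>] unfolding m_def .
  have "m \<le> i"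
    using Least_le[of "\<lambda>j. a j \<noteq> b j", OF \<open>a i \<noteq> b i\<close>] unfolding m_def .
  have lt: "a j = b j" if "j < m" for j
    using not_less_Least[OF that[unfolded m_def]] by simp
  have "tr a m = tr b m" "sg a m = sg b m"
    using prefix_cong(2,4)[of m a b] lt by simp_all
  moreover have "cod a - cod b = (tr a m + sg a m * cod (shift m a)) - (tr b m + sg b m * cod (shift m b))"
    by (rule arg_cong2[of _ _ _ _ minus]; rule cod_split)
  ultimately have "cod a - cod b = sg a m * (cod (shift m a) - cod (shift m b))"
    by (simp only: right_diff_distrib)
  then have eq: "\<bar>cod a - cod b\<bar> = sc a m * \<bar>cod (shift m a) - cod (shift m b)\<bar>"
    by (simp add: abs_mult abs_sg)
  have "D \<le> \<bar>cod (shift m a) - cod (shift m b)\<bar>"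
    by (rule D) (simp add: m)
  then have "sc a m * D \<le> \<bar>cod a - cod b\<bar>"
    unfolding eq by (rule mult_left_mono) (rule less_imp_le[OF sc_pos])
  moreover have "sc a n * D \<le> sc a m * D"
    by (rule mult_right_mono[OF sc_antimono]) (use \<open>m \<le> i\<close> \<open>i \<le> n\<close> D0 in simp_all)
  ultimately show False using close mult.commute[of D "sc a n"] by linarith
qed

end

section \<open>The product measure on sequences\<close>

lemma (in prob_space) ex_large_of_AE_nat:
  fixes A :: "nat \<Rightarrow> 'a set"
  assumes "\<And>k. A k \<in> sets M" "incseq A" "AE x in M. \<exists>k. x \<in> A k" "\<epsilon> > 0"
  shows "\<exists>k. 1 - \<epsilon> < prob (A k)"
proof -
  have U: "(\<Union>k. A k) \<in> sets M" using assms(1) by (intro sets.countable_UN) auto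
  moreover have "AE x in M. x \<in> (\<Union>k. A k)" using assms(3) by simp
  ultimately have "prob (\<Union>k. A k) = 1" by (simp add: prob_eq_1)
  moreover have "(\<lambda>i. prob (A i)) \<longlonglongrightarrow> prob (\<Union>i. A i)"
    using assms(1,2) by (intro finite_Lim_measure_incseq) auto
  ultimately have "(\<lambda>i. prob (A i)) \<longlonglongrightarrow> 1" by simp
  from order_tendstoD(1)[OF this, of "1 - \<epsilon>"] assms(4)
  have "\<forall>\<^sub>F i in sequentially. 1 - \<epsilon> < prob (A i)" by simp
  then show ?thesis by (auto simp: eventually_sequentially)
qed

text \<open>Multiplicative constants disappear after division by \<open>ln r\<close>, which tends to
  minus infinity, so only the exponents matter.\<close>

lemma ln_ratio_tendsto:
  fixes F :: "real \<Rightarrow> real"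
  assumes upper: "\<And>\<delta>. \<delta> > 0 \<Longrightarrow> \<exists>C>0. \<forall>\<^sub>F r in at_right 0. F r \<le> C * r powr (\<alpha> - \<delta>)"
    and lower: "\<And>\<delta>. \<delta> > 0 \<Longrightarrow> \<exists>C>0. \<forall>\<^sub>F r in at_right 0. C * r powr (\<alpha> + \<delta>) \<le> F r"
  shows "((\<lambda>r. ln (F r) / ln r) \<longlongrightarrow> \<alpha>) (at_right 0)"
proof (rule tendstoI)
  fix e :: real assume "e > 0"
  \<comment> \<open>One \<delta> is lost in the exponent and one to the constant; a third remains
    for strictness.\<close>
  define \<delta> where "\<delta> = e / 3"
  have \<delta>: "\<delta> > 0" "2 * \<delta> < e" using \<open>e > 0\<close> by (auto simp: \<delta>_def)
  obtain C where C: "C > 0" "\<forall>\<^sub>F r in at_right 0. F r \<le> C * r powr (\<alpha> - \<delta>)" using upper[OF \<delta>(1)] by blast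
  obtain c where c: "c > 0" "\<forall>\<^sub>F r in at_right 0. c * r powr (\<alpha> + \<delta>) \<le> F r" using lower[OF \<delta>(1)] by blast
  have "\<forall>\<^sub>F r in at_right (0::real). ln r \<le> Z" for Z
    using ln_at_0 by (simp add: filterlim_at_bot)
  from this[of "- ln C / \<delta>"] this[of "ln c / \<delta>"]
  have ev1: "\<forall>\<^sub>F r in at_right (0::real). ln C \<le> - \<delta> * ln r"
    and ev2: "\<forall>\<^sub>F r in at_right (0::real). - ln c \<le> - \<delta> * ln r"
    using \<delta>(1) by (auto simp: field_simps elim!: eventually_mono)
  have ev3: "\<forall>\<^sub>F r in at_right (0::real). 0 < r \<and> r < 1"
    by (auto simp: eventually_at_right_field intro: exI[of _ 1])
  show "\<forall>\<^sub>F r in at_right 0. dist (ln (F r) / ln r) \<alpha> < e"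
    using C(2) c(2) ev1 ev2 ev3
  proof eventually_elim
    case (elim r)
    then have l: "ln r < 0" and r: "0 < r" by auto
    have "0 < c * r powr (\<alpha> + \<delta>)" using r c(1) by simp
    then have F: "F r > 0" using elim(2) by (rule less_le_trans)
    have "ln (F r) \<le> ln (C * r powr (\<alpha> - \<delta>))" using elim F by (intro ln_mono) auto
    also have "\<dots> = ln C + (\<alpha> - \<delta>) * ln r" using elim C(1) by (simp add: ln_mult ln_powr)
    finally have 1: "ln (F r) \<le> (\<alpha> - 2 * \<delta>) * ln r" using elim by (simp add: algebra_simps)
    have "ln c + (\<alpha> + \<delta>) * ln r = ln (c * r powr (\<alpha> + \<delta>))" using elim c(1) by (simp add: ln_mult ln_powr)
    also have "\<dots> \<le> ln (F r)" using elim c(1) F by (intro ln_mono) auto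
    finally have 2: "(\<alpha> + 2 * \<delta>) * ln r \<le> ln (F r)" using elim by (simp add: algebra_simps)
    have "\<alpha> - 2 * \<delta> \<le> ln (F r) / ln r" "ln (F r) / ln r \<le> \<alpha> + 2 * \<delta>"
      using 1 2 l by (simp_all add: neg_le_divide_eq neg_divide_le_eq)
    then show ?case using \<delta> by (auto simp: dist_real_def)
  qed
qed

text \<open>The exponential moment is 1 at \<open>s = 0\<close> and its derivative there is the
  mean, so a negative mean pushes it below 1 for small positive \<open>s\<close>. This is the input
  of a Chernoff bound.\<close>

lemma ex_exponential_moment_less_1:
  fixes g q :: "'i::finite \<Rightarrow> real"
  assumes "(\<Sum>i\<in>UNIV. q i) = 1" "(\<Sum>i\<in>UNIV. q i * g i) < 0"
  shows "\<exists>s>0. (\<Sum>i\<in>UNIV. q i * exp (s * g i)) < 1"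
proof -
  define \<phi> where "\<phi> s = (\<Sum>i\<in>UNIV. q i * exp (s * g i))" for s
  have "(\<phi> has_real_derivative (\<Sum>i\<in>UNIV. q i * g i)) (at 0)"
    unfolding \<phi>_def by (auto intro!: derivative_eq_intros sum.cong)
  from DERIV_neg_dec_right[OF this assms(2)]
  obtain d where d: "d > 0" "\<And>h. 0 < h \<Longrightarrow> h < d \<Longrightarrow> \<phi> h < \<phi> 0" by auto
  have "\<phi> 0 = 1" using assms(1) by (simp add: \<phi>_def)
  then show ?thesis using d(1) d(2)[of "d / 2"] unfolding \<phi>_def by (intro exI[of _ "d / 2"]) auto
qed

context weighted_ifs
begin

abbreviation letter :: "'i measure" where "letter \<equiv> point_measure UNIV (\<lambda>i. ennreal (p i))"

abbreviation P :: "(nat \<Rightarrow> 'i) measure" where "P \<equiv> (\<Pi>\<^sub>M n\<in>(UNIV :: nat set). letter)"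

lemma prob_space_letter: "prob_space letter"
proof
  have "emeasure letter (space letter) = (\<Sum>i\<in>UNIV. ennreal (p i))"
    by (simp add: space_point_measure emeasure_point_measure_finite)
  also have "\<dots> = 1"
    using p_pos by (subst sum_ennreal) (auto intro: less_imp_le simp: sum_p)
  finally show "emeasure letter (space letter) = 1" .
qed

sublocale seq: sequence_space letter
  unfolding sequence_space_def by (rule product_prob_spaceI) (rule prob_space_letter)

sublocale PP: pair_prob_space P P ..

lemma space_P [simp]: "space P = UNIV"
  by (auto simp: space_PiM space_point_measure)

section \<open>Functions of finitely many letters\<close>

definition determined :: "nat \<Rightarrow> ((nat \<Rightarrow> 'i) \<Rightarrow> 'b) \<Rightarrow> bool" where
  "determined n g \<longleftrightarrow> (\<forall>a b. (\<forall>i<n. a i = b i) \<longrightarrow> g a = g b)"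

lemma measurable_cylinder [measurable]: "{b. \<forall>i<n. b i = w i} \<in> sets P"
proof -
  have "Measurable.pred P (\<lambda>b. b i = w i)" for i
  proof -
    have "(\<lambda>b. b i) -` {w i} \<inter> space P \<in> sets P"
      by (rule measurable_sets[OF measurable_component_singleton]) auto
    then show ?thesis by (simp add: pred_def vimage_def)
  qed
  then have "Measurable.pred P (\<lambda>b. \<forall>i<n. b i = w i)" by measurable
  then show ?thesis by (simp add: pred_def)
qed

text \<open>Over a finite alphabet there are only finitely many prefixes of length \<open>n\<close>,
  so every preimage is a finite union of cylinders, whatever the target space is.\<close>

lemma measurable_determined:
  assumes "determined n g" and g: "g \<in> UNIV \<rightarrow> space N"
  shows "g \<in> measurable P N"
proof (rule measurableI)
  fix A assume "A \<in> sets N"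
  define W where "W = PiE {..<n} (\<lambda>_. UNIV :: 'i set)"
  have "finite W" unfolding W_def by (intro finite_PiE) auto
  have eq: "g -` A \<inter> space P = (\<Union>w\<in>{w\<in>W. g w \<in> A}. {b. \<forall>i<n. b i = w i})"
  proof (intro equalityI subsetI)
    fix a assume a: "a \<in> g -` A \<inter> space P"
    have "g (restrict a {..<n}) = g a" using assms(1) unfolding determined_def by auto
    moreover have "restrict a {..<n} \<in> W" by (auto simp: W_def)
    ultimately show "a \<in> (\<Union>w\<in>{w\<in>W. g w \<in> A}. {b. \<forall>i<n. b i = w i})" using a by force
  next
    fix a assume "a \<in> (\<Union>w\<in>{w\<in>W. g w \<in> A}. {b. \<forall>i<n. b i = w i})"
    then obtain w where "g w \<in> A" "\<forall>i<n. a i = w i" by auto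
    moreover from this(2) have "g a = g w" using assms(1) unfolding determined_def by blast
    ultimately show "a \<in> g -` A \<inter> space P" by simp
  qed
  show "g -` A \<inter> space P \<in> sets P"
    unfolding eq using \<open>finite W\<close> by (intro sets.finite_UN) auto
qed (use g in auto)

lemma sets_determined: "determined n Q \<Longrightarrow> {a. Q a} \<in> sets P"
  using measurable_sets[OF measurable_determined[of n Q "count_space UNIV"], of "{True}"]
  by (simp add: vimage_def)

lemma determined_prefix: "determined n (\<lambda>a. sc a n)" "determined n (\<lambda>a. sg a n)"
  "determined n (\<lambda>a. pr a n)" "determined n (\<lambda>a. tr a n)"
  unfolding determined_def using prefix_cong[of n] by blast+

lemma measurable_prefix [measurable]:
  "(\<lambda>a. sc a n) \<in> borel_measurable P" "(\<lambda>a. sg a n) \<in> borel_measurable P"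
  "(\<lambda>a. pr a n) \<in> borel_measurable P" "(\<lambda>a. tr a n) \<in> borel_measurable P"
  by (rule measurable_determined[OF determined_prefix(1)] measurable_determined[OF determined_prefix(2)]
      measurable_determined[OF determined_prefix(3)] measurable_determined[OF determined_prefix(4)], simp)+

lemma measurable_cod [measurable]: "cod \<in> borel_measurable P"
  by (rule borel_measurable_LIMSEQ_real[OF tr_tendsto]) measurable

lemma self_similar_measure_eq: "self_similar_measure f p = distr P borel cod"
  unfolding self_similar_measure_def using coding_map_eq by (intro distr_cong) auto

lemma nn_integral_comb_seq:
  assumes [measurable]: "h \<in> borel_measurable P"
  shows "(\<integral>\<^sup>+a. h a \<partial>P) = (\<integral>\<^sup>+a. \<integral>\<^sup>+b. h (comb_seq n a b) \<partial>P \<partial>P)"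
proof -
  have "(\<integral>\<^sup>+a. h a \<partial>P) = (\<integral>\<^sup>+x. h x \<partial>distr (P \<Otimes>\<^sub>M P) P (\<lambda>(a, b). comb_seq n a b))"
    by (simp only: seq.PiM_comb_seq)
  also have "\<dots> = (\<integral>\<^sup>+x. h (case x of (a, b) \<Rightarrow> comb_seq n a b) \<partial>(P \<Otimes>\<^sub>M P))"
    by (rule nn_integral_distr[OF measurable_comb_seq]) measurable
  also have "\<dots> = (\<integral>\<^sup>+a. \<integral>\<^sup>+b. h (comb_seq n a b) \<partial>P \<partial>P)"
    by (subst seq.P.nn_integral_fst[symmetric]) auto
  finally show ?thesis .
qed

lemma nn_integral_coordinate: "(\<integral>\<^sup>+a. h (a n) \<partial>P) = (\<Sum>i\<in>UNIV. ennreal (p i) * h i)"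
proof -
  have "(\<integral>\<^sup>+a. h (a n) \<partial>P) = (\<integral>\<^sup>+x. h x \<partial>distr P letter (\<lambda>a. a n))"
    by (subst nn_integral_distr[OF measurable_component_singleton]) auto
  also have "\<dots> = (\<Sum>i\<in>UNIV. ennreal (p i) * h i)"
    using seq.PiM_component[of n] by (simp add: nn_integral_point_measure_finite)
  finally show ?thesis .
qed

lemma emeasure_cylinder: "emeasure P {b. \<forall>i<n. b i = w i} = ennreal (pr w n)"
proof (induction n)
  case 0
  show ?case using seq.P.emeasure_space_1 by simp
next
  case (Suc n)
  have "emeasure P {b. \<forall>i<Suc n. b i = w i} = (\<integral>\<^sup>+a. indicator {b. \<forall>i<Suc n. b i = w i} a \<partial>P)"
    by (rule nn_integral_indicator[symmetric]) (rule measurable_cylinder)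
  also have "\<dots> = (\<integral>\<^sup>+a. \<integral>\<^sup>+b. indicator {b. \<forall>i<Suc n. b i = w i} (comb_seq n a b) \<partial>P \<partial>P)"
    by (rule nn_integral_comb_seq) (intro borel_measurable_indicator measurable_cylinder)
  also have "\<dots> = (\<integral>\<^sup>+a. \<integral>\<^sup>+b. indicator {b. \<forall>i<n. b i = w i} a * indicator {w n} (b 0) \<partial>P \<partial>P)"
    by (intro nn_integral_cong) (auto simp: comb_seq_def less_Suc_eq split: split_indicator)
  also have "\<dots> = (\<integral>\<^sup>+a. indicator {b. \<forall>i<n. b i = w i} a * ennreal (p (w n)) \<partial>P)"
    using nn_integral_coordinate[of "indicator {w n}" 0]
    by (intro nn_integral_cong) (auto split: split_indicator simp: indicator_def if_distrib cong: if_cong)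
  also have "\<dots> = ennreal (pr w (Suc n))"
    using less_imp_le[OF pr_pos] less_imp_le[OF p_pos]
    by (simp add: nn_integral_multc Suc.IH pr_Suc ennreal_mult measurable_cylinder)
  finally show ?case .
qed

section \<open>Exponential moments and almost sure growth rates\<close>

lemma nn_integral_prod:
  "(\<integral>\<^sup>+a. (\<Prod>j<n. h (a j)) \<partial>P) = (\<Sum>i\<in>UNIV. ennreal (p i) * h i) ^ n" for h :: "'i \<Rightarrow> ennreal"
proof (induction n)
  case 0
  show ?case using seq.P.emeasure_space_1 by simp
next
  case (Suc n)
  have m: "determined k (\<lambda>a. \<Prod>j<k. h (a j))" for k
    unfolding determined_def by (auto intro!: prod.cong)
  have m0: "(\<lambda>a. h (a 0)) \<in> borel_measurable P"
    by (rule measurable_determined[of 1]) (auto simp: determined_def)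
  have "(\<integral>\<^sup>+a. (\<Prod>j<Suc n. h (a j)) \<partial>P) = (\<integral>\<^sup>+a. \<integral>\<^sup>+b. (\<Prod>j<Suc n. h (comb_seq 1 a b j)) \<partial>P \<partial>P)"
    by (rule nn_integral_comb_seq) (rule measurable_determined[OF m], simp)
  also have "\<dots> = (\<integral>\<^sup>+a. \<integral>\<^sup>+b. h (a 0) * (\<Prod>j<n. h (b j)) \<partial>P \<partial>P)"
    by (intro nn_integral_cong) (simp add: prod.lessThan_Suc_shift comb_seq_def del: prod.lessThan_Suc)
  also have "\<dots> = (\<integral>\<^sup>+a. h (a 0) * (\<Sum>i\<in>UNIV. ennreal (p i) * h i) ^ n \<partial>P)"
    using measurable_determined[OF m, where N = borel] by (simp add: nn_integral_cmult Suc.IH)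
  also have "\<dots> = (\<Sum>i\<in>UNIV. ennreal (p i) * h i) ^ Suc n"
    by (simp add: nn_integral_multc m0 nn_integral_coordinate)
  finally show ?case .
qed

text \<open>One half of a law of large numbers, by Chernoff and Borel-Cantelli. The eventual sign of
  the sums is enough, because exponents are always taken strictly on one side of the critical
  value.\<close>

lemma AE_sum_eventually_nonpos:
  assumes "(\<Sum>i\<in>UNIV. p i * g i) < 0"
  shows "AE a in P. \<forall>\<^sub>F n in sequentially. (\<Sum>j<n. g (a j)) \<le> 0"
proof -
  obtain s where s: "s > 0" "(\<Sum>i\<in>UNIV. p i * exp (s * g i)) < 1"
    using ex_exponential_moment_less_1[OF sum_p assms] by blast
  define q where "q = (\<Sum>i\<in>UNIV. p i * exp (s * g i))"
  have q: "0 \<le> q" "q < 1" using s less_imp_le[OF p_pos] by (auto simp: q_def intro!: sum_nonneg)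
  define A where "A n = {a :: nat \<Rightarrow> 'i. 0 < (\<Sum>j<n. g (a j))}" for n
  have "determined n (\<lambda>a. \<Sum>j<n. g (a j))" for n
    unfolding determined_def by (auto intro!: sum.cong)
  from measurable_determined[OF this, where N = borel]
  have m[measurable]: "(\<lambda>a. \<Sum>j<n. g (a j)) \<in> borel_measurable P" for n by simp
  have A[measurable]: "A n \<in> sets P" for n
  proof -
    have "{a \<in> space P. 0 < (\<Sum>j<n. g (a j))} \<in> sets P" by measurable
    then show ?thesis by (simp add: A_def)
  qed
  have "emeasure P (A n) \<le> ennreal (q ^ n)" for n
  proof -
    have "emeasure P (A n) = (\<integral>\<^sup>+a. indicator (A n) a \<partial>P)" by simp
    also have "\<dots> \<le> (\<integral>\<^sup>+a. (\<Prod>j<n. ennreal (exp (s * g (a j)))) \<partial>P)"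
    proof (rule nn_integral_mono)
      fix a
      have "(\<Prod>j<n. ennreal (exp (s * g (a j)))) = ennreal (exp (s * (\<Sum>j<n. g (a j))))"
        by (simp add: prod_ennreal exp_sum sum_distrib_left)
      then show "indicator (A n) a \<le> (\<Prod>j<n. ennreal (exp (s * g (a j))))"
        using s(1) by (auto simp: A_def split: split_indicator)
    qed
    also have "\<dots> = (\<Sum>i\<in>UNIV. ennreal (p i) * ennreal (exp (s * g i))) ^ n"
      by (rule nn_integral_prod)
    also have "(\<Sum>i\<in>UNIV. ennreal (p i) * ennreal (exp (s * g i))) = ennreal q"
      unfolding q_def using less_imp_le[OF p_pos]
      by (simp add: ennreal_mult[symmetric] sum_ennreal)
    finally show ?thesis using q by (simp add: ennreal_power)
  qed
  then have "measure P (A n) \<le> q ^ n" for n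
    using q by (simp add: seq.P.emeasure_eq_measure)
  then have "summable (\<lambda>n. measure P (A n))"
    using q by (intro summable_comparison_test'[OF summable_geometric[of q]]) auto
  then have "AE a in P. \<forall>\<^sub>F n in sequentially. a \<in> space P - A n"
    by (intro borel_cantelli_AE1) (auto simp: seq.P.emeasure_eq_measure)
  then show ?thesis by (auto simp: A_def not_less)
qed

text \<open>Entropy divided by Lyapunov exponent, with both signs reversed.\<close>

definition \<alpha> :: real where
  "\<alpha> = (\<Sum>i\<in>UNIV. p i * ln (p i)) / (\<Sum>i\<in>UNIV. p i * ln (r i))"

lemma lyapunov_neg: "(\<Sum>i\<in>UNIV. p i * ln (r i)) < 0"
proof -
  have "(\<Sum>i\<in>UNIV. p i * ln (r i)) < (\<Sum>i\<in>(UNIV :: 'i set). 0)"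
    by (rule sum_strict_mono) (auto simp: mult_pos_neg p_pos r_pos r_less_1)
  then show ?thesis by simp
qed

text \<open>This is the drift of \<open>ln (pr a n) - \<sigma> * ln (sc a n)\<close>. The last
  factor is negative, so the drift has the sign of \<open>\<sigma> - \<alpha>\<close>.\<close>

lemma sum_p_ln: "(\<Sum>i\<in>UNIV. p i * (ln (p i) - \<sigma> * ln (r i))) = (\<alpha> - \<sigma>) * (\<Sum>i\<in>UNIV. p i * ln (r i))"
proof -
  have "(\<Sum>i\<in>UNIV. p i * (ln (p i) - \<sigma> * ln (r i))) =
      (\<Sum>i\<in>UNIV. p i * ln (p i)) - \<sigma> * (\<Sum>i\<in>UNIV. p i * ln (r i))"
    by (simp add: right_diff_distrib sum_subtractf sum_distrib_left mult.left_commute)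
  then show ?thesis using lyapunov_neg unfolding \<alpha>_def by (simp add: left_diff_distrib)
qed

lemma sum_ln_letters: "(\<Sum>j<n. ln (p (a j)) - \<sigma> * ln (r (a j))) = ln (pr a n) - \<sigma> * ln (sc a n)"
proof -
  have "p i \<noteq> 0" "r i \<noteq> 0" for i
    using p_pos[of i] r_pos[of i] by auto
  then show ?thesis
    unfolding pr_def sc_def by (subst (1 2) ln_prod) (auto simp: sum_subtractf sum_distrib_left)
qed

lemma AE_pr_le:
  assumes "\<sigma> < \<alpha>"
  shows "AE a in P. \<forall>\<^sub>F n in sequentially. pr a n \<le> sc a n powr \<sigma>"
proof -
  have "(\<Sum>i\<in>UNIV. p i * (ln (p i) - \<sigma> * ln (r i))) < 0"
    unfolding sum_p_ln using assms lyapunov_neg by (simp add: mult_pos_neg)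
  from AE_sum_eventually_nonpos[OF this] show ?thesis
  proof eventually_elim
    case (elim a)
    then show ?case
    proof eventually_elim
      case (elim n)
      then have "ln (pr a n) \<le> ln (sc a n powr \<sigma>)"
        using sc_pos[of a n] by (simp add: sum_ln_letters ln_powr)
      then show ?case using pr_pos[of a n] sc_pos[of a n] by (subst (asm) ln_le_cancel_iff) auto
    qed
  qed
qed

lemma AE_pr_ge:
  assumes "\<alpha> < \<sigma>"
  shows "AE a in P. \<forall>\<^sub>F n in sequentially. sc a n powr \<sigma> \<le> pr a n"
proof -
  have "(\<Sum>i\<in>UNIV. p i * - (ln (p i) - \<sigma> * ln (r i))) = - ((\<alpha> - \<sigma>) * (\<Sum>i\<in>UNIV. p i * ln (r i)))"
    unfolding sum_p_ln[symmetric] by (simp only: mult_minus_right sum_negf)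
  also have "\<dots> < 0" using assms lyapunov_neg by (simp add: mult_neg_neg)
  finally have "(\<Sum>i\<in>UNIV. p i * - (ln (p i) - \<sigma> * ln (r i))) < 0" .
  from AE_sum_eventually_nonpos[OF this] show ?thesis
  proof eventually_elim
    case (elim a)
    then show ?case
    proof eventually_elim
      case (elim n)
      then have "- (ln (pr a n) - \<sigma> * ln (sc a n)) \<le> 0"
        unfolding sum_negf sum_ln_letters .
      then have "ln (sc a n powr \<sigma>) \<le> ln (pr a n)"
        using sc_pos[of a n] by (simp add: ln_powr)
      then show ?case using pr_pos[of a n] sc_pos[of a n] by (subst (asm) ln_le_cancel_iff) auto
    qed
  qed
qed

text \<open>An Egorov set: one \<open>K\<close> serves all lengths and all words of the set. It
  turns the almost sure bound into a uniform one outside a set of small probability.\<close>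

definition good :: "real \<Rightarrow> real \<Rightarrow> (nat \<Rightarrow> 'i) set" where
  "good \<sigma> K = {a. \<forall>n. pr a n \<le> K * sc a n powr \<sigma>}"

lemma good_measurable [measurable]: "good \<sigma> K \<in> sets P"
proof -
  have "determined n (\<lambda>a. pr a n \<le> K * sc a n powr \<sigma>)" for n
    using determined_prefix(1,3)[of n] unfolding determined_def by metis
  then have "(\<Inter>n. {a. pr a n \<le> K * sc a n powr \<sigma>}) \<in> sets P"
    by (intro sets.countable_INT) (auto intro: sets_determined)
  also have "(\<Inter>n. {a. pr a n \<le> K * sc a n powr \<sigma>}) = good \<sigma> K" by (auto simp: good_def)
  finally show ?thesis .
qed

lemma good_mono: "K \<le> K' \<Longrightarrow> good \<sigma> K \<subseteq> good \<sigma> K'"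
  unfolding good_def by (auto intro: order_trans[OF _ mult_right_mono])

lemma AE_good:
  assumes "\<sigma> < \<alpha>"
  shows "AE a in P. \<exists>k::nat. a \<in> good \<sigma> (real k)"
  using AE_pr_le[OF assms]
proof eventually_elim
  case (elim a)
  then obtain N where N: "\<And>n. n \<ge> N \<Longrightarrow> pr a n \<le> sc a n powr \<sigma>"
    by (auto simp: eventually_sequentially)
  \<comment> \<open>The sum takes care of the lengths below \<open>N\<close>, the 1 of all
    others.\<close>
  define B where "B = 1 + (\<Sum>n<N. pr a n / sc a n powr \<sigma>)"
  have B1: "B \<ge> 1" unfolding B_def using less_imp_le[OF pr_pos] by (auto intro!: sum_nonneg)
  obtain k :: nat where k: "B \<le> real k" using real_arch_simple by blast
  have "pr a n \<le> real k * sc a n powr \<sigma>" for n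
  proof (cases "n < N")
    case True
    have "pr a n / sc a n powr \<sigma> \<le> (\<Sum>n<N. pr a n / sc a n powr \<sigma>)"
      using True less_imp_le[OF pr_pos] by (intro member_le_sum) auto
    then have "pr a n / sc a n powr \<sigma> \<le> real k" using k by (simp add: B_def)
    then show ?thesis using sc_pos[of a n] by (simp add: divide_le_eq)
  next
    case False
    then have "pr a n \<le> 1 * sc a n powr \<sigma>" using N by simp
    also have "\<dots> \<le> real k * sc a n powr \<sigma>" using k B1 by (intro mult_right_mono) auto
    finally show ?thesis .
  qed
  then show ?case unfolding good_def by blast
qed

lemma ex_good:
  assumes "\<sigma> < \<alpha>" "\<epsilon> > 0"
  obtains K where "K \<ge> 1" "1 - \<epsilon> < measure P (good \<sigma> K)"
proof -
  have "\<exists>k. 1 - \<epsilon> < measure P (good \<sigma> (real k))"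
    using assms AE_good good_mono by (intro seq.P.ex_large_of_AE_nat) (auto simp: incseq_def)
  then obtain k where k: "1 - \<epsilon> < measure P (good \<sigma> (real k))" by blast
  also have "\<dots> \<le> measure P (good \<sigma> (max 1 (real k)))"
    by (intro seq.P.finite_measure_mono good_mono good_measurable) simp
  finally show ?thesis using that[of "max 1 (real k)"] by simp
qed

text \<open>By the separation gap the ball pulls back into one cylinder, that of the first length
  \<open>n\<close> with \<open>D * sc a n \<le> R\<close>: one letter earlier \<open>R\<close> is
  still below the gap, which forces agreement on \<open>n\<close> letters. If \<open>R\<close> is at
  least \<open>D\<close>, the right-hand side is at least 1.\<close>

lemma good_ball:
  assumes D: "\<And>a b. a 0 \<noteq> b 0 \<Longrightarrow> D \<le> \<bar>cod a - cod b\<bar>" "D > 0"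
    and a: "a \<in> good \<sigma> K" and "0 \<le> \<sigma>" "R > 0"
  shows "measure P {b. \<bar>cod a - cod b\<bar> \<le> R} \<le> K * (R / D) powr \<sigma>"
proof (cases "R < D")
  case True
  have "\<exists>n. D * sc a n \<le> R"
  proof -
    have "(\<lambda>n. D * sc a n) \<longlonglongrightarrow> D * 0" by (intro tendsto_intros sc_tendsto)
    then have "\<forall>\<^sub>F n in sequentially. D * sc a n < R" using \<open>R > 0\<close> by (auto dest: order_tendstoD)
    then show ?thesis using eventually_happens'[OF sequentially_bot] less_imp_le by blast
  qed
  define n where "n = (LEAST n. D * sc a n \<le> R)"
  have n: "D * sc a n \<le> R"
    using LeastI_ex[OF \<open>\<exists>n. D * sc a n \<le> R\<close>] unfolding n_def .
  have least: "\<not> D * sc a m \<le> R" if "m < n" for m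
    using not_less_Least that unfolding n_def by blast
  have "n \<noteq> 0" using n True by (cases n) auto
  then obtain m where m: "n = Suc m" by (cases n) auto
  then have "R < D * sc a m" using least[of m] by simp
  then have "{b. \<bar>cod a - cod b\<bar> \<le> R} \<subseteq> {b. \<forall>i<n. b i = a i}"
  proof (intro subsetI CollectI allI impI)
    fix b i assume "b \<in> {b. \<bar>cod a - cod b\<bar> \<le> R}" "i < n"
    then have "\<bar>cod a - cod b\<bar> < D * sc a m" "i \<le> m" using \<open>R < D * sc a m\<close> m by auto
    then show "b i = a i" using close_imp_prefix[OF D(1) _ D(2)] by metis
  qed
  then have "measure P {b. \<bar>cod a - cod b\<bar> \<le> R} \<le> measure P {b. \<forall>i<n. b i = a i}"
    by (intro seq.P.finite_measure_mono measurable_cylinder)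
  also have "\<dots> = pr a n"
    using emeasure_cylinder[of n a] less_imp_le[OF pr_pos] by (simp add: measure_def)
  also have "\<dots> \<le> K * sc a n powr \<sigma>" using a by (auto simp: good_def)
  also have "\<dots> \<le> K * (R / D) powr \<sigma>"
  proof (rule mult_left_mono)
    show "sc a n powr \<sigma> \<le> (R / D) powr \<sigma>"
      using n D(2) less_imp_le[OF sc_pos] \<open>0 \<le> \<sigma>\<close>
      by (intro powr_mono2) (auto simp: le_divide_eq mult.commute)
    have "pr a 0 \<le> K * sc a 0 powr \<sigma>" using a unfolding good_def by blast
    then show "0 \<le> K" by simp
  qed
  finally show ?thesis .
next
  case False
  have "pr a 0 \<le> K * sc a 0 powr \<sigma>" using a unfolding good_def by blast
  then have "1 \<le> K" by simp
  moreover have "1 \<le> (R / D) powr \<sigma>" using False D(2) \<open>0 \<le> \<sigma>\<close> by (intro ge_one_powr_ge_zero) auto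
  ultimately have "1 * 1 \<le> K * (R / D) powr \<sigma>" by (intro mult_mono) auto
  moreover have "measure P {b. \<bar>cod a - cod b\<bar> \<le> R} \<le> 1" by (rule seq.P.prob_le_1)
  ultimately show ?thesis by linarith
qed

end

section \<open>Local dimensions along dyadic radii\<close>

lemma eventually_le_imp_bounded_ratio:
  fixes x y :: "nat \<Rightarrow> real"
  assumes "\<forall>\<^sub>F n in sequentially. x n \<le> C * y n" "\<And>n. 0 < y n"
  shows "\<exists>k::nat. \<forall>n. x n \<le> real k * y n"
proof -
  obtain N where N: "\<And>n. n \<ge> N \<Longrightarrow> x n \<le> C * y n"
    using assms(1) by (auto simp: eventually_sequentially)
  define B where "B = \<bar>C\<bar> + (\<Sum>n<N. \<bar>x n\<bar> / y n)"
  obtain k :: nat where k: "B \<le> real k" using real_arch_simple by blast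
  have S: "0 \<le> (\<Sum>n<N. \<bar>x n\<bar> / y n)"
    using less_imp_le[OF assms(2)] by (intro sum_nonneg) auto
  have "x n \<le> real k * y n" for n
  proof (cases "n < N")
    case True
    have "\<bar>x n\<bar> / y n \<le> (\<Sum>n<N. \<bar>x n\<bar> / y n)"
      using True less_imp_le[OF assms(2)] by (intro member_le_sum[of n _ "\<lambda>n. \<bar>x n\<bar> / y n"]) auto
    then have "\<bar>x n\<bar> / y n \<le> real k" using k by (simp add: B_def)
    then show ?thesis using assms(2)[of n] by (simp add: divide_le_eq)
  next
    case False
    then have "x n \<le> C * y n" using N by simp
    also have "\<dots> \<le> real k * y n"
      using k S less_imp_le[OF assms(2)] by (intro mult_right_mono) (auto simp: B_def)
    finally show ?thesis .
  qed
  then show ?thesis by blast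
qed

text \<open>The exponent may have either sign, hence the \<open>max\<close> and the
  \<open>min\<close>.\<close>

lemma powr_comparable:
  fixes r t B s :: real
  assumes "0 < r" "r \<le> t" "t \<le> B * r"
  shows "t powr s \<le> max 1 (B powr s) * r powr s" "min 1 (B powr s) * r powr s \<le> t powr s"
proof -
  have B: "0 < B" using assms by (metis less_le_trans zero_less_mult_pos2)
  have t: "0 < t" using assms by simp
  have Br: "(B * r) powr s = B powr s * r powr s" using B assms by (simp add: powr_mult)
  show "t powr s \<le> max 1 (B powr s) * r powr s"
  proof (cases "0 \<le> s")
    case True
    then have "t powr s \<le> (B * r) powr s" using assms t by (intro powr_mono2) auto
    then show ?thesis unfolding Br by (rule order_trans) (intro mult_right_mono, auto)
  next
    case False
    then have "t powr s \<le> r powr s" using assms by (intro powr_mono2') auto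
    also have "\<dots> \<le> max 1 (B powr s) * r powr s"
      using mult_right_mono[of 1 "max 1 (B powr s)" "r powr s"] by simp
    finally show ?thesis .
  qed
  show "min 1 (B powr s) * r powr s \<le> t powr s"
  proof (cases "0 \<le> s")
    case True
    then have "r powr s \<le> t powr s" using assms by (intro powr_mono2) auto
    moreover have "min 1 (B powr s) * r powr s \<le> r powr s"
      using mult_right_mono[of "min 1 (B powr s)" 1 "r powr s"] by simp
    ultimately show ?thesis by linarith
  next
    case False
    then have "(B * r) powr s \<le> t powr s" using assms t by (intro powr_mono2') auto
    moreover have "min 1 (B powr s) * r powr s \<le> B powr s * r powr s"
      by (intro mult_right_mono) auto
    ultimately show ?thesis unfolding Br by linarith
  qed
qed

lemma ex_dyadic_between:
  fixes r :: real
  assumes "0 < r" "r \<le> 1"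
  obtains n :: nat where "r \<le> 1 / 2 ^ n" "1 / 2 ^ n < 2 * r"
proof -
  define n where "n = (LEAST n. (1 / 2 ^ n :: real) < 2 * r)"
  have "\<exists>n. (1 / 2 ^ n :: real) < 2 * r"
    using real_arch_pow_inv[of "2 * r" "1 / 2"] assms by (auto simp: power_one_over)
  then have n: "(1 / 2 ^ n :: real) < 2 * r" unfolding n_def by (rule LeastI_ex)
  have "r \<le> 1 / 2 ^ n"
  proof (cases n)
    case (Suc m)
    then have "\<not> (1 / 2 ^ m :: real) < 2 * r" using not_less_Least[of m "\<lambda>n. 1 / 2 ^ n < 2 * r"] unfolding n_def by simp
    then show ?thesis using Suc by (simp add: field_simps)
  qed (use assms in auto)
  with n that show ?thesis by blast
qed

text \<open>Radii, losses in the exponent and constants all range over countable sets, here and in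
  \<open>local_dim_le\<close>. The sets of such points are therefore Borel, and almost sure
  statements can be passed through \<open>distr\<close>.\<close>

definition local_dim_ge :: "real measure \<Rightarrow> real \<Rightarrow> real \<Rightarrow> bool" where
  "local_dim_ge \<theta> \<gamma> x \<longleftrightarrow> (\<forall>j::nat. \<exists>k::nat. \<forall>n::nat.
     measure \<theta> (cball x (1 / 2 ^ n)) \<le> k * (1 / 2 ^ n) powr (\<gamma> - 1 / Suc j))"

definition local_dim_le :: "real measure \<Rightarrow> real \<Rightarrow> real \<Rightarrow> bool" where
  "local_dim_le \<theta> \<gamma> x \<longleftrightarrow> (\<forall>j::nat. \<exists>k::nat. \<forall>n::nat.
     (1 / 2 ^ n) powr (\<gamma> + 1 / Suc j) \<le> k * measure \<theta> (cball x (1 / 2 ^ n)))"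

lemma measurable_measure_cball:
  fixes \<theta> :: "real measure"
  assumes "finite_measure \<theta>" and [measurable_cong]: "sets \<theta> = sets borel"
  shows "(\<lambda>x. measure \<theta> (cball x R)) \<in> borel_measurable borel"
proof -
  interpret finite_measure \<theta> by fact
  have "{z \<in> space (borel \<Otimes>\<^sub>M \<theta>). dist (fst z) (snd z) \<le> R} \<in> sets (borel \<Otimes>\<^sub>M \<theta>)"
    by measurable
  from measurable_emeasure_Pair[OF this]
  have "(\<lambda>x. emeasure \<theta> (Pair x -` {z \<in> space (borel \<Otimes>\<^sub>M \<theta>). dist (fst z) (snd z) \<le> R})) \<in> borel_measurable borel" .
  also have "(\<lambda>x. emeasure \<theta> (Pair x -` {z \<in> space (borel \<Otimes>\<^sub>M \<theta>). dist (fst z) (snd z) \<le> R})) =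
      (\<lambda>x. emeasure \<theta> (cball x R))"
    using sets_eq_imp_space_eq[OF assms(2)]
    by (intro ext arg_cong[of _ _ "emeasure \<theta>"]) (auto simp: space_pair_measure)
  finally show ?thesis unfolding measure_def by measurable
qed

lemma sets_local_dim:
  assumes "finite_measure \<theta>" "sets \<theta> = sets borel"
  shows "{x. local_dim_ge \<theta> \<gamma> x} \<in> sets borel" "{x. local_dim_le \<theta> \<gamma> x} \<in> sets borel"
proof -
  have [measurable]: "(\<lambda>x. measure \<theta> (cball x R)) \<in> borel_measurable borel" for R
    by (rule measurable_measure_cball[OF assms])
  have "Measurable.pred borel (local_dim_ge \<theta> \<gamma>)" "Measurable.pred borel (local_dim_le \<theta> \<gamma>)"
    unfolding local_dim_ge_def local_dim_le_def by measurable
  then show "{x. local_dim_ge \<theta> \<gamma> x} \<in> sets borel" "{x. local_dim_le \<theta> \<gamma> x} \<in> sets borel"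
    by (simp_all add: pred_def)
qed

lemma local_dim_imp_tendsto:
  assumes "finite_measure \<theta>" "sets \<theta> = sets borel"
    and ge: "local_dim_ge \<theta> \<gamma> x" and le: "local_dim_le \<theta> \<gamma> x"
  shows "((\<lambda>r. ln (measure \<theta> (cball x r)) / ln r) \<longlongrightarrow> \<gamma>) (at_right 0)"
proof (rule ln_ratio_tendsto)
  interpret finite_measure \<theta> by fact
  have ev: "\<forall>\<^sub>F r in at_right (0::real). 0 < r \<and> r \<le> 1"
    by (auto simp: eventually_at_right_field intro: exI[of _ 1])
  fix \<delta> :: real assume "\<delta> > 0"
  then obtain j :: nat where j: "1 / Suc j < \<delta>" using nat_approx_posE by metis
  have mono: "measure \<theta> (cball x s) \<le> measure \<theta> (cball x t)" if "s \<le> t" for s t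
    using that by (intro finite_measure_mono subset_cball) (auto simp: assms(2))
  show "\<exists>C>0. \<forall>\<^sub>F r in at_right 0. measure \<theta> (cball x r) \<le> C * r powr (\<gamma> - \<delta>)"
  proof -
    obtain k :: nat where k: "\<And>n. measure \<theta> (cball x (1 / 2 ^ n)) \<le> k * (1 / 2 ^ n) powr (\<gamma> - 1 / Suc j)"
      using ge unfolding local_dim_ge_def by blast
    define C where "C = (real k + 1) * max 1 (2 powr (\<gamma> - 1 / Suc j))"
    have "C > 0" by (simp add: C_def less_max_iff_disj)
    moreover have "measure \<theta> (cball x r) \<le> C * r powr (\<gamma> - \<delta>)" if r: "0 < r" "r \<le> 1" for r
    proof -
      obtain n :: nat where n: "r \<le> 1 / 2 ^ n" "1 / 2 ^ n < 2 * r" by (rule ex_dyadic_between[OF r])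
      have "measure \<theta> (cball x r) \<le> k * (1 / 2 ^ n) powr (\<gamma> - 1 / Suc j)"
        using mono[OF n(1)] k[of n] by linarith
      also have "\<dots> \<le> (k + 1) * (max 1 (2 powr (\<gamma> - 1 / Suc j)) * r powr (\<gamma> - 1 / Suc j))"
        using powr_comparable(1)[of r "1 / 2 ^ n" 2 "\<gamma> - 1 / Suc j"] r n by (intro mult_mono) auto
      also have "\<dots> = C * r powr (\<gamma> - 1 / Suc j)" by (simp add: C_def)
      also have "\<dots> \<le> C * r powr (\<gamma> - \<delta>)"
        using r j \<open>C > 0\<close> by (intro mult_left_mono powr_mono') auto
      finally show ?thesis .
    qed
    ultimately show ?thesis using ev by (intro exI[of _ C]) (auto elim!: eventually_mono)
  qed
  show "\<exists>C>0. \<forall>\<^sub>F r in at_right 0. C * r powr (\<gamma> + \<delta>) \<le> measure \<theta> (cball x r)"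
  proof -
    obtain k :: nat where k: "\<And>n. (1 / 2 ^ n) powr (\<gamma> + 1 / Suc j) \<le> k * measure \<theta> (cball x (1 / 2 ^ n))"
      using le unfolding local_dim_le_def by blast
    define s where "s = \<gamma> + 1 / Suc j"
    define C where "C = min 1 (2 powr s) / (2 powr s * (real k + 1))"
    have "C > 0" by (simp add: C_def)
    moreover have "C * r powr (\<gamma> + \<delta>) \<le> measure \<theta> (cball x r)" if r: "0 < r" "r \<le> 1" for r
    proof -
      \<comment> \<open>Applied to \<open>r / 2\<close>, the dyadic radius falls below
        \<open>r\<close>, so that its ball lies inside the ball of radius \<open>r\<close>.\<close>
      have "0 < r / 2" "r / 2 \<le> 1" using r by auto
      then obtain n :: nat where n: "r / 2 \<le> 1 / 2 ^ n" "1 / 2 ^ n < 2 * (r / 2)"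
        by (rule ex_dyadic_between)
      have "C * r powr (\<gamma> + \<delta>) \<le> C * r powr s"
        using r j \<open>C > 0\<close> by (intro mult_left_mono powr_mono') (auto simp: s_def)
      also have "\<dots> = min 1 (2 powr s) * (r / 2) powr s / (real k + 1)"
        using r by (simp add: C_def powr_divide)
      also have "\<dots> \<le> (1 / 2 ^ n) powr s / (real k + 1)"
        using powr_comparable(2)[of "r / 2" "1 / 2 ^ n" 2 s] r n by (intro divide_right_mono) auto
      also have "\<dots> \<le> k * measure \<theta> (cball x (1 / 2 ^ n)) / (real k + 1)"
        using k[of n] unfolding s_def by (intro divide_right_mono) auto
      also have "\<dots> \<le> measure \<theta> (cball x (1 / 2 ^ n))" by (simp add: field_simps)
      also have "\<dots> \<le> measure \<theta> (cball x r)" using n by (intro mono) auto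
      finally show ?thesis .
    qed
    ultimately show ?thesis using ev by (intro exI[of _ C]) (auto elim!: eventually_mono)
  qed
qed

text \<open>A bounded interval has of the order of \<open>2 ^ n\<close> cells of side
  \<open>1 / 2 ^ n\<close>. A cell that contains an exceptional point lies in the ball around that
  point, so its mass is below \<open>(1 / 2 ^ n) powr s\<close> with \<open>s > 1\<close>. The
  exceptional masses are thus summable, and Borel-Cantelli applies.\<close>

lemma AE_local_dim_le_1:
  fixes \<theta> :: "real measure"
  assumes "finite_measure \<theta>" and S[measurable_cong]: "sets \<theta> = sets borel"
  shows "AE x in \<theta>. local_dim_le \<theta> 1 x"
proof -
  interpret finite_measure \<theta> by fact
  have sp: "space \<theta> = UNIV" using sets_eq_imp_space_eq[OF S] by simp
  have [measurable]: "(\<lambda>x. measure \<theta> (cball x R)) \<in> borel_measurable borel" for R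
    by (rule measurable_measure_cball[OF assms])
  have *: "AE x in \<theta>. x \<in> {-real R..real R} \<longrightarrow> (\<forall>\<^sub>F n in sequentially. (1 / 2 ^ n) powr (1 + 1 / Suc j) \<le> 1 * measure \<theta> (cball x (1 / 2 ^ n)))"
    for j R :: nat
  proof -
    define s where "s = 1 + 1 / real (Suc j)"
    define A where "A n = {x \<in> {-real R..real R}. measure \<theta> (cball x (1 / 2 ^ n)) < (1 / 2 ^ n) powr s}" for n :: nat
    define I where "I n = {\<lfloor>-real R * 2 ^ n\<rfloor>..\<lfloor>real R * 2 ^ n\<rfloor>}" for n :: nat
    define cell where "cell n k = {x::real. \<lfloor>x * 2 ^ n\<rfloor> = k}" for n :: nat and k :: int
    have A_sets[measurable]: "A n \<in> sets \<theta>" for n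
    proof -
      have "A n = {x \<in> space borel. x \<in> {-real R..real R} \<and> measure \<theta> (cball x (1 / 2 ^ n)) < (1 / 2 ^ n) powr s}"
        by (auto simp: A_def)
      also have "\<dots> \<in> sets borel" by measurable
      finally show ?thesis by (simp add: S)
    qed
    have cell_sets: "cell n k \<in> sets \<theta>" for n k
    proof -
      have "{x \<in> space borel. \<lfloor>x * 2 ^ n\<rfloor> = k} \<in> sets (borel :: real measure)" by measurable
      then show ?thesis by (simp add: S cell_def)
    qed
    have cell_le: "measure \<theta> (A n \<inter> cell n k) \<le> (1 / 2 ^ n) powr s" for n k
    proof (cases "A n \<inter> cell n k = {}")
      case False
      then obtain x where x: "x \<in> A n" "x \<in> cell n k" by blast
      have "cell n k \<subseteq> cball x (1 / 2 ^ n)"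
      proof
        fix y assume "y \<in> cell n k"
        then have "\<bar>x * 2 ^ n - y * 2 ^ n\<bar> \<le> 1" using x(2) by (simp add: cell_def) linarith
        moreover have "\<bar>x * 2 ^ n - y * 2 ^ n\<bar> = \<bar>x - y\<bar> * 2 ^ n"
          by (simp only: left_diff_distrib[symmetric] abs_mult) simp
        ultimately have "\<bar>x - y\<bar> * 2 ^ n \<le> 1" by simp
        then show "y \<in> cball x (1 / 2 ^ n)" by (simp add: dist_real_def field_simps)
      qed
      then have "measure \<theta> (A n \<inter> cell n k) \<le> measure \<theta> (cball x (1 / 2 ^ n))"
        by (intro finite_measure_mono) (auto simp: S)
      then show ?thesis using x(1) by (simp add: A_def)
    qed simp
    have A_le: "measure \<theta> (A n) \<le> (2 * real R + 2) * (2 powr (- 1 / Suc j)) ^ n" for n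
    proof -
      have "A n \<subseteq> (\<Union>k\<in>I n. A n \<inter> cell n k)"
      proof
        fix x assume x: "x \<in> A n"
        then have "-real R \<le> x" "x \<le> real R" by (simp_all add: A_def)
        from mult_right_mono[OF this(1), of "2 ^ n"] mult_right_mono[OF this(2), of "2 ^ n"]
        have "-real R * 2 ^ n \<le> x * 2 ^ n" "x * 2 ^ n \<le> real R * 2 ^ n" by simp_all
        then have "\<lfloor>x * 2 ^ n\<rfloor> \<in> I n" unfolding I_def by (auto intro!: floor_mono)
        with x show "x \<in> (\<Union>k\<in>I n. A n \<inter> cell n k)" by (auto simp: cell_def)
      qed
      then have "measure \<theta> (A n) \<le> measure \<theta> (\<Union>k\<in>I n. A n \<inter> cell n k)"
        by (rule finite_measure_mono) (rule sets.finite_UN, auto simp: I_def cell_sets)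
      also have "\<dots> \<le> (\<Sum>k\<in>I n. measure \<theta> (A n \<inter> cell n k))"
        by (intro finite_measure_subadditive_finite) (auto simp: I_def cell_sets)
      also have "\<dots> \<le> real (card (I n)) * (1 / 2 ^ n) powr s"
        using sum_mono[of "I n" "\<lambda>k. measure \<theta> (A n \<inter> cell n k)" "\<lambda>_. (1 / 2 ^ n) powr s"] cell_le
        by simp
      also have "real (card (I n)) \<le> (2 * real R + 2) * 2 ^ n"
      proof -
        have "real (card (I n)) = real_of_int (max 0 (\<lfloor>real R * 2 ^ n\<rfloor> + 1 - \<lfloor>-real R * 2 ^ n\<rfloor>))"
          by (simp add: I_def)
        also have "\<dots> \<le> real R * 2 ^ n + 1 + (real R * 2 ^ n + 1)"
        proof -
          have "0 \<le> real R * 2 ^ n" by simp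
          then show ?thesis
            using of_int_floor_le[of "real R * 2 ^ n"] floor_correct[of "-real R * 2 ^ n"]
            unfolding of_int_max max.bounded_iff by (intro conjI; simp; linarith)
        qed
        also have "\<dots> \<le> (2 * real R + 2) * 2 ^ n"
          using one_le_power[of "2::real" n] by (simp add: algebra_simps)
        finally show ?thesis .
      qed
      also have "(2 * real R + 2) * 2 ^ n * (1 / 2 ^ n) powr s = (2 * real R + 2) * (2 powr (- 1 / Suc j)) ^ n"
      proof -
        have "(1 / 2 ^ n) powr s = (2 powr (- real n)) powr s"
          by (simp add: powr_minus powr_realpow divide_inverse)
        also have "\<dots> = 2 powr (- real n) * 2 powr (- (real n / Suc j))"
          by (simp add: powr_powr s_def powr_add[symmetric] algebra_simps)
        also have "2 powr (- real n) = 1 / 2 ^ n" by (simp add: powr_minus powr_realpow divide_inverse)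
        also have "2 powr (- (real n / Suc j)) = (2 powr (- 1 / Suc j)) ^ n"
          by (simp add: powr_realpow[symmetric] powr_powr)
        finally show ?thesis by simp
      qed
      finally show ?thesis by (simp add: mult_right_mono)
    qed
    have "2 powr (- 1 / Suc j) < (2 :: real) powr 0" by (rule powr_less_mono) auto
    then have "norm (2 powr (- 1 / Suc j)) < (1 :: real)" by simp
    then have "summable (\<lambda>n. (2 * real R + 2) * (2 powr (- 1 / Suc j)) ^ n)"
      by (intro summable_mult summable_geometric)
    then have "summable (\<lambda>n. measure \<theta> (A n))"
      by (rule summable_comparison_test'[of _ 0]) (use A_le in simp)
    then have "AE x in \<theta>. \<forall>\<^sub>F n in sequentially. x \<in> space \<theta> - A n"
      by (intro borel_cantelli_AE1) (auto simp: emeasure_eq_measure)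
    then show ?thesis
      by eventually_elim (auto elim!: eventually_mono simp: A_def s_def not_less)
  qed
  then have "AE x in \<theta>. \<forall>j R. x \<in> {-real R..real R} \<longrightarrow> (\<forall>\<^sub>F n in sequentially. (1 / 2 ^ n) powr (1 + 1 / Suc j) \<le> 1 * measure \<theta> (cball x (1 / 2 ^ n)))"
    by (simp only: AE_all_countable) blast
  then show ?thesis
  proof eventually_elim
    case (elim x)
    obtain R :: nat where "\<bar>x\<bar> \<le> real R" using real_arch_simple by blast
    then have x: "x \<in> {-real R..real R}" by auto
    show ?case unfolding local_dim_le_def
    proof
      fix j
      have ev: "\<forall>\<^sub>F n in sequentially. (1 / 2 ^ n) powr (1 + 1 / Suc j) \<le> 1 * measure \<theta> (cball x (1 / 2 ^ n))"
        using elim x by blast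
      have "0 < measure \<theta> (cball x (1 / 2 ^ n))" for n
      proof -
        obtain N where N: "\<And>n. n \<ge> N \<Longrightarrow> (1 / 2 ^ n) powr (1 + 1 / Suc j) \<le> 1 * measure \<theta> (cball x (1 / 2 ^ n))"
          using ev unfolding eventually_sequentially by blast
        have "0 < (1 / 2 ^ (max n N)) powr (1 + 1 / real (Suc j))" by simp
        also have "\<dots> \<le> 1 * measure \<theta> (cball x (1 / 2 ^ (max n N)))" by (rule N) simp
        also have "\<dots> \<le> measure \<theta> (cball x (1 / 2 ^ n))"
          unfolding mult_1 by (intro finite_measure_mono subset_cball) (auto simp: S field_simps)
        finally show ?thesis .
      qed
      then show "\<exists>k::nat. \<forall>n. (1 / 2 ^ n) powr (1 + 1 / Suc j) \<le> k * measure \<theta> (cball x (1 / 2 ^ n))"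
        by (rule eventually_le_imp_bounded_ratio[OF ev])
    qed
  qed
qed

section \<open>An upper bound of renewal type\<close>

context weighted_ifs
begin

text \<open>The numbers \<open>- ln (sc a n)\<close> form a random walk with positive steps
  \<open>- ln (r i)\<close>, and the event is a visit of this walk to a window of length
  \<eta>.\<close>

definition hit :: "real \<Rightarrow> real \<Rightarrow> (nat \<Rightarrow> 'i) set" where
  "hit \<eta> t = {a. \<exists>n. t \<le> - ln (sc a n) \<and> - ln (sc a n) \<le> t + \<eta>}"

lemma hit_measurable [measurable]: "hit \<eta> t \<in> sets P"
proof -
  have "determined n (\<lambda>a. t \<le> - ln (sc a n) \<and> - ln (sc a n) \<le> t + \<eta>)" for n
    using determined_prefix(1)[of n] unfolding determined_def by metis
  then have "(\<Union>n. {a. t \<le> - ln (sc a n) \<and> - ln (sc a n) \<le> t + \<eta>}) \<in> sets P"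
    by (intro sets.countable_UN) (auto intro: sets_determined)
  also have "(\<Union>n. {a. t \<le> - ln (sc a n) \<and> - ln (sc a n) \<le> t + \<eta>}) = hit \<eta> t" by (auto simp: hit_def)
  finally show ?thesis .
qed

lemma sc_comb_seq_1: "sc (comb_seq 1 a b) (Suc n) = r (a 0) * sc b n"
  using sc_add[of "comb_seq 1 a b" 1 n] shift_comb_seq[of 1 a b] by (simp add: sc_def comb_seq_def)

text \<open>For \<open>t > 0\<close> the starting point 0 of the walk is outside the window, so the
  first step can be taken out.\<close>

lemma hit_recursion:
  assumes "t > 0"
  shows "measure P (hit \<eta> t) = (\<Sum>i\<in>UNIV. p i * measure P (hit \<eta> (t + ln (r i))))"
proof -
  have iff: "comb_seq 1 a b \<in> hit \<eta> t \<longleftrightarrow> b \<in> hit \<eta> (t + ln (r (a 0)))" for a b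
  proof
    assume "comb_seq 1 a b \<in> hit \<eta> t"
    then obtain n where n: "t \<le> - ln (sc (comb_seq 1 a b) n)" "- ln (sc (comb_seq 1 a b) n) \<le> t + \<eta>"
      by (auto simp: hit_def)
    with assms have "n \<noteq> 0" by (cases n) auto
    then obtain m where "n = Suc m" by (cases n) auto
    then show "b \<in> hit \<eta> (t + ln (r (a 0)))"
      using n r_pos[of "a 0"] sc_pos[of b m] unfolding hit_def
      by (auto simp: sc_comb_seq_1[unfolded One_nat_def] ln_mult simp del: comb_seq_Suc_0 intro!: exI[of _ m])
  next
    assume "b \<in> hit \<eta> (t + ln (r (a 0)))"
    then obtain m where m: "t + ln (r (a 0)) \<le> - ln (sc b m)" "- ln (sc b m) \<le> t + ln (r (a 0)) + \<eta>"
      by (auto simp: hit_def)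
    have "- ln (sc (comb_seq 1 a b) (Suc m)) = - ln (r (a 0)) - ln (sc b m)"
      unfolding sc_comb_seq_1 using r_pos[of "a 0"] sc_pos[of b m] by (simp add: ln_mult)
    then show "comb_seq 1 a b \<in> hit \<eta> t"
      using m unfolding hit_def by (intro CollectI exI[of _ "Suc m"]) linarith
  qed
  have "emeasure P (hit \<eta> t) = (\<integral>\<^sup>+a. indicator (hit \<eta> t) a \<partial>P)" by simp
  also have "\<dots> = (\<integral>\<^sup>+a. \<integral>\<^sup>+b. indicator (hit \<eta> t) (comb_seq 1 a b) \<partial>P \<partial>P)"
    by (rule nn_integral_comb_seq) simp
  also have "\<dots> = (\<integral>\<^sup>+a. \<integral>\<^sup>+b. indicator (hit \<eta> (t + ln (r (a 0)))) b \<partial>P \<partial>P)"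
    by (intro nn_integral_cong) (simp add: indicator_def iff del: comb_seq_Suc_0 One_nat_def)
  also have "\<dots> = (\<integral>\<^sup>+a. ennreal (measure P (hit \<eta> (t + ln (r (a 0))))) \<partial>P)"
    by (simp add: seq.P.emeasure_eq_measure)
  also have "\<dots> = (\<Sum>i\<in>UNIV. ennreal (p i) * ennreal (measure P (hit \<eta> (t + ln (r i)))))"
    by (rule nn_integral_coordinate)
  also have "\<dots> = ennreal (\<Sum>i\<in>UNIV. p i * measure P (hit \<eta> (t + ln (r i))))"
    using less_imp_le[OF p_pos] by (simp add: ennreal_mult[symmetric] sum_ennreal)
  finally show ?thesis
    using less_imp_le[OF p_pos] by (simp add: seq.P.emeasure_eq_measure sum_nonneg)
qed

lemma ln_sc_diff: "m \<le> n \<Longrightarrow> - ln (sc a n) \<ge> - ln (sc a m) + (real n - real m) * (- ln rmax)"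
proof (induction n rule: dec_induct)
  case (step n)
  have "ln (r (a n)) \<le> ln rmax" using r_pos le_rmax by (intro ln_mono) auto
  with step show ?case
    using sc_pos[of a n] r_pos[of "a n"] by (simp add: sc_Suc ln_mult algebra_simps)
qed simp

lemma ln_rmax_neg: "ln rmax < 0"
  using rmax_pos rmax_less_1 by simp

text \<open>Every step of the walk has length at least \<open>- ln rmax\<close>, so the times spent
  in a window of length \<open>l\<close> differ by at most \<open>l / (- ln rmax)\<close>.\<close>

lemma card_visits:
  assumes "0 \<le> l"
  shows "finite {n. x \<le> - ln (sc a n) \<and> - ln (sc a n) \<le> x + l}" (is "finite ?N")
    and "real (card {n. x \<le> - ln (sc a n) \<and> - ln (sc a n) \<le> x + l}) \<le> l / (- ln rmax) + 1"
proof -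
  have d: "real n - real m \<le> l / (- ln rmax)" if "n \<in> ?N" "m \<in> ?N" for n m
  proof (cases "m \<le> n")
    case True
    from ln_sc_diff[OF this, of a] that have "(real n - real m) * (- ln rmax) \<le> l" by auto
    then show ?thesis using ln_rmax_neg by (subst pos_le_divide_eq) auto
  next
    case False
    have "0 \<le> l / (- ln rmax)" using assms ln_rmax_neg by (intro divide_nonneg_pos) auto
    then show ?thesis using False by simp
  qed
  show fin: "finite ?N"
  proof (cases "?N = {}")
    case False
    then obtain m where m: "m \<in> ?N" by blast
    obtain k :: nat where k: "real m + l / (- ln rmax) \<le> real k" using real_arch_simple by blast
    have "?N \<subseteq> {..k}"
    proof
      fix n assume "n \<in> ?N"
      with d[OF this m] k have "real n \<le> real k" by linarith
      then show "n \<in> {..k}" by simp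
    qed
    then show ?thesis by (rule finite_subset) simp
  qed (metis finite.emptyI)
  show "real (card ?N) \<le> l / (- ln rmax) + 1"
  proof (cases "?N = {}")
    case True
    then show ?thesis using assms ln_rmax_neg by (simp only: card.empty) (simp add: divide_nonpos_neg)
  next
    case False
    have mM: "Min ?N \<in> ?N" "Max ?N \<in> ?N" using Min_in[OF fin False] Max_in[OF fin False] by blast+
    have "?N \<subseteq> {Min ?N..Max ?N}" using fin by auto
    then have "card ?N \<le> card {Min ?N..Max ?N}" by (rule card_mono[rotated]) simp
    also have "\<dots> = Suc (Max ?N) - Min ?N" by simp
    finally have "real (card ?N) \<le> real (Suc (Max ?N) - Min ?N)" by (rule of_nat_mono)
    also have "\<dots> = real (Max ?N) - real (Min ?N) + 1"
      using fin mM(2) by (subst of_nat_diff) (auto intro: le_SucI Min_le)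
    also have "\<dots> \<le> l / (- ln rmax) + 1" using d[OF mM(2) mM(1)] by simp
    finally show ?thesis .
  qed
qed

text \<open>Separated windows are visited at different times, and all of them lie in one interval of
  length \<open>l + \<eta>\<close>, in which every path makes boundedly many visits. The claim is
  the integral of this pointwise count.\<close>

lemma sum_hit_le:
  fixes t :: "nat \<Rightarrow> real"
  assumes "\<And>j. j < N \<Longrightarrow> x \<le> t j \<and> t j \<le> x + l" "0 \<le> l" "0 \<le> \<eta>"
    and sep: "\<And>i j. i < j \<Longrightarrow> j < N \<Longrightarrow> t i + \<eta> < t j \<or> t j + \<eta> < t i"
  shows "(\<Sum>j<N. measure P (hit \<eta> (t j))) \<le> (l + \<eta>) / (- ln rmax) + 1"
proof -
  define c where "c = (l + \<eta>) / (- ln rmax) + 1"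
  have c0: "0 \<le> c" using assms(2,3) ln_rmax_neg unfolding c_def by (intro add_nonneg_nonneg divide_nonneg_pos) auto
  have pt: "(\<Sum>j<N. indicator (hit \<eta> (t j)) a) \<le> c" for a
  proof -
    let ?J = "{j\<in>{..<N}. a \<in> hit \<eta> (t j)}"
    let ?V = "{n. x \<le> - ln (sc a n) \<and> - ln (sc a n) \<le> x + (l + \<eta>)}"
    have "\<forall>j\<in>?J. \<exists>n. t j \<le> - ln (sc a n) \<and> - ln (sc a n) \<le> t j + \<eta>" by (auto simp: hit_def)
    then obtain n where n: "\<And>j. j \<in> ?J \<Longrightarrow> t j \<le> - ln (sc a (n j)) \<and> - ln (sc a (n j)) \<le> t j + \<eta>"
      by metis
    have "inj_on n ?J"
    proof (rule inj_onI, rule ccontr)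
      fix i j assume ij: "i \<in> ?J" "j \<in> ?J" "n i = n j" "i \<noteq> j"
      then have "t i + \<eta> < t j \<or> t j + \<eta> < t i" using sep[of i j] sep[of j i] by (cases "i < j") auto
      then show False using n[OF ij(1)] n[OF ij(2)] ij(3) by auto
    qed
    moreover have "n ` ?J \<subseteq> ?V" using n assms(1) by fastforce
    ultimately have "card ?J \<le> card ?V"
      using assms(2,3) by (intro card_inj_on_le card_visits(1)) auto
    moreover have "(\<Sum>j<N. indicator (hit \<eta> (t j)) a) = real (card ?J)"
      by (simp add: indicator_def sum.If_cases Int_def)
    ultimately show ?thesis using card_visits(2)[of "l + \<eta>" x a] assms(2,3) unfolding c_def by linarith
  qed
  have "(\<Sum>j<N. measure P (hit \<eta> (t j))) = (\<Sum>j<N. (\<integral>a. indicator (hit \<eta> (t j)) a \<partial>P))"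
    by simp
  also have "\<dots> = (\<integral>a. (\<Sum>j<N. indicator (hit \<eta> (t j)) a) \<partial>P)"
    by (rule Bochner_Integration.integral_sum[symmetric]) (simp add: integrable_real_indicator seq.P.emeasure_eq_measure)
  also have "\<dots> \<le> (\<integral>a. c \<partial>P)"
    using pt by (intro integral_mono Bochner_Integration.integrable_sum)
      (auto simp: integrable_real_indicator seq.P.emeasure_eq_measure)
  also have "\<dots> = c" using seq.P.prob_space by simp
  finally show ?thesis by (simp add: c_def)
qed

text \<open>A maximum principle: an average of numbers at most \<open>U\<close> that is itself
  nearly \<open>U\<close> has all its terms nearly \<open>U\<close>. Each letter costs a factor
  \<open>1 / q\<close>, and the margin \<open>- ln rmin\<close> keeps the other letters of the same
  step above \<open>T\<close>.\<close>

lemma hit_propagates: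
  assumes T: "\<And>t. t \<ge> T \<Longrightarrow> measure P (hit \<eta> t) \<le> U" and "0 \<le> T" "0 < q" "q \<le> 1" "\<And>i. q \<le> p i"
    and t: "T + ln (sc a n) \<le> T" "T - ln (sc a n) - ln rmin \<le> t" and k: "U - \<kappa> \<le> measure P (hit \<eta> t)" "0 \<le> \<kappa>"
  shows "U - \<kappa> / q ^ n \<le> measure P (hit \<eta> (t + ln (sc a n)))"
  using t
proof (induction n)
  case 0
  then show ?case using k by simp
next
  case (Suc n)
  have lnr: "ln rmin \<le> ln (r i)" for i using rmin_pos rmin_le by (intro ln_mono) auto
  have l1: "ln (sc a (Suc n)) = ln (sc a n) + ln (r (a n))"
    using sc_pos[of a n] r_pos[of "a n"] by (simp add: sc_Suc ln_mult)
  have rn: "ln (r i) < 0" for i using r_pos r_less_1 by simp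
  have rmn: "ln rmin < 0" using rmin_pos rmin_less_1 by simp
  have scn: "ln (sc a n) \<le> 0"
    using sc_pos[of a n] sc_antimono[of 0 n a] by simp
  have IH: "U - \<kappa> / q ^ n \<le> measure P (hit \<eta> (t + ln (sc a n)))"
    using Suc.prems l1 rn[of "a n"] scn by (intro Suc.IH) auto
  let ?s = "t + ln (sc a n)"
  have s: "?s - T \<ge> - ln (r (a n)) - ln rmin" using Suc.prems l1 by simp
  then have "?s > 0" using rn[of "a n"] rmn \<open>0 \<le> T\<close> by linarith
  have up: "measure P (hit \<eta> (?s + ln (r i))) \<le> U" for i
    using s lnr[of i] rn[of "a n"] by (intro T) linarith
  have "measure P (hit \<eta> ?s) = (\<Sum>i\<in>UNIV. p i * measure P (hit \<eta> (?s + ln (r i))))"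
    by (rule hit_recursion[OF \<open>?s > 0\<close>])
  also have "\<dots> = p (a n) * measure P (hit \<eta> (?s + ln (r (a n)))) +
      (\<Sum>i\<in>UNIV - {a n}. p i * measure P (hit \<eta> (?s + ln (r i))))"
    by (rule sum.remove) auto
  also have "\<dots> \<le> p (a n) * measure P (hit \<eta> (?s + ln (r (a n)))) + (\<Sum>i\<in>UNIV - {a n}. p i * U)"
    using up less_imp_le[OF p_pos] by (intro add_left_mono sum_mono mult_left_mono) auto
  also have "(\<Sum>i\<in>UNIV - {a n}. p i * U) = (1 - p (a n)) * U"
    using sum.remove[of UNIV "a n" p] by (simp add: sum_distrib_right[symmetric] sum_p)
  finally have "p (a n) * (U - measure P (hit \<eta> (?s + ln (r (a n))))) \<le> \<kappa> / q ^ n"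
    using IH by (simp add: algebra_simps)
  moreover have "q * (U - measure P (hit \<eta> (?s + ln (r (a n))))) \<le> p (a n) * (U - measure P (hit \<eta> (?s + ln (r (a n)))))"
    using up[of "a n"] assms(5) by (intro mult_right_mono) auto
  ultimately have "q * (U - measure P (hit \<eta> (?s + ln (r (a n))))) \<le> \<kappa> / q ^ n" by linarith
  then have "U - measure P (hit \<eta> (?s + ln (r (a n)))) \<le> \<kappa> / q ^ n / q"
    by (subst pos_le_divide_eq[OF \<open>0 < q\<close>]) (simp add: mult.commute)
  then show ?case by (simp add: l1 add.assoc mult.commute)
qed

section \<open>The semigroup generated by the contraction ratios\<close>

definition semigrp :: "real set" where "semigrp = {x. \<exists>a n. x = sc a n}"

lemma semigrp_1: "1 \<in> semigrp"
  unfolding semigrp_def by (intro CollectI exI[of _ undefined] exI[of _ 0]) simp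

lemma semigrp_r: "r i \<in> semigrp"
  unfolding semigrp_def by (intro CollectI exI[of _ "\<lambda>_. i"] exI[of _ 1]) (simp add: sc_def)

lemma semigrp_mult:
  assumes "x \<in> semigrp" "y \<in> semigrp" shows "x * y \<in> semigrp"
proof -
  obtain a n b m where "x = sc a n" "y = sc b m" using assms unfolding semigrp_def by blast
  then have "x * y = sc (comb_seq n a b) (n + m)"
    using sc_add[of "comb_seq n a b" n m] prefix_cong(1)[of n "comb_seq n a b" a]
    by (simp add: shift_comb_seq comb_seq_less)
  then show ?thesis unfolding semigrp_def by blast
qed

lemma semigrp_prod: "(\<And>i. i \<in> I \<Longrightarrow> g i \<in> semigrp) \<Longrightarrow> prod g I \<in> semigrp"
  by (induction I rule: infinite_finite_induct) (auto intro: semigrp_1 semigrp_mult)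

lemma semigrp_pos: "x \<in> semigrp \<Longrightarrow> 0 < x"
  unfolding semigrp_def using sc_pos by auto

lemma generate_quotient:
  assumes "g \<in> generate pos_real_mult_group (range r)"
  shows "\<exists>x\<in>semigrp. \<exists>y\<in>semigrp. g = x / y"
  using assms
proof induction
  case one
  show ?case using semigrp_1 by (intro bexI[of _ 1]) (auto simp: pos_real_mult_group_def)
next
  case (incl h)
  then show ?case using semigrp_1 semigrp_r by (intro bexI[of _ h] bexI[of _ 1]) auto
next
  case (inv h)
  interpret comm_group pos_real_mult_group by (rule comm_group_pos_real_mult_group)
  have "h > 0" using inv r_pos by auto
  then have "inv\<^bsub>pos_real_mult_group\<^esub> h = 1 / h"
    by (intro inv_equality) (auto simp: pos_real_mult_group_def)
  then show ?case using inv semigrp_1 semigrp_r by (intro bexI[of _ 1] bexI[of _ h]) auto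
next
  case (eng g h)
  then obtain x y x' y' where "x \<in> semigrp" "y \<in> semigrp" "g = x / y" "x' \<in> semigrp" "y' \<in> semigrp" "h = x' / y'"
    by blast
  then show ?case
    by (intro bexI[of _ "x * x'"] bexI[of _ "y * y'"]) (auto simp: pos_real_mult_group_def semigrp_mult)
qed

text \<open>Elements of the dense group become elements of the semigroup after multiplication by a
  common denominator.\<close>

lemma ex_separated_semigrp:
  fixes \<eta> :: real
  assumes dense: "generates_dense_subgroup (range r)" and "0 < \<eta>" "\<eta> \<le> 1"
  obtains N :: nat and s :: "nat \<Rightarrow> real" and x where "1 \<le> 3 * \<eta> * N" "\<And>j. s j \<in> semigrp"
    "\<And>j. j < N \<Longrightarrow> x \<le> - ln (s j) \<and> - ln (s j) \<le> x + 2"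
    "\<And>i j. i < j \<Longrightarrow> j < N \<Longrightarrow> - ln (s i) + \<eta> < - ln (s j)"
proof -
  \<comment> \<open>The targets have spacing \<open>3 * \<eta>\<close> and fill an interval of
    length 1. An error below \<open>\<eta> / 2\<close> at each of them still leaves gaps larger than
    \<eta>.\<close>
  define N where "N = nat \<lceil>1 / (3 * \<eta>)\<rceil>"
  have N: "1 / (3 * \<eta>) \<le> real N" "real N < 1 / (3 * \<eta>) + 1"
    using \<open>0 < \<eta>\<close> by (auto simp: N_def of_nat_nat) linarith+
  have "\<exists>c\<in>semigrp. \<exists>d\<in>semigrp. exp (- (3 * \<eta> * real j + \<eta> / 2)) < c / d \<and> c / d < exp (- (3 * \<eta> * real j))" for j
  proof -
    define w where "w = exp (- (3 * \<eta> * real j + \<eta> / 4))"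
    have "w \<in> closure (generate pos_real_mult_group (range r))"
      using dense unfolding generates_dense_subgroup_def w_def by (auto simp: subset_iff)
    moreover have "w \<in> {exp (- (3 * \<eta> * real j + \<eta> / 2))<..<exp (- (3 * \<eta> * real j))}"
      using \<open>0 < \<eta>\<close> by (simp add: w_def)
    ultimately have "{exp (- (3 * \<eta> * real j + \<eta> / 2))<..<exp (- (3 * \<eta> * real j))} \<inter>
        generate pos_real_mult_group (range r) \<noteq> {}"
      using open_Int_closure_eq_empty[OF open_greaterThanLessThan,
          of "exp (- (3 * \<eta> * real j + \<eta> / 2))" "exp (- (3 * \<eta> * real j))"
            "generate pos_real_mult_group (range r)"] by blast
    then obtain g where "g \<in> generate pos_real_mult_group (range r)"
      "exp (- (3 * \<eta> * real j + \<eta> / 2)) < g" "g < exp (- (3 * \<eta> * real j))" by auto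
    then show ?thesis using generate_quotient by metis
  qed
  then obtain c d where cd: "\<And>j. c j \<in> semigrp" "\<And>j. d j \<in> semigrp"
    "\<And>j. exp (- (3 * \<eta> * real j + \<eta> / 2)) < c j / d j" "\<And>j. c j / d j < exp (- (3 * \<eta> * real j))"
    by metis
  define D where "D = (\<Prod>i<N. d i)"
  have D: "0 < D" unfolding D_def using semigrp_pos[OF cd(2)] by (rule prod_pos)
  \<comment> \<open>The factor \<open>D\<close> shifts all logarithms by the same amount, so the
    gaps survive. The value 1 beyond \<open>N\<close> is a default that lies in the
    semigroup.\<close>
  define s where "s j = (if j < N then c j / d j * D else 1)" for j
  have s1: "s j \<in> semigrp" for j
  proof (cases "j < N")
    case True
    then have "D = d j * (\<Prod>i\<in>{..<N} - {j}. d i)" unfolding D_def by (intro prod.remove) auto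
    then have "s j = c j * (\<Prod>i\<in>{..<N} - {j}. d i)"
      using True semigrp_pos[OF cd(2), of j] by (simp add: s_def)
    then show ?thesis using cd by (auto intro!: semigrp_mult semigrp_prod)
  qed (simp add: s_def semigrp_1)
  have s2: "- ln D + 3 * \<eta> * real j < - ln (s j)" "- ln (s j) < - ln D + 3 * \<eta> * real j + \<eta> / 2" if "j < N" for j
  proof -
    have q: "0 < c j / d j" using semigrp_pos[OF cd(1)] semigrp_pos[OF cd(2)] by simp
    have "s j = c j / d j * D" using that by (simp add: s_def)
    then have "ln (s j) = ln (c j / d j) + ln D" using D q by (simp only: ln_mult_pos)
    moreover have "- (3 * \<eta> * real j + \<eta> / 2) < ln (c j / d j)"
      using cd(3)[of j] q by (metis exp_less_cancel_iff exp_ln)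
    moreover have "ln (c j / d j) < - (3 * \<eta> * real j)"
      using cd(4)[of j] q by (metis exp_less_cancel_iff exp_ln)
    ultimately show "- ln D + 3 * \<eta> * real j < - ln (s j)" "- ln (s j) < - ln D + 3 * \<eta> * real j + \<eta> / 2"
      by linarith+
  qed
  show ?thesis
  proof (rule that[of N s "- ln D"])
    show "1 \<le> 3 * \<eta> * N" using N(1) \<open>0 < \<eta>\<close> by (simp add: field_simps)
    fix j assume "j < N"
    then have "real j \<le> real N - 1" by simp
    then have "real j < 1 / (3 * \<eta>)" using N(2) by simp
    then have "3 * \<eta> * real j < 1" using \<open>0 < \<eta>\<close> by (simp add: field_simps)
    moreover have "0 \<le> 3 * \<eta> * real j" using \<open>0 < \<eta>\<close> by simp
    ultimately show "- ln D \<le> - ln (s j) \<and> - ln (s j) \<le> - ln D + 2"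
      using s2[OF \<open>j < N\<close>] \<open>\<eta> \<le> 1\<close> by linarith
    fix i assume "i < j"
    then have "3 * \<eta> * real i + 3 * \<eta> \<le> 3 * \<eta> * real j"
      using \<open>0 < \<eta>\<close> mult_left_mono[of "real i + 1" "real j" "3 * \<eta>"] by (simp add: algebra_simps)
    moreover have "i < N" using \<open>i < j\<close> \<open>j < N\<close> by simp
    ultimately show "- ln (s i) + \<eta> < - ln (s j)"
      using s2(2)[OF \<open>i < N\<close>] s2(1)[OF \<open>j < N\<close>] \<open>0 < \<eta>\<close> by linarith
  qed (rule s1)
qed

text \<open>\<open>S\<close> is the upper limit of the hitting probability. Near-maximality at one
  distant \<open>t\<close> spreads to the \<open>N\<close> separated windows at
  \<open>t + ln (s j)\<close>, so \<open>N * S\<close> is bounded, while \<open>N\<close> is at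
  least \<open>1 / (3 * \<eta>)\<close>. The threshold depends on \<eta>, the constant
  \<open>C\<close> does not.\<close>

lemma renewal_bound:
  fixes \<eta> :: real
  assumes dense: "generates_dense_subgroup (range r)"
  defines "C \<equiv> 3 * (3 / (- ln rmax) + 1) + 1"
  assumes \<eta>: "0 < \<eta>" "\<eta> \<le> 1"
  shows "\<exists>T\<ge>0. \<forall>t\<ge>T. measure P (hit \<eta> t) \<le> C * \<eta>"
proof -
  define h where "h t = measure P (hit \<eta> t)" for t
  define B where "B = {c. \<exists>T\<ge>0. \<forall>t\<ge>T. h t \<le> c}"
  define S where "S = Inf B"
  have h0: "0 \<le> h t" "h t \<le> 1" for t by (auto simp: h_def)
  have "1 \<in> B" unfolding B_def using h0 by (auto intro: exI[of _ 0])
  have bdd: "bdd_below B"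
    unfolding B_def using h0 by (intro bdd_belowI[of _ 0]) (force intro: order_trans)
  obtain N s x where Ns: "1 \<le> 3 * \<eta> * real N" "\<And>j. s j \<in> semigrp"
    "\<And>j. j < N \<Longrightarrow> x \<le> - ln (s j) \<and> - ln (s j) \<le> x + 2"
    "\<And>i j. i < j \<Longrightarrow> j < N \<Longrightarrow> - ln (s i) + \<eta> < - ln (s j)"
    using ex_separated_semigrp[OF dense \<eta>] by metis
  have "\<exists>a n. s j = sc a n" for j using Ns(2) unfolding semigrp_def by blast
  then obtain a n where an: "\<And>j. s j = sc (a j) (n j)" by metis
  define m where "m = Max (n ` {..<N})"
  have m: "n j \<le> m" if "j < N" for j using that unfolding m_def by (intro Max_ge) auto
  define q where "q = Min (range p)"
  have q: "0 < q" "\<And>i. q \<le> p i" using p_pos by (auto simp: q_def)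
  have "q \<le> 1"
  proof -
    have "p i \<le> (\<Sum>i\<in>UNIV. p i)" for i using less_imp_le[OF p_pos] by (intro member_le_sum) auto
    then show ?thesis using q(2) sum_p order_trans by metis
  qed
  have le: "N * (S - 2 * \<epsilon> / q ^ m) \<le> 3 / (- ln rmax) + 1" if \<epsilon>: "\<epsilon> > 0" for \<epsilon>
  proof -
    have "\<exists>c\<in>B. c < S + \<epsilon>"
      using cInf_lessD[of B "S + \<epsilon>"] \<open>1 \<in> B\<close> \<epsilon> unfolding S_def by auto
    then obtain T where T: "T \<ge> 0" "\<And>t. t \<ge> T \<Longrightarrow> h t \<le> S + \<epsilon>"
      unfolding B_def by fastforce
    \<comment> \<open>Values close to \<open>S\<close> occur arbitrarily far out, so
      \<open>t\<close> can be taken large enough for all translates to stay above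
      \<open>T\<close>.\<close>
    have "S - \<epsilon> \<notin> B" using cInf_lower[OF _ bdd, of "S - \<epsilon>"] \<epsilon> unfolding S_def by auto
    then have "\<not> (\<forall>t\<ge>max 0 (T + x + 2 - ln rmin). h t \<le> S - \<epsilon>)"
      unfolding B_def using max.cobounded1[of 0 "T + x + 2 - ln rmin"] by blast
    then obtain t where t: "t \<ge> max 0 (T + x + 2 - ln rmin)" "S - \<epsilon> < h t"
      by (auto simp only: not_all not_imp not_le)
    have "S - 2 * \<epsilon> / q ^ m \<le> h (t + ln (s j))" if "j < N" for j
    proof -
      have "ln (sc (a j) (n j)) \<le> 0" using sc_pos[of "a j" "n j"] sc_antimono[of 0 "n j" "a j"] by simp
      moreover have "- ln (sc (a j) (n j)) \<le> x + 2" using Ns(3)[OF that] by (simp add: an)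
      ultimately have "S + \<epsilon> - 2 * \<epsilon> / q ^ n j \<le> measure P (hit \<eta> (t + ln (sc (a j) (n j))))"
        using T t q \<open>q \<le> 1\<close> \<epsilon> unfolding h_def by (intro hit_propagates[of T]) auto
      moreover have "2 * \<epsilon> / q ^ n j \<le> 2 * \<epsilon> / q ^ m"
        using q \<open>q \<le> 1\<close> \<epsilon> m[OF that] by (intro divide_left_mono power_decreasing) auto
      ultimately show ?thesis using \<epsilon> unfolding h_def an by linarith
    qed
    then have "(\<Sum>j<N. S - 2 * \<epsilon> / q ^ m) \<le> (\<Sum>j<N. h (t + ln (s j)))" by (intro sum_mono) auto
    also have "\<dots> \<le> (2 + \<eta>) / (- ln rmax) + 1"
      unfolding h_def using Ns(3,4) \<eta> by (intro sum_hit_le[where x = "t - x - 2"]) force+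
    also have "\<dots> \<le> 3 / (- ln rmax) + 1"
      using \<eta> ln_rmax_neg by (intro add_right_mono divide_right_mono) auto
    finally show ?thesis by simp
  qed
  have "N * S \<le> 3 / (- ln rmax) + 1"
  proof (rule field_le_epsilon)
    fix e :: real assume "e > 0"
    have "N > 0" using Ns(1) by (cases N) auto
    \<comment> \<open>Chosen so that the total loss over the \<open>N\<close> translates is exactly
      \<open>e\<close>.\<close>
    define \<epsilon> where "\<epsilon> = e * q ^ m / (2 * N)"
    have "\<epsilon> > 0" using \<open>e > 0\<close> q \<open>N > 0\<close> by (simp add: \<epsilon>_def)
    from le[OF this] have "N * S - N * (2 * \<epsilon> / q ^ m) \<le> 3 / (- ln rmax) + 1" by (simp add: right_diff_distrib)
    moreover have "N * (2 * \<epsilon> / q ^ m) = e" using q \<open>N > 0\<close> by (simp add: \<epsilon>_def)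
    ultimately show "N * S \<le> 3 / (- ln rmax) + 1 + e" by simp
  qed
  then have "3 * \<eta> * (N * S) \<le> 3 * \<eta> * (3 / (- ln rmax) + 1)"
    using \<eta> by (intro mult_left_mono) auto
  moreover have "0 \<le> S" unfolding S_def using \<open>1 \<in> B\<close> h0(1)
    by (intro cInf_greatest) (auto simp: B_def intro: order_trans)
  then have "1 * S \<le> 3 * \<eta> * N * S" using Ns(1) by (intro mult_right_mono) auto
  \<comment> \<open>The final \<open>+ 1\<close> in \<open>C\<close> makes the inequality strict, so
    that some member of \<open>B\<close> lies below \<open>C * \<eta>\<close>.\<close>
  ultimately have "S < C * \<eta>" using \<eta> unfolding C_def by (simp add: algebra_simps)
  then obtain c where "c \<in> B" "c < C * \<eta>" using cInf_lessD[of B "C * \<eta>"] \<open>1 \<in> B\<close> unfolding S_def by blast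
  then obtain T where "T \<ge> 0" "\<And>t. t \<ge> T \<Longrightarrow> h t \<le> c" unfolding B_def by blast
  then have "h t \<le> C * \<eta>" if "t \<ge> T" for t
    using that \<open>c < C * \<eta>\<close> by (meson less_imp_le order_trans)
  with \<open>T \<ge> 0\<close> show ?thesis unfolding h_def by (intro exI[of _ T] conjI allI impI)
qed

end

section \<open>Stopping at a given scale\<close>

context weighted_ifs
begin

definition stop :: "real \<Rightarrow> (nat \<Rightarrow> 'i) \<Rightarrow> nat" where
  "stop \<theta> a = (LEAST n. sc a n \<le> \<theta>)"

text \<open>Resampling after the stopping time: \<open>a\<close> supplies the stopped word and
  \<open>b\<close> a fresh continuation, so integrating over \<open>b\<close> amounts to
  conditioning on the stopped word.\<close>

definition join :: "real \<Rightarrow> (nat \<Rightarrow> 'i) \<Rightarrow> (nat \<Rightarrow> 'i) \<Rightarrow> nat \<Rightarrow> 'i" where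
  "join \<theta> a b = comb_seq (stop \<theta> a) a b"

lemma ex_rmax_power_le: "0 < \<theta> \<Longrightarrow> \<exists>n. rmax ^ n \<le> \<theta>"
  using real_arch_pow_inv[of \<theta> rmax] rmax_less_1 less_imp_le by blast

lemma sc_stop_le:
  assumes "0 < \<theta>" shows "sc a (stop \<theta> a) \<le> \<theta>"
proof -
  obtain n where "rmax ^ n \<le> \<theta>" using ex_rmax_power_le[OF assms] by blast
  then have "sc a n \<le> \<theta>" using sc_le[of a n] by linarith
  then show ?thesis unfolding stop_def by (rule LeastI)
qed

lemma stop_le: "sc a n \<le> \<theta> \<Longrightarrow> stop \<theta> a \<le> n"
  unfolding stop_def by (rule Least_le)

lemma stop_le_rmax: "rmax ^ n \<le> \<theta> \<Longrightarrow> stop \<theta> a \<le> n"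
  using sc_le[of a n] by (intro stop_le) linarith

lemma less_stop: "n < stop \<theta> a \<Longrightarrow> \<theta> < sc a n"
  using stop_le[of a n \<theta>] by (meson not_le)

lemma sc_stop_ge:
  assumes "0 < \<theta>" "\<theta> \<le> 1" shows "rmin * \<theta> \<le> sc a (stop \<theta> a)"
proof (cases "stop \<theta> a")
  case 0
  have "rmin * \<theta> \<le> 1 * 1" using assms rmin_pos rmin_less_1 by (intro mult_mono) auto
  with 0 show ?thesis by simp
next
  case (Suc m)
  then have "\<theta> < sc a m" using less_stop[of m \<theta> a] by simp
  then have "rmin * \<theta> \<le> rmin * sc a m" using rmin_pos by simp
  also have "\<dots> \<le> sc a (stop \<theta> a)" unfolding Suc by (rule sc_Suc_ge)
  finally show ?thesis .
qed

lemma stop_antimono: "0 < \<theta> \<Longrightarrow> \<theta> \<le> \<theta>' \<Longrightarrow> stop \<theta>' a \<le> stop \<theta> a"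
  using sc_stop_le[of \<theta> a] by (intro stop_le) linarith

lemma stop_eqI:
  assumes "sc a n \<le> \<theta>" "\<And>m. m < n \<Longrightarrow> \<theta> < sc a m" shows "stop \<theta> a = n"
  unfolding stop_def using assms(2) by (intro Least_equality assms(1)) (meson not_le)

lemma stop_prefix:
  assumes "0 < \<theta>" "\<And>i. i < stop \<theta> a \<Longrightarrow> b i = a i"
  shows "stop \<theta> b = stop \<theta> a"
proof (rule stop_eqI)
  show "sc b (stop \<theta> a) \<le> \<theta>"
    using prefix_cong(1)[of "stop \<theta> a" b a] assms sc_stop_le[of \<theta> a] by simp
  show "\<theta> < sc b m" if "m < stop \<theta> a" for m
    using prefix_cong(1)[of m b a] assms that less_stop[OF that] by simp
qed

lemma join_less: "i < stop \<theta> a \<Longrightarrow> join \<theta> a b i = a i"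
  by (simp add: join_def comb_seq_less)

lemma shift_join: "shift (stop \<theta> a) (join \<theta> a b) = b"
  by (simp add: join_def shift_comb_seq)

lemma stop_join: "0 < \<theta> \<Longrightarrow> stop \<theta> (join \<theta> a b) = stop \<theta> a"
  by (rule stop_prefix) (auto simp: join_less)

lemma stop_join_smaller:
  assumes "0 < \<theta>'" "\<theta>' \<le> \<theta>"
  shows "stop \<theta>' (join \<theta> a b) = stop \<theta> a + stop (\<theta>' / sc a (stop \<theta> a)) b"
proof -
  let ?n = "stop \<theta> a" let ?s = "sc a ?n"
  have sc: "sc (join \<theta> a b) (?n + m) = ?s * sc b m" for m
    using prefix_cong(1)[of ?n "join \<theta> a b" a] by (simp add: sc_add shift_join join_less)
  show ?thesis
  proof (rule stop_eqI)
    show "sc (join \<theta> a b) (?n + stop (\<theta>' / ?s) b) \<le> \<theta>'"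
      using sc_stop_le[of "\<theta>' / ?s" b] sc_pos[of a ?n] assms by (simp add: sc le_divide_eq mult.commute)
    fix m assume m: "m < ?n + stop (\<theta>' / ?s) b"
    show "\<theta>' < sc (join \<theta> a b) m"
    proof (cases "m < ?n")
      case True
      then have "\<theta> < sc a m" by (rule less_stop)
      moreover have "sc (join \<theta> a b) m = sc a m"
        using True by (intro prefix_cong) (auto simp: join_less)
      ultimately show ?thesis using assms by simp
    next
      case False
      then obtain k where k: "m = ?n + k" using le_Suc_ex[of ?n m] by auto
      then have "\<theta>' / ?s < sc b k" using m by (intro less_stop) simp
      then show ?thesis using sc_pos[of a ?n] by (simp add: k sc divide_less_eq mult.commute)
    qed
  qed
qed

text \<open>The counterpart of measurability with respect to the stopped word: \<open>g\<close> does
  not see the letters after the stopping time.\<close>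

definition adapted :: "real \<Rightarrow> ((nat \<Rightarrow> 'i) \<Rightarrow> 'b) \<Rightarrow> bool" where
  "adapted \<theta> g \<longleftrightarrow> (\<forall>a b. (\<forall>i<stop \<theta> a. b i = a i) \<longrightarrow> g b = g a)"

lemma adapted_join: "adapted \<theta> g \<Longrightarrow> g (join \<theta> a b) = g a"
  unfolding adapted_def using join_less by blast

lemma adapted_mono: "adapted \<theta> g \<Longrightarrow> 0 < \<theta>' \<Longrightarrow> \<theta>' \<le> \<theta> \<Longrightarrow> adapted \<theta>' g"
  unfolding adapted_def using stop_antimono less_le_trans by blast

lemma adapted_stop: "0 < \<theta> \<Longrightarrow> adapted \<theta> (stop \<theta>)"
  unfolding adapted_def using stop_prefix by blast

lemma adapted_join_cong:
  assumes "0 < \<theta>" "\<forall>i<stop \<theta> a. b i = a i" shows "join \<theta> b c = join \<theta> a c"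
  using stop_prefix[of \<theta> a b] assms by (auto simp: join_def comb_seq_def fun_eq_iff)

lemma adapted_tr_stop: "0 < \<theta> \<Longrightarrow> adapted \<theta> (\<lambda>a. tr a (stop \<theta> a))"
  unfolding adapted_def
proof (intro allI impI)
  fix a b assume "0 < \<theta>" and eq: "\<forall>i<stop \<theta> a. b i = a i"
  then have "stop \<theta> b = stop \<theta> a" by (intro stop_prefix) auto
  then show "tr b (stop \<theta> b) = tr a (stop \<theta> a)" using eq prefix_cong(4)[of "stop \<theta> a" b a] by simp
qed

lemma adapted_comp: "adapted \<theta> g \<Longrightarrow> adapted \<theta> (\<lambda>a. F (g a))"
  unfolding adapted_def by metis

lemma adapted_comp2: "adapted \<theta> g \<Longrightarrow> adapted \<theta> h \<Longrightarrow> adapted \<theta> (\<lambda>a. F (g a) (h a))"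
  unfolding adapted_def by metis

lemma adapted_imp_determined:
  assumes "adapted \<theta> g" "0 < \<theta>"
  obtains n where "determined n g"
proof -
  obtain n where "rmax ^ n \<le> \<theta>" using ex_rmax_power_le[OF assms(2)] by blast
  then have "stop \<theta> a \<le> n" for a by (rule stop_le_rmax)
  then have "determined n g" using assms(1) unfolding determined_def adapted_def
    by (metis less_le_trans)
  with that show ?thesis .
qed

lemma measurable_adapted:
  "adapted \<theta> g \<Longrightarrow> 0 < \<theta> \<Longrightarrow> g \<in> UNIV \<rightarrow> space N \<Longrightarrow> g \<in> measurable P N"
  by (erule (1) adapted_imp_determined) (rule measurable_determined)

lemma sets_adapted: "adapted \<theta> Q \<Longrightarrow> 0 < \<theta> \<Longrightarrow> {a. Q a} \<in> sets P"
  by (erule (1) adapted_imp_determined) (rule sets_determined)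

lemma measurable_join:
  assumes "0 < \<theta>"
  shows "(\<lambda>(a, b). join \<theta> a b) \<in> measurable (P \<Otimes>\<^sub>M P) P"
proof -
  have [measurable]: "stop \<theta> \<in> measurable P (count_space UNIV)"
    by (rule measurable_adapted[OF adapted_stop]) (auto simp: assms)
  have "(\<lambda>x. comb_seq (stop \<theta> (fst x)) (fst x) (snd x)) \<in> measurable (P \<Otimes>\<^sub>M P) P"
    by (rule measurable_compose_countable'[where f = "\<lambda>n x. comb_seq n (fst x) (snd x)" and I = UNIV])
      (auto intro!: measurable_comb_seq' measurable_compose[OF measurable_fst \<open>stop \<theta> \<in> _\<close>])
  then show ?thesis by (simp add: join_def split_beta')
qed

lemma measurable_join_right: "(\<lambda>b. join \<theta> a b) \<in> measurable P P"
  unfolding join_def by (rule measurable_comb_seq') (auto intro: measurable_const)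

text \<open>The strong Markov property. The stopping time is bounded by a constant \<open>N\<close>,
  so the integral splits into finitely many pieces on which the word is cut at a fixed
  index.\<close>

lemma nn_integral_join:
  assumes \<theta>: "0 < \<theta>" and h[measurable]: "h \<in> borel_measurable P"
  shows "(\<integral>\<^sup>+a. h a \<partial>P) = (\<integral>\<^sup>+a. \<integral>\<^sup>+b. h (join \<theta> a b) \<partial>P \<partial>P)"
proof -
  obtain N where N: "rmax ^ N \<le> \<theta>" using ex_rmax_power_le[OF \<theta>] by blast
  have le: "stop \<theta> a \<le> N" for a by (rule stop_le_rmax[OF N])
  have ms: "{a. stop \<theta> a = n} \<in> sets P" for n
    by (rule sets_adapted[OF adapted_comp[OF adapted_stop[OF \<theta>]] \<theta>])
  have mh: "(\<lambda>b. h (comb_seq n a b)) \<in> borel_measurable P" for n a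
    by (rule measurable_compose[OF measurable_comb_seq' h]) (auto intro: measurable_const)
  have mI: "(\<lambda>a. \<integral>\<^sup>+b. h (comb_seq n a b) \<partial>P) \<in> borel_measurable P" for n
  proof -
    have "(\<lambda>x. h (comb_seq n (fst x) (snd x))) \<in> borel_measurable (P \<Otimes>\<^sub>M P)"
      by (rule measurable_compose[OF measurable_comb_seq' h]) auto
    from seq.P.borel_measurable_nn_integral_fst[OF this] show ?thesis by simp
  qed
  \<comment> \<open>Whether the stopping time equals \<open>n\<close> depends on the first
    \<open>n\<close> letters only, so its indicator leaves the inner integral.\<close>
  have iff: "stop \<theta> (comb_seq n a b) = n \<longleftrightarrow> stop \<theta> a = n" for a b n
  proof
    assume "stop \<theta> (comb_seq n a b) = n"
    then show "stop \<theta> a = n"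
      using stop_prefix[OF \<theta>, of "comb_seq n a b" a] by (simp add: comb_seq_less)
  next
    assume "stop \<theta> a = n"
    then show "stop \<theta> (comb_seq n a b) = n"
      using stop_prefix[OF \<theta>, of a "comb_seq n a b"] by (simp add: comb_seq_less)
  qed
  have split: "x = (\<Sum>n\<le>N. indicator {a. stop \<theta> a = n} a * x)" for a and x :: ennreal
  proof -
    have "(\<Sum>n\<le>N. indicator {a. stop \<theta> a = n} a * x) = (\<Sum>n\<le>N. if n = stop \<theta> a then x else 0)"
      by (intro sum.cong) (auto split: split_indicator)
    also have "\<dots> = x" using le[of a] by (subst sum.delta) auto
    finally show ?thesis by simp
  qed
  have "(\<integral>\<^sup>+a. h a \<partial>P) = (\<integral>\<^sup>+a. (\<Sum>n\<le>N. indicator {a. stop \<theta> a = n} a * h a) \<partial>P)"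
    by (rule nn_integral_cong) (rule split)
  also have "\<dots> = (\<Sum>n\<le>N. \<integral>\<^sup>+a. indicator {a. stop \<theta> a = n} a * h a \<partial>P)"
    by (rule nn_integral_sum) (intro borel_measurable_times_ennreal borel_measurable_indicator ms h)
  also have "\<dots> = (\<Sum>n\<le>N. \<integral>\<^sup>+a. indicator {a. stop \<theta> a = n} a * (\<integral>\<^sup>+b. h (comb_seq n a b) \<partial>P) \<partial>P)"
  proof (intro sum.cong refl)
    fix n
    have "(\<integral>\<^sup>+a. indicator {a. stop \<theta> a = n} a * h a \<partial>P) =
        (\<integral>\<^sup>+a. \<integral>\<^sup>+b. indicator {a. stop \<theta> a = n} (comb_seq n a b) * h (comb_seq n a b) \<partial>P \<partial>P)"
      by (rule nn_integral_comb_seq) (intro borel_measurable_times_ennreal borel_measurable_indicator ms h)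
    also have "\<dots> = (\<integral>\<^sup>+a. \<integral>\<^sup>+b. indicator {a. stop \<theta> a = n} a * h (comb_seq n a b) \<partial>P \<partial>P)"
      by (simp add: indicator_def iff)
    also have "\<dots> = (\<integral>\<^sup>+a. indicator {a. stop \<theta> a = n} a * (\<integral>\<^sup>+b. h (comb_seq n a b) \<partial>P) \<partial>P)"
      by (intro nn_integral_cong nn_integral_cmult mh)
    finally show "(\<integral>\<^sup>+a. indicator {a. stop \<theta> a = n} a * h a \<partial>P) =
        (\<integral>\<^sup>+a. indicator {a. stop \<theta> a = n} a * (\<integral>\<^sup>+b. h (comb_seq n a b) \<partial>P) \<partial>P)" .
  qed
  also have "\<dots> = (\<integral>\<^sup>+a. (\<Sum>n\<le>N. indicator {a. stop \<theta> a = n} a * (\<integral>\<^sup>+b. h (comb_seq n a b) \<partial>P)) \<partial>P)"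
    by (rule nn_integral_sum[symmetric]) (intro borel_measurable_times_ennreal borel_measurable_indicator ms mI)
  also have "\<dots> = (\<integral>\<^sup>+a. (\<Sum>n\<le>N. indicator {a. stop \<theta> a = n} a * (\<integral>\<^sup>+b. h (join \<theta> a b) \<partial>P)) \<partial>P)"
    by (intro nn_integral_cong sum.cong refl) (auto simp: join_def split: split_indicator)
  also have "\<dots> = (\<integral>\<^sup>+a. \<integral>\<^sup>+b. h (join \<theta> a b) \<partial>P \<partial>P)"
    by (rule nn_integral_cong) (rule split[symmetric])
  finally show ?thesis .
qed

lemma emeasure_join:
  assumes "0 < \<theta>" "A \<in> sets P"
  shows "emeasure P A = (\<integral>\<^sup>+a. emeasure P {b. join \<theta> a b \<in> A} \<partial>P)"
proof -
  have "emeasure P A = (\<integral>\<^sup>+a. indicator A a \<partial>P)" using assms by simp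
  also have "\<dots> = (\<integral>\<^sup>+a. \<integral>\<^sup>+b. indicator A (join \<theta> a b) \<partial>P \<partial>P)"
    by (rule nn_integral_join) (use assms in auto)
  also have "\<dots> = (\<integral>\<^sup>+a. emeasure P {b. join \<theta> a b \<in> A} \<partial>P)"
  proof (rule nn_integral_cong)
    fix a
    have "{b. join \<theta> a b \<in> A} \<in> sets P"
      using measurable_sets[OF measurable_join_right assms(2), of \<theta> a] by (simp add: vimage_def)
    moreover have "(\<lambda>b. indicator A (join \<theta> a b) :: ennreal) = indicator {b. join \<theta> a b \<in> A}"
      by (auto simp: fun_eq_iff split: split_indicator)
    ultimately show "(\<integral>\<^sup>+b. indicator A (join \<theta> a b) \<partial>P) = emeasure P {b. join \<theta> a b \<in> A}"
      by simp
  qed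
  finally show ?thesis .
qed

end

section \<open>Dimensions of the two factors\<close>

context weighted_ifs
begin

lemma p_le_1: "p i \<le> 1"
  using member_le_sum[of i UNIV p] less_imp_le[OF p_pos] by (simp add: sum_p)

lemma \<alpha>_nonneg: "0 \<le> \<alpha>"
proof -
  have "(\<Sum>i\<in>UNIV. p i * ln (p i)) \<le> 0"
    using p_le_1 p_pos by (intro sum_nonpos mult_nonneg_nonpos) (auto intro: less_imp_le)
  then show ?thesis unfolding \<alpha>_def using lyapunov_neg by (intro divide_nonpos_neg)
qed

text \<open>Zero entropy forces a single letter of probability 1. The walk is then deterministic and
  visits windows arbitrarily far out with certainty, which contradicts the renewal bound for short
  windows.\<close>

lemma \<alpha>_pos:
  assumes dense: "generates_dense_subgroup (range r)"
  shows "0 < \<alpha>"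
proof (rule ccontr)
  assume "\<not> 0 < \<alpha>"
  then have "(\<Sum>i\<in>UNIV. p i * ln (p i)) = 0" using \<alpha>_nonneg lyapunov_neg by (simp add: \<alpha>_def)
  moreover have "p i * ln (p i) \<le> 0" for i using p_le_1[of i] p_pos[of i] by (simp add: mult_nonneg_nonpos)
  moreover have "(\<Sum>i\<in>UNIV. - (p i * ln (p i))) = 0" using calculation(1) by (simp add: sum_negf)
  ultimately have "- (p i * ln (p i)) = 0" for i
    using sum_nonneg_eq_0_iff[of UNIV "\<lambda>i. - (p i * ln (p i))"] by simp
  then have "p i * ln (p i) = 0" for i by simp
  then have p1: "p i = 1" for i using p_pos[of i] by (metis less_irrefl ln_eq_zero_iff mult_eq_0_iff)
  have "i = j" for i j :: 'i
  proof (rule ccontr)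
    assume "i \<noteq> j"
    then have "(\<Sum>k\<in>{i, j}. p k) = 2" using p1 by simp
    moreover have "(\<Sum>k\<in>{i, j}. p k) \<le> (\<Sum>k\<in>UNIV. p k)"
      using less_imp_le[OF p_pos] by (intro sum_mono2) auto
    ultimately show False by (simp add: sum_p)
  qed
  then have all_eq: "a = b" for a b :: "nat \<Rightarrow> 'i" by (intro ext)
  define C where "C = 3 * (3 / (- ln rmax) + 1) + 1"
  have "0 \<le> 3 / (- ln rmax)" using ln_rmax_neg by (intro divide_nonneg_pos) auto
  then have "4 \<le> C" by (simp add: C_def)
  define \<eta> where "\<eta> = 1 / (2 * C)"
  have \<eta>: "0 < \<eta>" "\<eta> \<le> 1" "C * \<eta> < 1" using \<open>4 \<le> C\<close> by (auto simp: \<eta>_def)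
  obtain T where T: "\<And>t. t \<ge> T \<Longrightarrow> measure P (hit \<eta> t) \<le> C * \<eta>"
    using renewal_bound[OF dense \<eta>(1,2)] unfolding C_def by blast
  define a :: "nat \<Rightarrow> 'i" where "a = (\<lambda>_. undefined)"
  have "\<exists>n. sc a n \<le> exp (- T)"
    using ex_rmax_power_le[of "exp (- T)"] sc_le[of a] order_trans by (metis exp_gt_zero)
  then obtain n where "sc a n \<le> exp (- T)" by blast
  then have "T \<le> - ln (sc a n)" using sc_pos[of a n] by (metis exp_ln exp_le_cancel_iff le_minus_iff minus_minus)
  from T[OF this] have "measure P (hit \<eta> (- ln (sc a n))) < 1" using \<eta> by linarith
  moreover have "hit \<eta> (- ln (sc a n)) = UNIV"
    using \<eta>(1) all_eq[of _ a] unfolding hit_def by (metis (mono_tags, lifting) UNIV_eq_I add_increasing2 less_imp_le mem_Collect_eq order_refl)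
  ultimately show False using seq.P.prob_space by simp
qed

abbreviation \<mu> :: "real measure" where "\<mu> \<equiv> distr P borel cod"

sublocale mu: prob_space \<mu>
  by (rule seq.P.prob_space_distr) (rule measurable_cod)

lemma measure_\<mu>_cball: "measure \<mu> (cball x R) = measure P {b. \<bar>x - cod b\<bar> \<le> R}"
  by (subst measure_distr[OF measurable_cod]) (auto simp: vimage_def dist_real_def)

lemma AE_local_dim_ge_\<mu>:
  assumes sep: "strong_separation f"
  shows "AE a in P. local_dim_ge \<mu> \<alpha> (cod a)"
proof -
  obtain D where D: "D > 0" "\<And>a b. a 0 \<noteq> b 0 \<Longrightarrow> D \<le> \<bar>cod a - cod b\<bar>"
    by (rule separation_gap[OF sep]) blast
  have "AE a in P. \<forall>j. \<exists>k::nat. a \<in> good (\<alpha> - 1 / Suc j) (real k)"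
    unfolding AE_all_countable by (intro allI AE_good) simp
  then show ?thesis
  proof eventually_elim
    case (elim a)
    show ?case unfolding local_dim_ge_def
    proof
      fix j
      define \<sigma> where "\<sigma> = \<alpha> - 1 / Suc j"
      show "\<exists>k::nat. \<forall>n. measure \<mu> (cball (cod a) (1 / 2 ^ n)) \<le> k * (1 / 2 ^ n) powr (\<alpha> - 1 / Suc j)"
      proof (cases "0 \<le> \<sigma>")
        case True
        obtain K :: nat where K: "a \<in> good \<sigma> (real K)" using elim unfolding \<sigma>_def by blast
        obtain k :: nat where k: "K / D powr \<sigma> \<le> real k" using real_arch_simple by blast
        have "measure \<mu> (cball (cod a) (1 / 2 ^ n)) \<le> k * (1 / 2 ^ n) powr \<sigma>" for n
        proof -
          have "measure \<mu> (cball (cod a) (1 / 2 ^ n)) \<le> K * (1 / 2 ^ n / D) powr \<sigma>"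
            unfolding measure_\<mu>_cball by (rule good_ball[OF D(2,1) K True]) simp_all
          also have "\<dots> = K / D powr \<sigma> * (1 / 2 ^ n) powr \<sigma>"
            using D(1) powr_divide[of "1 / 2 ^ n" D \<sigma>] by (simp del: divide_divide_eq_left divide_divide_eq_right)
          also have "\<dots> \<le> k * (1 / 2 ^ n) powr \<sigma>" using k by (intro mult_right_mono) auto
          finally show ?thesis .
        qed
        then show ?thesis unfolding \<sigma>_def by blast
      next
        case False
        have "measure \<mu> (cball (cod a) (1 / 2 ^ n)) \<le> real 1 * (1 / 2 ^ n) powr \<sigma>" for n :: nat
        proof -
          have "1 powr \<sigma> \<le> (1 / 2 ^ n) powr \<sigma>" using False by (intro powr_mono2') auto
          then have "1 \<le> (1 / 2 ^ n) powr \<sigma>" by simp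
          then show ?thesis unfolding of_nat_1 mult_1
            using mu.prob_le_1[of "cball (cod a) (1 / 2 ^ n)"] by (rule order_trans[rotated])
        qed
        then show ?thesis unfolding \<sigma>_def by blast
      qed
    qed
  qed
qed

text \<open>The cylinder of a word stopped at scale \<open>t / (2 * bnd)\<close> is mapped into the
  ball of radius \<open>t\<close>, and \<open>AE_pr_ge\<close> bounds its probability from below by
  a power of its contraction.\<close>

lemma AE_local_dim_le_\<mu>: "AE a in P. local_dim_le \<mu> \<alpha> (cod a)"
proof -
  have "AE a in P. \<forall>j. \<forall>\<^sub>F n in sequentially. sc a n powr (\<alpha> + 1 / Suc j) \<le> pr a n"
    unfolding AE_all_countable by (intro allI AE_pr_ge) simp
  then show ?thesis
  proof eventually_elim
    case (elim a)
    show ?case unfolding local_dim_le_def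
    proof
      fix j
      define \<sigma> where "\<sigma> = \<alpha> + 1 / Suc j"
      have \<sigma>0: "0 \<le> \<sigma>" using \<alpha>_nonneg by (simp add: \<sigma>_def)
      have "\<forall>\<^sub>F n in sequentially. sc a n powr \<sigma> \<le> 1 * pr a n"
        using elim unfolding \<sigma>_def by simp
      from eventually_le_imp_bounded_ratio[OF this pr_pos]
      obtain K :: nat where K: "\<And>n. sc a n powr \<sigma> \<le> K * pr a n" by blast
      \<comment> \<open>The contraction of the word stopped for radius \<open>t\<close> is at least
        \<open>c * t\<close>.\<close>
      define c where "c = rmin / (2 * bnd)"
      have c: "0 < c" using rmin_pos bnd_ge_1 by (simp add: c_def)
      obtain k :: nat where k: "K / c powr \<sigma> \<le> real k" using real_arch_simple by blast
      have "(1 / 2 ^ n) powr \<sigma> \<le> k * measure \<mu> (cball (cod a) (1 / 2 ^ n))" for n :: nat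
      proof -
        define t :: real where "t = 1 / 2 ^ n"
        have t: "0 < t" "t \<le> 1" by (auto simp: t_def)
        define \<theta> where "\<theta> = t / (2 * bnd)"
        have \<theta>: "0 < \<theta>" "\<theta> \<le> 1" using t bnd_ge_1 by (auto simp: \<theta>_def divide_le_eq)
        define m where "m = stop \<theta> a"
        have "{b. \<forall>i<m. b i = a i} \<subseteq> {b. \<bar>cod a - cod b\<bar> \<le> t}"
        proof
          fix b assume "b \<in> {b. \<forall>i<m. b i = a i}"
          then have "\<bar>cod a - cod b\<bar> \<le> sc a m * (2 * bnd)" by (intro cod_diff_le) auto
          also have "\<dots> \<le> \<theta> * (2 * bnd)"
            using sc_stop_le[OF \<theta>(1), of a] bnd_ge_1 unfolding m_def by (intro mult_right_mono) auto
          also have "\<dots> = t" using bnd_ge_1 by (simp add: \<theta>_def)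
          finally show "b \<in> {b. \<bar>cod a - cod b\<bar> \<le> t}" by simp
        qed
        moreover have "{b. \<bar>cod a - cod b\<bar> \<le> t} \<in> sets P"
        proof -
          have "{b \<in> space P. \<bar>cod a - cod b\<bar> \<le> t} \<in> sets P" by measurable
          then show ?thesis by simp
        qed
        ultimately have "measure P {b. \<forall>i<m. b i = a i} \<le> measure P {b. \<bar>cod a - cod b\<bar> \<le> t}"
          by (intro seq.P.finite_measure_mono)
        then have pr_le: "pr a m \<le> measure \<mu> (cball (cod a) t)"
          using emeasure_cylinder[of m a] less_imp_le[OF pr_pos]
          by (simp add: measure_\<mu>_cball seq.P.emeasure_eq_measure)
        have "c powr \<sigma> * t powr \<sigma> = (rmin * \<theta>) powr \<sigma>"
          using c t by (simp add: powr_mult[symmetric] c_def \<theta>_def)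
        also have "\<dots> \<le> sc a m powr \<sigma>"
          using sc_stop_ge[OF \<theta>, of a] \<sigma>0 \<theta> rmin_pos unfolding m_def by (intro powr_mono2) auto
        also have "\<dots> \<le> K * pr a m" by (rule K)
        also have "\<dots> \<le> K * measure \<mu> (cball (cod a) t)" using pr_le by (intro mult_left_mono) auto
        finally have "t powr \<sigma> \<le> K / c powr \<sigma> * measure \<mu> (cball (cod a) t)"
          using c by (simp add: field_simps)
        also have "\<dots> \<le> k * measure \<mu> (cball (cod a) t)" using k by (intro mult_right_mono) auto
        finally show ?thesis by (simp add: t_def)
      qed
      then show "\<exists>k::nat. \<forall>n. (1 / 2 ^ n) powr (\<alpha> + 1 / Suc j) \<le> k * measure \<mu> (cball (cod a) (1 / 2 ^ n))"
        unfolding \<sigma>_def by blast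
    qed
  qed
qed

lemma has_exact_dim_\<mu>:
  assumes "strong_separation f"
  shows "has_exact_dim \<mu> \<alpha>"
proof -
  have fin: "finite_measure \<mu>" by unfold_locales
  have "AE a in P. local_dim_ge \<mu> \<alpha> (cod a) \<and> local_dim_le \<mu> \<alpha> (cod a)"
    using AE_local_dim_ge_\<mu>[OF assms] AE_local_dim_le_\<mu> by eventually_elim simp
  then have "AE x in \<mu>. local_dim_ge \<mu> \<alpha> x \<and> local_dim_le \<mu> \<alpha> x"
    using sets_local_dim[OF fin, of \<alpha>] by (subst AE_distr_iff[OF measurable_cod]) (auto simp: Collect_conj_eq)
  then show ?thesis unfolding has_exact_dim_def
    by eventually_elim (rule local_dim_imp_tendsto[OF fin], auto)
qed

end

lemma ahlfors_point_local_dim: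
  assumes "0 < c" and "\<forall>r. 0 < r \<and> r \<le> 1 \<longrightarrow>
     inverse c * r powr \<beta> \<le> measure \<nu> (cball y r) \<and> measure \<nu> (cball y r) \<le> c * r powr \<beta>"
  shows "local_dim_ge \<nu> \<beta> y \<and> local_dim_le \<nu> \<beta> y"
proof -
  obtain k :: nat where k: "c \<le> real k" using real_arch_simple by blast
  have up: "measure \<nu> (cball y (1 / 2 ^ n)) \<le> k * (1 / 2 ^ n) powr \<beta>" for n :: nat
    using assms(2)[rule_format, of "1 / 2 ^ n"] mult_right_mono[OF k, of "(1 / 2 ^ n) powr \<beta>"]
      by (smt (verit) divide_pos_pos one_le_power powr_ge_zero zero_less_power divide_le_eq_1)
  have low: "(1 / 2 ^ n) powr \<beta> \<le> k * measure \<nu> (cball y (1 / 2 ^ n))" for n :: nat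
  proof -
    have "(1 / 2 ^ n) powr \<beta> \<le> c * measure \<nu> (cball y (1 / 2 ^ n))"
      using assms(1) assms(2)[rule_format, of "1 / 2 ^ n"] by (auto simp: field_simps)
    also have "\<dots> \<le> k * measure \<nu> (cball y (1 / 2 ^ n))" using k by (intro mult_right_mono) auto
    finally show ?thesis .
  qed
  have "(1 / 2 ^ n) powr \<beta> \<le> (1 / 2 ^ n) powr (\<beta> - 1 / Suc j)"
    "(1 / 2 ^ n) powr (\<beta> + 1 / Suc j) \<le> (1 / 2 ^ n) powr \<beta>" for n j :: nat
    by (intro powr_mono'; simp)+
  then show ?thesis
    unfolding local_dim_ge_def local_dim_le_def
    using up low by (intro conjI allI exI[of _ k]) (blast intro: order_trans mult_left_mono of_nat_0_le_iff)+
qed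

section \<open>The grid tree of a regular set\<close>

text \<open>In an a.e.-Ahlfors measure the constant varies with the point. \<open>A\<close> is a
  bounded piece on which one \<open>K\<close> works; the balls are centred in \<open>A\<close>, but
  their mass is that of the whole \<nu>.\<close>

locale regular_set = prob_space \<nu> for \<nu> :: "real measure" +
  fixes \<beta> K :: real and A :: "real set"
  assumes sets_nu: "sets \<nu> = sets borel" and \<beta>_pos: "0 < \<beta>" and K_ge_1: "1 \<le> K"
    and A_bounded: "A \<subseteq> {-K..K}" and A_sets: "A \<in> sets borel"
    and A_lower: "\<And>y i. y \<in> A \<Longrightarrow> (1 / 2 ^ i) powr \<beta> \<le> K * measure \<nu> (cball y (1 / 2 ^ i))"
    and A_upper: "\<And>y i. y \<in> A \<Longrightarrow> measure \<nu> (cball y (1 / 2 ^ i)) \<le> K * (1 / 2 ^ i) powr \<beta>"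
begin

definition idx :: "nat \<Rightarrow> real \<Rightarrow> int" where "idx l y = \<lfloor>y * 2 ^ l\<rfloor>"

text \<open>The cells of side \<open>1 / 2 ^ l\<close> that meet \<open>A\<close>. They are the
  nodes of a tree in which the ancestor \<open>i\<close> levels up is obtained by integer division
  by \<open>2 ^ i\<close>.\<close>

definition T :: "nat \<Rightarrow> int set" where "T l = idx l ` A"

text \<open>The 3 bounds the overlap of the balls around representatives of the cells, the two
  factors \<open>K\<close> come from the lower and the upper mass bound, and
  \<open>4 powr \<beta>\<close> from a ball enlarged by the factor 4.\<close>

definition bb :: real where "bb = 3 * K\<^sup>2 * 4 powr \<beta>"

lemma bb_ge_1: "1 \<le> bb"
proof -
  have "1 * 1 \<le> K\<^sup>2 * 4 powr \<beta>"
    using K_ge_1 \<beta>_pos by (intro mult_mono) (auto simp: one_le_power ge_one_powr_ge_zero)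
  then show ?thesis by (simp add: bb_def)
qed

lemma idx_le: "real_of_int (idx l y) \<le> y * 2 ^ l" "y * 2 ^ l < real_of_int (idx l y) + 1"
  unfolding idx_def by linarith+

lemma finite_T: "finite (T l)"
proof (rule finite_subset)
  show "T l \<subseteq> {\<lfloor>-K * 2 ^ l\<rfloor>..\<lfloor>K * 2 ^ l\<rfloor>}"
  proof
    fix j assume "j \<in> T l"
    then obtain y where y: "y \<in> A" "j = \<lfloor>y * 2 ^ l\<rfloor>" by (auto simp: T_def idx_def)
    then have "-K \<le> y" "y \<le> K" using A_bounded by auto
    from mult_right_mono[OF this(1), of "2 ^ l"] mult_right_mono[OF this(2), of "2 ^ l"]
    show "j \<in> {\<lfloor>-K * 2 ^ l\<rfloor>..\<lfloor>K * 2 ^ l\<rfloor>}" unfolding y(2) by (auto intro!: floor_mono)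
  qed
qed simp

lemma idx_div: "idx (l + i) y div 2 ^ i = idx l y"
proof -
  have "\<lfloor>y * 2 ^ (l + i) / real_of_int (2 ^ i)\<rfloor> = \<lfloor>y * 2 ^ (l + i)\<rfloor> div 2 ^ i"
    by (rule floor_divide_real_eq_div) simp
  then show ?thesis by (simp add: idx_def power_add)
qed

lemma T_div: "j \<in> T (l + i) \<Longrightarrow> j div 2 ^ i \<in> T l"
  by (auto simp: T_def idx_div)

lemma measure_cell: "measure \<nu> {y \<in> A. idx l y = j} \<le> K * (1 / 2 ^ l) powr \<beta>"
proof (cases "{y \<in> A. idx l y = j} = {}")
  case False
  then obtain y0 where y0: "y0 \<in> A" "idx l y0 = j" by blast
  have "{y \<in> A. idx l y = j} \<subseteq> cball y0 (1 / 2 ^ l)"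
  proof
    fix y assume "y \<in> {y \<in> A. idx l y = j}"
    then have "\<bar>y0 * 2 ^ l - y * 2 ^ l\<bar> \<le> 1" using y0(2) idx_le[where l = l and y = y] idx_le[where l = l and y = y0] by auto
    moreover have "\<bar>y0 * 2 ^ l - y * 2 ^ l\<bar> = \<bar>y0 - y\<bar> * 2 ^ l"
      by (simp only: left_diff_distrib[symmetric] abs_mult) simp
    ultimately show "y \<in> cball y0 (1 / 2 ^ l)" by (simp add: dist_real_def field_simps)
  qed
  then have "measure \<nu> {y \<in> A. idx l y = j} \<le> measure \<nu> (cball y0 (1 / 2 ^ l))"
    by (intro finite_measure_mono) (auto simp: sets_nu)
  with A_upper[OF y0(1), of l] show ?thesis by linarith
next
  case True
  then show ?thesis using K_ge_1 by (simp only: measure_empty) simp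
qed

lemma measure_cball_le:
  assumes "y \<in> A"
  shows "measure \<nu> (cball y (2 ^ i / 2 ^ l)) \<le> K * (2 ^ i / 2 ^ l) powr \<beta>"
proof (cases "i \<le> l")
  case True
  then have "(2::real) ^ i / 2 ^ l = 1 / 2 ^ (l - i)" by (simp add: power_diff)
  then show ?thesis using A_upper[OF assms] by simp
next
  case False
  then have "(1::real) \<le> 2 ^ i / 2 ^ l" by simp
  then have "1 \<le> ((2::real) ^ i / 2 ^ l) powr \<beta>" using \<beta>_pos by (intro ge_one_powr_ge_zero) auto
  then have "1 * 1 \<le> K * (2 ^ i / 2 ^ l) powr \<beta>" using K_ge_1 by (intro mult_mono) auto
  then show ?thesis using prob_le_1[of "cball y (2 ^ i / 2 ^ l)"] by linarith
qed

text \<open>A packing argument. Every cell gets a representative in \<open>A\<close>. The balls of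
  radius \<open>1 / 2 ^ l\<close> around the representatives cover any point at most three times,
  lie in one ball of radius \<open>4 * 2 ^ i / 2 ^ l\<close>, and each has mass at least
  \<open>(1 / 2 ^ l) powr \<beta> / K\<close>. The upper mass bound of the large ball limits their
  number.\<close>

lemma card_T_near:
  assumes "j0 \<in> T l"
  shows "real (card {j \<in> T l. \<bar>j - j0\<bar> \<le> 2 ^ i}) \<le> bb * (2 ^ i) powr \<beta>"
proof -
  define S where "S = {j \<in> T l. \<bar>j - j0\<bar> \<le> 2 ^ i}"
  have fin: "finite S" using finite_T by (simp add: S_def)
  obtain y0 where y0: "y0 \<in> A" "j0 = idx l y0" using assms by (auto simp: T_def)
  have "\<forall>j\<in>S. \<exists>y. y \<in> A \<and> j = idx l y" by (auto simp: S_def T_def)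
  then obtain y where y: "\<And>j. j \<in> S \<Longrightarrow> y j \<in> A \<and> j = idx l (y j)" by metis
  define R :: real where "R = 2 ^ (i + 2) / 2 ^ l"
  have scale: "z \<in> cball w (s / 2 ^ l) \<longleftrightarrow> \<bar>w * 2 ^ l - z * 2 ^ l\<bar> \<le> s" for z w s :: real
  proof -
    have "\<bar>w * 2 ^ l - z * 2 ^ l\<bar> = \<bar>w - z\<bar> * 2 ^ l"
      by (simp only: left_diff_distrib[symmetric] abs_mult) simp
    then show ?thesis by (simp add: dist_real_def field_simps)
  qed
  have pt: "(\<Sum>j\<in>S. indicator (cball (y j) (1 / 2 ^ l)) z) \<le> (3 * indicator (cball y0 R) z :: real)" for z :: real
  proof -
    let ?S = "{j\<in>S. z \<in> cball (y j) (1 / 2 ^ l)}"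
    have sub: "?S \<subseteq> {idx l z - 1..idx l z + 1}"
    proof
      fix j assume j: "j \<in> ?S"
      then have "\<bar>y j * 2 ^ l - z * 2 ^ l\<bar> \<le> 1" using scale by blast
      moreover have "idx l (y j) = j" using y j by auto
      ultimately show "j \<in> {idx l z - 1..idx l z + 1}"
        using idx_le[where l = l and y = "y j"] idx_le[where l = l and y = z] by auto
    qed
    have c3: "card ?S \<le> 3" using card_mono[OF _ sub] by simp
    have eq: "(\<Sum>j\<in>S. indicator (cball (y j) (1 / 2 ^ l)) z) = real (card ?S)"
      using fin by (simp add: indicator_def sum.If_cases Int_def)
    show ?thesis
    proof (cases "?S = {}")
      case True
      then have "card ?S = 0" by (simp only: card.empty)
      then show ?thesis unfolding eq by simp
    next
      case False
      then obtain j where j: "j \<in> ?S" by blast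
      then have "\<bar>y j * 2 ^ l - z * 2 ^ l\<bar> \<le> 1" using scale by blast
      moreover have "idx l (y j) = j" using y j by auto
      moreover have "\<bar>j - j0\<bar> \<le> 2 ^ i" using j by (auto simp: S_def)
      then have "real_of_int \<bar>j - j0\<bar> \<le> real_of_int (2 ^ i)" by (simp only: of_int_le_iff)
      then have "\<bar>real_of_int j - real_of_int j0\<bar> \<le> 2 ^ i" by simp
      moreover have "1 \<le> (2::real) ^ i" by simp
      ultimately have "\<bar>y0 * 2 ^ l - z * 2 ^ l\<bar> \<le> 4 * 2 ^ i"
        using idx_le[where l = l and y = "y j"] idx_le[where l = l and y = y0] y0(2) by linarith
      then have "z \<in> cball y0 R" unfolding R_def scale by (simp add: power_add)
      then show ?thesis unfolding eq using c3 by simp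
    qed
  qed
  have sets_cball: "cball z t \<in> sets \<nu>" for z t :: real by (simp add: sets_nu)
  have "real (card S) * (1 / 2 ^ l) powr \<beta> = (\<Sum>j\<in>S. (1 / 2 ^ l) powr \<beta>)" by simp
  also have "\<dots> \<le> (\<Sum>j\<in>S. K * measure \<nu> (cball (y j) (1 / 2 ^ l)))"
    using A_lower y by (intro sum_mono) blast
  also have "\<dots> = K * (\<Sum>j\<in>S. (\<integral>z. indicat_real (cball (y j) (1 / 2 ^ l)) z \<partial>\<nu>))"
    using sets_cball by (simp add: sum_distrib_left)
  also have "(\<Sum>j\<in>S. (\<integral>z. indicat_real (cball (y j) (1 / 2 ^ l)) z \<partial>\<nu>)) =
      (\<integral>z. (\<Sum>j\<in>S. indicat_real (cball (y j) (1 / 2 ^ l)) z) \<partial>\<nu>)"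
    using sets_cball
    by (intro Bochner_Integration.integral_sum[symmetric] integrable_real_indicator) (auto simp: emeasure_eq_measure)
  also have "\<dots> \<le> (\<integral>z. 3 * indicat_real (cball y0 R) z \<partial>\<nu>)"
    by (intro integral_mono Bochner_Integration.integrable_sum integrable_real_indicator integrable_mult_right pt)
      (auto simp: emeasure_eq_measure sets_cball)
  also have "\<dots> = 3 * measure \<nu> (cball y0 R)" using sets_cball by simp
  also have "\<dots> \<le> 3 * (K * R powr \<beta>)"
    using measure_cball_le[OF y0(1), of "i + 2" l] unfolding R_def by (intro mult_left_mono) auto
  also have "R powr \<beta> = 4 powr \<beta> * (2 ^ i) powr \<beta> * (1 / 2 ^ l) powr \<beta>"
    by (simp add: R_def power_add powr_mult powr_divide)
  finally have "real (card S) * (1 / 2 ^ l) powr \<beta> \<le> bb * (2 ^ i) powr \<beta> * (1 / 2 ^ l) powr \<beta>"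
    using K_ge_1 by (simp add: bb_def power2_eq_square mult_ac)
  then show ?thesis unfolding S_def[symmetric] by (rule mult_right_le_imp_le) simp
qed

lemma card_children:
  "real (card {j \<in> T (l + m). j div 2 ^ m = i}) \<le> bb * (2 ^ m) powr \<beta>"
proof (cases "{j \<in> T (l + m). j div 2 ^ m = i} = {}")
  case False
  then obtain j0 where j0: "j0 \<in> T (l + m)" "j0 div 2 ^ m = i" by blast
  have "\<bar>j - j0\<bar> \<le> 2 ^ m" if "j div 2 ^ m = i" for j
  proof -
    have "j = 2 ^ m * i + j mod 2 ^ m" "j0 = 2 ^ m * i + j0 mod 2 ^ m"
      using that j0(2) by (metis mult_div_mod_eq)+
    moreover have "0 \<le> j mod 2 ^ m" "j mod 2 ^ m < 2 ^ m" "0 \<le> j0 mod 2 ^ m" "j0 mod 2 ^ m < 2 ^ m" by auto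
    ultimately show ?thesis by linarith
  qed
  then have "{j \<in> T (l + m). j div 2 ^ m = i} \<subseteq> {j \<in> T (l + m). \<bar>j - j0\<bar> \<le> 2 ^ m}" by auto
  then have "card {j \<in> T (l + m). j div 2 ^ m = i} \<le> card {j \<in> T (l + m). \<bar>j - j0\<bar> \<le> 2 ^ m}"
    by (intro card_mono) (auto simp: finite_T)
  also have "real \<dots> \<le> bb * (2 ^ m) powr \<beta>" by (rule card_T_near[OF j0(1)])
  finally show ?thesis by simp
next
  case True
  then show ?thesis using bb_ge_1 by (simp only: card.empty) simp
qed

end

section \<open>Counting near a point of the line\<close>

lemma mult_interchange: "(t * x) * (y * z) = (t * y) * (z * x)" for t x y z :: ennreal
  by (metis mult.assoc mult.commute)

text \<open>One ratio \<open>1 / 2 ^ m\<close> governs both factors: step \<open>k\<close> stops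
  words at the \<open>k\<close>-th power of this ratio and uses grid cells of the same side, which
  form level \<open>m * k\<close> of the tree. \<zeta> is the threshold for the conditional mass of
  a light step.\<close>

locale scheme = weighted_ifs r u v p + regular_set \<nu> \<beta> K A
  for r u v p :: "'i::finite \<Rightarrow> real" and \<nu> :: "real measure" and \<beta> K :: real and A :: "real set" +
  fixes m :: nat and \<zeta> :: real
  assumes m_pos: "0 < m" and \<zeta>: "0 < \<zeta>" "\<zeta> \<le> 1"
begin

definition rho :: real where "rho = 1 / 2 ^ m"

lemma rho: "0 < rho" "rho \<le> 1 / 2" "rho < 1"
proof -
  show "0 < rho" by (simp add: rho_def)
  have "(2::real) ^ 1 \<le> 2 ^ m" using m_pos by (intro power_increasing) auto
  then show "rho \<le> 1 / 2" by (simp add: rho_def field_simps)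
  then show "rho < 1" by simp
qed

lemma rho_power_pos: "0 < rho ^ k"
  using rho by simp

lemma rho_power_le_1: "rho ^ k \<le> 1"
  using rho by (intro power_le_one) auto

lemma rho_power_mono: "k \<le> n \<Longrightarrow> rho ^ n \<le> rho ^ k"
  using rho by (intro power_decreasing) auto

lemma rho_power: "rho ^ k = 1 / 2 ^ (m * k)"
  by (simp add: rho_def power_divide power_mult)

definition pos :: "nat \<Rightarrow> (nat \<Rightarrow> 'i) \<Rightarrow> real" where
  "pos k a = tr a (stop (rho ^ k) a)"

text \<open>Large enough that nearness passes to the parent cell, and that replacing two positions
  by codes costs at most \<open>cc\<close> times the scale.\<close>

definition cc :: real where "cc = 4 * (bnd + 1)"

text \<open>The weight \<open>rho powr \<beta>\<close> stands for the \<open>\<nu>\<close>-mass of a child cell relative to its parent, so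
  \<open>mass k a j\<close> is the conditional probability that a fresh step from the same stopped word and the
  same parent cell ends near the given one.\<close>

definition mass :: "nat \<Rightarrow> (nat \<Rightarrow> 'i) \<Rightarrow> int \<Rightarrow> real" where
  "mass k a j = rho powr \<beta> * (\<Sum>j' | j' \<in> T (m * Suc k) \<and> j' div 2 ^ m = j div 2 ^ m.
     measure P {b. \<bar>pos (Suc k) (join (rho ^ k) a b) + j' * rho ^ Suc k - (pos (Suc k) a + j * rho ^ Suc k)\<bar>
       \<le> 2 * cc * rho ^ Suc k})"

definition light :: "nat \<Rightarrow> (nat \<Rightarrow> 'i) \<Rightarrow> int \<Rightarrow> bool" where
  "light k a j \<longleftrightarrow> mass k a j \<le> \<zeta>"

text \<open>The cell \<open>j div 2 ^ (m * (n - Suc k))\<close> is the ancestor of \<open>j\<close> at level \<open>Suc k\<close>.\<close>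

definition cnt :: "nat \<Rightarrow> (nat \<Rightarrow> 'i) \<Rightarrow> int \<Rightarrow> nat" where
  "cnt n a j = card {k. k < n \<and> light k a (j div 2 ^ (m * (n - Suc k)))}"

definition near :: "real \<Rightarrow> nat \<Rightarrow> (nat \<Rightarrow> 'i) \<Rightarrow> int \<Rightarrow> bool" where
  "near z n a j \<longleftrightarrow> \<bar>pos n a + j * rho ^ n - z\<bar> \<le> cc * rho ^ n"

lemma adapted_pos: "adapted (rho ^ k) (pos k)"
  using adapted_tr_stop[OF rho_power_pos[of k]] by (simp add: pos_def[abs_def])

lemma adapted_near: "adapted (rho ^ n) (\<lambda>a. near z n a j)"
  unfolding near_def by (rule adapted_comp[OF adapted_pos, where F = "\<lambda>x. \<bar>x + j * rho ^ n - z\<bar> \<le> cc * rho ^ n"])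

lemma adapted_light: "adapted (rho ^ Suc k) (\<lambda>a. light k a j)"
  unfolding adapted_def
proof (intro allI impI)
  fix a b assume eq: "\<forall>i<stop (rho ^ Suc k) a. b i = a i"
  have "pos (Suc k) b = pos (Suc k) a"
    using adapted_pos[of "Suc k"] eq unfolding adapted_def by blast
  moreover have "stop (rho ^ k) a \<le> stop (rho ^ Suc k) a"
    by (rule stop_antimono[OF rho_power_pos rho_power_mono]) simp
  then have "join (rho ^ k) b c = join (rho ^ k) a c" for c
    using eq by (intro adapted_join_cong[OF rho_power_pos]) auto
  ultimately show "light k b j = light k a j"
    unfolding light_def mass_def by (simp only:)
qed

lemma adapted_cnt: "adapted (rho ^ n) (\<lambda>a. cnt n a j)"
proof -
  have "light k b j = light k a j" if "k < n" "\<forall>i<stop (rho ^ n) a. b i = a i" for k a b j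
  proof -
    have "adapted (rho ^ n) (\<lambda>a. light k a j)"
      using that(1) by (intro adapted_mono[OF adapted_light] rho_power_pos rho_power_mono) auto
    then show ?thesis using that(2) unfolding adapted_def by blast
  qed
  then have "{k. k < n \<and> light k b (j div 2 ^ (m * (n - Suc k)))} = {k. k < n \<and> light k a (j div 2 ^ (m * (n - Suc k)))}"
    if "\<forall>i<stop (rho ^ n) a. b i = a i" for a b
    using that by (intro Collect_cong conj_cong refl) blast
  then show ?thesis unfolding adapted_def cnt_def by simp
qed

lemma cnt_Suc: "cnt (Suc n) a j = cnt n a (j div 2 ^ m) + (if light n a j then 1 else 0)"
proof -
  have eq: "j div 2 ^ (m * (Suc n - Suc k)) = (j div 2 ^ m) div 2 ^ (m * (n - Suc k))" if "k < n" for k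
  proof -
    have "m * (Suc n - Suc k) = m + m * (n - Suc k)"
      using that by (simp add: Suc_diff_Suc[symmetric] del: Suc_diff_Suc)
    then show ?thesis by (simp add: power_add zdiv_zmult2_eq)
  qed
  have "{k. k < Suc n \<and> light k a (j div 2 ^ (m * (Suc n - Suc k)))} =
      {k. k < n \<and> light k a ((j div 2 ^ m) div 2 ^ (m * (n - Suc k)))} \<union> (if light n a j then {n} else {})"
    using eq by (auto simp: less_Suc_eq)
  then show ?thesis unfolding cnt_def by (auto simp: card_insert_if)
qed

lemma cod_pos: "\<bar>cod a - pos k a\<bar> \<le> rho ^ k * bnd"
proof -
  have "\<bar>cod a - pos k a\<bar> \<le> sc a (stop (rho ^ k) a) * bnd" unfolding pos_def by (rule cod_minus_tr)
  also have "\<dots> \<le> rho ^ k * bnd"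
    using sc_stop_le[OF rho_power_pos[of k], of a] bnd_ge_1 by (intro mult_right_mono) auto
  finally show ?thesis .
qed

text \<open>Since \<open>rho\<close> is at most 1/2, the error allowed at the child is at most half
  of the error allowed at the parent. The other half pays for moving \<open>pos\<close> back one
  step and for the place of the child inside its parent.\<close>

lemma near_parent:
  assumes "near z (Suc n) a j"
  shows "near z n a (j div 2 ^ m)"
proof -
  define e where "e = rho ^ n"
  have e: "0 < e" using rho_power_pos by (simp add: e_def)
  have e': "rho ^ Suc n = rho * e" "rho * e \<le> e / 2"
    using rho(2) e by (auto simp: e_def intro: mult_right_mono[of rho "1 / 2", simplified])
  have be: "rho * e * bnd \<le> e / 2 * bnd" using e'(2) bnd_ge_1 by (intro mult_right_mono) auto
  define q d where "q = j div 2 ^ m" and "d = j mod 2 ^ m"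
  have jq: "j = q * 2 ^ m + d" unfolding q_def d_def by (rule div_mult_mod_eq[symmetric])
  have d: "0 \<le> d" "d < 2 ^ m" unfolding d_def by auto
  have "real_of_int d \<le> 2 ^ m" using d(2) by (metis less_imp_le of_int_le_iff of_int_numeral of_int_power)
  then have dr: "real_of_int d * rho \<le> 1" by (simp add: rho_def)
  have "real_of_int j * (rho * e) = q * e * (2 ^ m * rho) + (real_of_int d * rho) * e"
    by (simp add: jq algebra_simps)
  also have "2 ^ m * rho = 1" by (simp add: rho_def)
  finally have jr: "real_of_int j * (rho * e) = q * e + (real_of_int d * rho) * e" by simp
  have dre: "0 \<le> (real_of_int d * rho) * e" "(real_of_int d * rho) * e \<le> 1 * e"
    using d(1) rho e dr by (auto intro!: mult_right_mono)
  have ce: "cc * (rho * e) \<le> cc * (e / 2)" using e'(2) bnd_ge_1 unfolding cc_def by (intro mult_left_mono) auto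
  have "\<bar>pos (Suc n) a + real_of_int j * (rho * e) - z\<bar> \<le> cc * (rho * e)"
    using assms unfolding near_def e'(1) .
  moreover have "\<bar>cod a - pos (Suc n) a\<bar> \<le> rho * e * bnd" using cod_pos[of a "Suc n"] unfolding e'(1) .
  moreover have "\<bar>cod a - pos n a\<bar> \<le> e * bnd" using cod_pos[of a n] unfolding e_def .
  ultimately have "\<bar>pos n a + q * e - z\<bar> \<le> cc * (e / 2) + e / 2 * bnd + e * bnd + e"
    using jr dre ce be by linarith
  also have "\<dots> \<le> cc * e" using e bnd_ge_1 by (simp add: cc_def algebra_simps)
  finally show ?thesis unfolding near_def e_def q_def .
qed

text \<open>Two light steps which both stay near \<open>z\<close> end near each other, so the whole event is
  contained in the one that defines the mass of either.\<close>

lemma light_mass_near: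
  "rho powr \<beta> * (\<Sum>j' | j' \<in> T (m * Suc n) \<and> j' div 2 ^ m = j.
     measure P {b. near z (Suc n) (join (rho ^ n) a b) j' \<and> light n (join (rho ^ n) a b) j'}) \<le> \<zeta>"
proof (cases "\<exists>b j'. j' div 2 ^ m = j \<and> near z (Suc n) (join (rho ^ n) a b) j' \<and> light n (join (rho ^ n) a b) j'")
  case True
  then obtain b0 j0 where 0: "j0 div 2 ^ m = j" "near z (Suc n) (join (rho ^ n) a b0) j0" "light n (join (rho ^ n) a b0) j0"
    by blast
  have jj: "join (rho ^ n) (join (rho ^ n) a b0) b = join (rho ^ n) a b" for b
    by (rule adapted_join_cong[OF rho_power_pos]) (simp add: join_less)
  have "rho powr \<beta> * (\<Sum>j' | j' \<in> T (m * Suc n) \<and> j' div 2 ^ m = j.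
     measure P {b. near z (Suc n) (join (rho ^ n) a b) j' \<and> light n (join (rho ^ n) a b) j'}) \<le>
     mass n (join (rho ^ n) a b0) j0"
    unfolding mass_def 0(1) jj
  proof (intro mult_left_mono sum_mono seq.P.finite_measure_mono)
    fix j'
    show "{b. near z (Suc n) (join (rho ^ n) a b) j' \<and> light n (join (rho ^ n) a b) j'} \<subseteq>
      {b. \<bar>pos (Suc n) (join (rho ^ n) a b) + j' * rho ^ Suc n -
        (pos (Suc n) (join (rho ^ n) a b0) + j0 * rho ^ Suc n)\<bar> \<le> 2 * cc * rho ^ Suc n}"
      using 0(2) unfolding near_def by (auto simp del: power_Suc)
    have mp: "(\<lambda>b. pos (Suc n) (join (rho ^ n) a b)) \<in> borel_measurable P"
      by (rule measurable_compose[OF measurable_join_right])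
        (rule measurable_adapted[OF adapted_pos rho_power_pos], simp)
    have "{b \<in> space P. \<bar>pos (Suc n) (join (rho ^ n) a b) + j' * rho ^ Suc n -
        (pos (Suc n) (join (rho ^ n) a b0) + j0 * rho ^ Suc n)\<bar> \<le> 2 * cc * rho ^ Suc n} \<in> sets P"
      by (intro borel_measurable_le borel_measurable_abs borel_measurable_diff borel_measurable_add mp borel_measurable_const)
    then show "{b. \<bar>pos (Suc n) (join (rho ^ n) a b) + j' * rho ^ Suc n -
        (pos (Suc n) (join (rho ^ n) a b0) + j0 * rho ^ Suc n)\<bar> \<le> 2 * cc * rho ^ Suc n} \<in> sets P"
      by simp
  qed auto
  also have "\<dots> \<le> \<zeta>" using 0(3) by (simp add: light_def)
  finally show ?thesis .
next
  case False
  then have "{b. near z (Suc n) (join (rho ^ n) a b) j' \<and> light n (join (rho ^ n) a b) j'} = {}"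
    if "j' div 2 ^ m = j" for j'
    using that by blast
  then have "measure P {b. near z (Suc n) (join (rho ^ n) a b) j' \<and> light n (join (rho ^ n) a b) j'} = 0"
    if "j' div 2 ^ m = j" for j'
    using that by (simp only: measure_empty)
  then show ?thesis using \<zeta> by simp
qed

text \<open>Summed over cells and integrated, this is an exponential moment of the number of light
  steps, restricted to pairs near \<open>z\<close>. The weight \<open>1 / \<zeta>\<close> of a light
  step is what the bound \<zeta> on the light mass compensates.\<close>

definition G :: "real \<Rightarrow> nat \<Rightarrow> (nat \<Rightarrow> 'i) \<Rightarrow> int \<Rightarrow> ennreal" where
  "G z n a j = (if near z n a j then ennreal ((1 / \<zeta>) ^ cnt n a j) else 0)"

lemma adapted_G: "adapted (rho ^ n) (\<lambda>a. G z n a j)"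
  unfolding G_def
  by (rule adapted_comp2[OF adapted_near adapted_cnt, where F = "\<lambda>x y. if x then ennreal ((1 / \<zeta>) ^ y) else 0"])

lemma measurable_G [measurable]: "(\<lambda>a. G z n a j) \<in> borel_measurable P"
  by (rule measurable_adapted[OF adapted_G rho_power_pos]) simp

text \<open>A near child has a near parent, and its weight changes only at a light step, by the
  factor \<open>1 / \<zeta>\<close>. The summand 1 covers the steps that are not light.\<close>

lemma G_Suc_le:
  "G z (Suc n) (join (rho ^ n) a b) j \<le> G z n a (j div 2 ^ m) *
    (1 + ennreal (1 / \<zeta>) * indicator {b. near z (Suc n) (join (rho ^ n) a b) j \<and> light n (join (rho ^ n) a b) j} b)"
proof (cases "near z (Suc n) (join (rho ^ n) a b) j")
  case True
  let ?c = "join (rho ^ n) a b"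
  have nr: "near z n a (j div 2 ^ m)"
    using near_parent[OF True] by (simp only: adapted_join[OF adapted_near])
  have ct: "cnt (Suc n) ?c j = cnt n a (j div 2 ^ m) + (if light n ?c j then 1 else 0)"
    unfolding cnt_Suc by (simp only: adapted_join[OF adapted_cnt])
  have Z: "0 < 1 / \<zeta>" using \<zeta> by simp
  show ?thesis
  proof (cases "light n ?c j")
    case True
    have "G z (Suc n) ?c j = ennreal ((1 / \<zeta>) ^ cnt n a (j div 2 ^ m)) * ennreal (1 / \<zeta>)"
      using \<open>near z (Suc n) ?c j\<close> True Z unfolding G_def ct by (simp add: ennreal_mult[symmetric])
    also have "\<dots> \<le> ennreal ((1 / \<zeta>) ^ cnt n a (j div 2 ^ m)) * (1 + ennreal (1 / \<zeta>))"
      by (intro mult_left_mono) auto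
    finally show ?thesis using \<open>near z (Suc n) ?c j\<close> True nr by (simp add: G_def)
  qed (use True nr ct in \<open>simp add: G_def\<close>)
qed (simp add: G_def)

text \<open>Below one parent cell, with the factor \<open>rho powr \<beta>\<close>, the children
  contribute at most \<open>bb\<close> by their number and at most 1 by their light steps, whose
  mass is at most \<zeta> and whose weight is \<open>1 / \<zeta>\<close>. This is the origin of
  \<open>bb + 1\<close>.\<close>

lemma integral_G_Suc:
  "ennreal (rho powr \<beta>) * (\<integral>\<^sup>+a. (\<Sum>j\<in>T (m * Suc n). G z (Suc n) a j) \<partial>P) \<le>
   ennreal (bb + 1) * (\<integral>\<^sup>+a. (\<Sum>j\<in>T (m * n). G z n a j) \<partial>P)"
proof -
  define w where "w = rho powr \<beta>"
  have w: "0 < w" using rho by (simp add: w_def)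
  define pm where "pm a j = measure P {b. near z (Suc n) (join (rho ^ n) a b) j \<and> light n (join (rho ^ n) a b) j}" for a j
  have inner: "ennreal w * (\<integral>\<^sup>+b. (\<Sum>j\<in>T (m * Suc n). G z (Suc n) (join (rho ^ n) a b) j) \<partial>P)
      \<le> ennreal (bb + 1) * (\<Sum>j\<in>T (m * n). G z n a j)" for a
  proof -
    have ms: "{b. near z (Suc n) (join (rho ^ n) a b) j \<and> light n (join (rho ^ n) a b) j} \<in> sets P" for j
    proof -
      have "{c. near z (Suc n) c j \<and> light n c j} \<in> sets P"
        by (rule sets_adapted[OF adapted_comp2[OF adapted_near adapted_light, where F = "\<lambda>x y. x \<and> y"] rho_power_pos])
      from measurable_sets[OF measurable_join_right this, of "rho ^ n" a]
      show ?thesis by (simp add: vimage_def)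
    qed
    have mG: "(\<lambda>b. G z (Suc n) (join (rho ^ n) a b) j) \<in> borel_measurable P" for j
      by (rule measurable_compose[OF measurable_join_right measurable_G])
    have "(\<integral>\<^sup>+b. G z (Suc n) (join (rho ^ n) a b) j \<partial>P) \<le> G z n a (j div 2 ^ m) * ennreal (1 + 1 / \<zeta> * pm a j)" for j
    proof -
      have "(\<integral>\<^sup>+b. G z (Suc n) (join (rho ^ n) a b) j \<partial>P) \<le>
        (\<integral>\<^sup>+b. G z n a (j div 2 ^ m) * (1 + ennreal (1 / \<zeta>) *
          indicator {b. near z (Suc n) (join (rho ^ n) a b) j \<and> light n (join (rho ^ n) a b) j} b) \<partial>P)"
        by (rule nn_integral_mono) (rule G_Suc_le)
      also have "\<dots> = G z n a (j div 2 ^ m) * (1 + ennreal (1 / \<zeta>) *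
          emeasure P {b. near z (Suc n) (join (rho ^ n) a b) j \<and> light n (join (rho ^ n) a b) j})"
        using ms seq.P.emeasure_space_1
        by (subst nn_integral_cmult, simp, subst nn_integral_add) (auto simp: nn_integral_cmult)
      also have "\<dots> = G z n a (j div 2 ^ m) * ennreal (1 + 1 / \<zeta> * pm a j)"
        using \<zeta> by (simp add: pm_def seq.P.emeasure_eq_measure ennreal_mult[symmetric] ennreal_plus)
      finally show ?thesis .
    qed
    then have "(\<Sum>j\<in>T (m * Suc n). \<integral>\<^sup>+b. G z (Suc n) (join (rho ^ n) a b) j \<partial>P) \<le>
        (\<Sum>j\<in>T (m * Suc n). G z n a (j div 2 ^ m) * ennreal (1 + 1 / \<zeta> * pm a j))"
      by (intro sum_mono)
    also have "\<dots> = (\<Sum>i\<in>T (m * n). \<Sum>j | j \<in> T (m * Suc n) \<and> j div 2 ^ m = i.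
        G z n a (j div 2 ^ m) * ennreal (1 + 1 / \<zeta> * pm a j))"
      using T_div[of _ "m * n" m] by (intro sum.group[symmetric] finite_T) (auto simp: add.commute)
    also have "\<dots> = (\<Sum>i\<in>T (m * n). G z n a i * ennreal (\<Sum>j | j \<in> T (m * Suc n) \<and> j div 2 ^ m = i. 1 + 1 / \<zeta> * pm a j))"
    proof (intro sum.cong refl)
      fix i
      have "(\<Sum>j | j \<in> T (m * Suc n) \<and> j div 2 ^ m = i. G z n a (j div 2 ^ m) * ennreal (1 + 1 / \<zeta> * pm a j)) =
          (\<Sum>j | j \<in> T (m * Suc n) \<and> j div 2 ^ m = i. G z n a i * ennreal (1 + 1 / \<zeta> * pm a j))"
        by (intro sum.cong) auto
      also have "\<dots> = G z n a i * (\<Sum>j | j \<in> T (m * Suc n) \<and> j div 2 ^ m = i. ennreal (1 + 1 / \<zeta> * pm a j))"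
        by (rule sum_distrib_left[symmetric])
      also have "(\<Sum>j | j \<in> T (m * Suc n) \<and> j div 2 ^ m = i. ennreal (1 + 1 / \<zeta> * pm a j)) =
          ennreal (\<Sum>j | j \<in> T (m * Suc n) \<and> j div 2 ^ m = i. 1 + 1 / \<zeta> * pm a j)"
        using \<zeta> by (intro sum_ennreal) (auto simp: pm_def intro!: add_nonneg_nonneg)
      finally show "(\<Sum>j | j \<in> T (m * Suc n) \<and> j div 2 ^ m = i. G z n a (j div 2 ^ m) * ennreal (1 + 1 / \<zeta> * pm a j)) =
        G z n a i * ennreal (\<Sum>j | j \<in> T (m * Suc n) \<and> j div 2 ^ m = i. 1 + 1 / \<zeta> * pm a j)" .
    qed
    finally have le: "(\<Sum>j\<in>T (m * Suc n). \<integral>\<^sup>+b. G z (Suc n) (join (rho ^ n) a b) j \<partial>P) \<le>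
      (\<Sum>i\<in>T (m * n). G z n a i * ennreal (\<Sum>j | j \<in> T (m * Suc n) \<and> j div 2 ^ m = i. 1 + 1 / \<zeta> * pm a j))" .
    have real_le: "w * (\<Sum>j | j \<in> T (m * Suc n) \<and> j div 2 ^ m = i. 1 + 1 / \<zeta> * pm a j) \<le> bb + 1" for i
    proof -
      let ?S = "{j. j \<in> T (m * Suc n) \<and> j div 2 ^ m = i}"
      have "w * real (card ?S) \<le> w * (bb * (2 ^ m) powr \<beta>)"
        using card_children[of "m * n" m i] w by (intro mult_left_mono) (auto simp: add.commute)
      also have "\<dots> = bb" by (simp add: w_def rho_def powr_divide)
      finally have 1: "w * real (card ?S) \<le> bb" .
      have "w * (\<Sum>j\<in>?S. pm a j) \<le> \<zeta>" unfolding w_def pm_def by (rule light_mass_near)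
      then have 2: "1 / \<zeta> * (w * (\<Sum>j\<in>?S. pm a j)) \<le> 1" using \<zeta> by (simp add: field_simps)
      have "w * (\<Sum>j\<in>?S. 1 + 1 / \<zeta> * pm a j) = w * real (card ?S) + 1 / \<zeta> * (w * (\<Sum>j\<in>?S. pm a j))"
        by (simp only: sum.distrib sum_distrib_left[symmetric]) (simp add: algebra_simps)
      with 1 2 show ?thesis by linarith
    qed
    have "ennreal w * (\<integral>\<^sup>+b. (\<Sum>j\<in>T (m * Suc n). G z (Suc n) (join (rho ^ n) a b) j) \<partial>P) =
        ennreal w * (\<Sum>j\<in>T (m * Suc n). \<integral>\<^sup>+b. G z (Suc n) (join (rho ^ n) a b) j \<partial>P)"
      by (subst nn_integral_sum) (auto intro: mG)
    also have "\<dots> \<le> ennreal w * (\<Sum>i\<in>T (m * n). G z n a i * ennreal (\<Sum>j | j \<in> T (m * Suc n) \<and> j div 2 ^ m = i. 1 + 1 / \<zeta> * pm a j))"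
      using le by (intro mult_left_mono) auto
    also have "\<dots> = (\<Sum>i\<in>T (m * n). G z n a i * ennreal (w * (\<Sum>j | j \<in> T (m * Suc n) \<and> j div 2 ^ m = i. 1 + 1 / \<zeta> * pm a j)))"
    proof -
      have "ennreal w * (g * ennreal x) = g * ennreal (w * x)" if "0 \<le> x" for g x
        using w that by (simp add: ennreal_mult mult.left_commute)
      moreover have "0 \<le> (\<Sum>j | j \<in> T (m * Suc n) \<and> j div 2 ^ m = i. 1 + 1 / \<zeta> * pm a j)" for i
        using \<zeta> by (intro sum_nonneg) (auto simp: pm_def)
      ultimately show ?thesis by (simp only: sum_distrib_left)
    qed
    also have "\<dots> \<le> (\<Sum>i\<in>T (m * n). G z n a i * ennreal (bb + 1))"
      using real_le by (intro sum_mono mult_left_mono ennreal_leI) auto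
    also have "\<dots> = (\<Sum>i\<in>T (m * n). G z n a i) * ennreal (bb + 1)"
      by (rule sum_distrib_right[symmetric])
    also have "\<dots> = ennreal (bb + 1) * (\<Sum>i\<in>T (m * n). G z n a i)"
      by (rule mult.commute)
    finally show ?thesis .
  qed
  have "ennreal w * (\<integral>\<^sup>+a. (\<Sum>j\<in>T (m * Suc n). G z (Suc n) a j) \<partial>P) =
      ennreal w * (\<integral>\<^sup>+a. \<integral>\<^sup>+b. (\<Sum>j\<in>T (m * Suc n). G z (Suc n) (join (rho ^ n) a b) j) \<partial>P \<partial>P)"
    by (subst nn_integral_join[OF rho_power_pos]) auto
  also have "\<dots> = (\<integral>\<^sup>+a. ennreal w * (\<integral>\<^sup>+b. (\<Sum>j\<in>T (m * Suc n). G z (Suc n) (join (rho ^ n) a b) j) \<partial>P) \<partial>P)"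
  proof (rule nn_integral_cmult[symmetric])
    have "(\<lambda>x. \<Sum>j\<in>T (m * Suc n). G z (Suc n) (join (rho ^ n) (fst x) (snd x)) j) \<in> borel_measurable (P \<Otimes>\<^sub>M P)"
      using measurable_compose[OF measurable_join[OF rho_power_pos, of n] measurable_G]
      by (intro borel_measurable_sum) (simp add: split_beta')
    from seq.P.borel_measurable_nn_integral_fst[OF this]
    show "(\<lambda>a. \<integral>\<^sup>+b. (\<Sum>j\<in>T (m * Suc n). G z (Suc n) (join (rho ^ n) a b) j) \<partial>P) \<in> borel_measurable P"
      by simp
  qed
  also have "\<dots> \<le> (\<integral>\<^sup>+a. ennreal (bb + 1) * (\<Sum>j\<in>T (m * n). G z n a j) \<partial>P)"
    by (rule nn_integral_mono) (rule inner)
  also have "\<dots> = ennreal (bb + 1) * (\<integral>\<^sup>+a. (\<Sum>j\<in>T (m * n). G z n a j) \<partial>P)"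
    by (rule nn_integral_cmult) measurable
  finally show ?thesis by (simp add: w_def)
qed

lemma integral_G_le:
  "ennreal ((rho powr \<beta>) ^ n) * (\<integral>\<^sup>+a. (\<Sum>j\<in>T (m * n). G z n a j) \<partial>P) \<le> ennreal (card (T 0) * (bb + 1) ^ n)"
proof (induction n)
  case 0
  have "(\<Sum>j\<in>T 0. G z 0 a j) \<le> (\<Sum>j\<in>T 0. 1)" for a
    by (intro sum_mono) (simp add: G_def cnt_def)
  then have "(\<integral>\<^sup>+a. (\<Sum>j\<in>T 0. G z 0 a j) \<partial>P) \<le> (\<integral>\<^sup>+a. of_nat (card (T 0)) \<partial>P)"
    by (intro nn_integral_mono) simp
  then show ?case using seq.P.emeasure_space_1 by (simp add: ennreal_of_nat_eq_real_of_nat)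
next
  case (Suc n)
  have "ennreal ((rho powr \<beta>) ^ Suc n) * (\<integral>\<^sup>+a. (\<Sum>j\<in>T (m * Suc n). G z (Suc n) a j) \<partial>P) =
      ennreal ((rho powr \<beta>) ^ n) * (ennreal (rho powr \<beta>) * (\<integral>\<^sup>+a. (\<Sum>j\<in>T (m * Suc n). G z (Suc n) a j) \<partial>P))"
    by (simp add: ennreal_mult mult_ac)
  also have "\<dots> \<le> ennreal ((rho powr \<beta>) ^ n) * (ennreal (bb + 1) * (\<integral>\<^sup>+a. (\<Sum>j\<in>T (m * n). G z n a j) \<partial>P))"
    by (intro mult_left_mono integral_G_Suc) simp
  also have "\<dots> = ennreal (bb + 1) * (ennreal ((rho powr \<beta>) ^ n) * (\<integral>\<^sup>+a. (\<Sum>j\<in>T (m * n). G z n a j) \<partial>P))"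
    by (simp add: mult_ac)
  also have "\<dots> \<le> ennreal (bb + 1) * ennreal (card (T 0) * (bb + 1) ^ n)"
    by (intro mult_left_mono Suc.IH) simp
  also have "\<dots> = ennreal (card (T 0) * (bb + 1) ^ Suc n)"
    using bb_ge_1 by (subst ennreal_mult[symmetric]) (auto simp: mult_ac)
  finally show ?case .
qed

text \<open>Markov's inequality for \<open>G\<close>: at least \<open>s\<close> light steps mean a
  weight of at least \<open>(1 / \<zeta>) ^ s\<close>. The \<nu>-mass of a cell supplies the factor
  \<open>(rho powr \<beta>) ^ n\<close> that normalises \<open>integral_G_le\<close>.\<close>

lemma emeasure_near_le:
  "emeasure (P \<Otimes>\<^sub>M \<nu>) {(a, y). y \<in> A \<and> s \<le> cnt n a (idx (m * n) y) \<and> \<bar>cod a + y - z\<bar> \<le> rho ^ n}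
     \<le> ennreal (K * card (T 0) * (bb + 1) ^ n * \<zeta> ^ s)"
proof -
  define C where "C j = {a. near z n a j \<and> s \<le> cnt n a j}" for j
  define Y where "Y j = {y \<in> A. idx (m * n) y = j}" for j
  have C: "C j \<in> sets P" for j
    unfolding C_def by (rule sets_adapted[OF adapted_comp2[OF adapted_near adapted_cnt, where F = "\<lambda>x y. x \<and> s \<le> y"] rho_power_pos])
  have Y: "Y j \<in> sets \<nu>" for j
  proof -
    have "Y j = A \<inter> {y \<in> space borel. \<lfloor>y * 2 ^ (m * n)\<rfloor> = j}" by (auto simp: Y_def idx_def)
    also have "\<dots> \<in> sets borel" using A_sets by measurable
    finally show ?thesis by (simp add: sets_nu)
  qed
  have sub: "{(a, y). y \<in> A \<and> s \<le> cnt n a (idx (m * n) y) \<and> \<bar>cod a + y - z\<bar> \<le> rho ^ n} \<subseteq> (\<Union>j\<in>T (m * n). C j \<times> Y j)"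
  proof (clarify)
    fix a y assume y: "y \<in> A" "s \<le> cnt n a (idx (m * n) y)" "\<bar>cod a + y - z\<bar> \<le> rho ^ n"
    let ?j = "idx (m * n) y"
    have "real_of_int ?j * rho ^ n \<le> y" "y \<le> real_of_int ?j * rho ^ n + rho ^ n"
    proof -
      have y_eq: "y * 2 ^ (m * n) * rho ^ n = y" by (simp add: rho_power)
      show "real_of_int ?j * rho ^ n \<le> y"
        using mult_right_mono[OF idx_le(1)[where l = "m * n" and y = y] less_imp_le[OF rho_power_pos[of n]]]
        unfolding y_eq .
      show "y \<le> real_of_int ?j * rho ^ n + rho ^ n"
        using mult_right_mono[OF less_imp_le[OF idx_le(2)[where l = "m * n" and y = y]] less_imp_le[OF rho_power_pos[of n]]]
        unfolding y_eq by (simp add: distrib_right)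
    qed
    moreover have "\<bar>cod a - pos n a\<bar> \<le> rho ^ n * bnd" by (rule cod_pos)
    ultimately have "\<bar>pos n a + ?j * rho ^ n - z\<bar> \<le> rho ^ n * bnd + rho ^ n + rho ^ n" using y(3) by linarith
    also have "\<dots> = (bnd + 2) * rho ^ n" by (simp add: algebra_simps)
    also have "\<dots> \<le> cc * rho ^ n"
      using bnd_ge_1 rho_power_pos[of n] unfolding cc_def by (intro mult_right_mono) auto
    finally have "near z n a ?j" unfolding near_def .
    then show "(a, y) \<in> (\<Union>j\<in>T (m * n). C j \<times> Y j)" using y by (auto simp: C_def Y_def T_def)
  qed
  have CG: "ennreal (\<zeta> ^ s) * G z n a j \<ge> indicator (C j) a" for a j
  proof (cases "a \<in> C j")
    case True
    then have n: "near z n a j" and c: "s \<le> cnt n a j" by (auto simp: C_def)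
    have "1 = \<zeta> ^ s * (1 / \<zeta>) ^ s" using \<zeta> by (simp add: power_mult_distrib[symmetric])
    also have "\<dots> \<le> \<zeta> ^ s * (1 / \<zeta>) ^ cnt n a j"
      using \<zeta> c by (intro mult_left_mono power_increasing) auto
    finally show ?thesis using True n \<zeta> by (simp add: G_def ennreal_mult[symmetric])
  qed simp
  define X where "X = ennreal (\<zeta> ^ s)"
  define W where "W = ennreal ((rho powr \<beta>) ^ n)"
  define I where "I j = (\<integral>\<^sup>+a. G z n a j \<partial>P)" for j
  have emC: "emeasure P (C j) \<le> X * I j" for j
  proof -
    have "emeasure P (C j) = (\<integral>\<^sup>+a. indicator (C j) a \<partial>P)" using C by simp
    also have "\<dots> \<le> (\<integral>\<^sup>+a. X * G z n a j \<partial>P)" unfolding X_def by (rule nn_integral_mono) (rule CG)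
    also have "\<dots> = X * I j" unfolding I_def by (rule nn_integral_cmult) (rule measurable_G)
    finally show ?thesis .
  qed
  have emY: "emeasure \<nu> (Y j) \<le> ennreal K * W" for j
  proof -
    have "(1 / 2 ^ (m * n)) powr \<beta> = (rho powr \<beta>) ^ n"
      unfolding rho_power[symmetric] using rho by (simp add: powr_realpow[symmetric] powr_powr mult.commute)
    then have "measure \<nu> (Y j) \<le> K * (rho powr \<beta>) ^ n"
      using measure_cell[of "m * n" j] unfolding Y_def by simp
    then have "emeasure \<nu> (Y j) \<le> ennreal (K * (rho powr \<beta>) ^ n)" by (simp add: emeasure_eq_measure ennreal_leI)
    also have "\<dots> = ennreal K * W" unfolding W_def using K_ge_1 by (intro ennreal_mult) auto
    finally show ?thesis .
  qed
  have WI: "W * (\<Sum>j\<in>T (m * n). I j) \<le> ennreal (card (T 0) * (bb + 1) ^ n)"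
  proof -
    have "(\<Sum>j\<in>T (m * n). I j) = (\<integral>\<^sup>+a. (\<Sum>j\<in>T (m * n). G z n a j) \<partial>P)"
      unfolding I_def by (rule nn_integral_sum[symmetric]) (rule measurable_G)
    then show ?thesis unfolding W_def using integral_G_le[of n z] by simp
  qed
  have "emeasure (P \<Otimes>\<^sub>M \<nu>) {(a, y). y \<in> A \<and> s \<le> cnt n a (idx (m * n) y) \<and> \<bar>cod a + y - z\<bar> \<le> rho ^ n}
      \<le> emeasure (P \<Otimes>\<^sub>M \<nu>) (\<Union>j\<in>T (m * n). C j \<times> Y j)"
    using C Y finite_T by (intro emeasure_mono[OF sub] sets.finite_UN pair_measureI) auto
  also have "\<dots> \<le> (\<Sum>j\<in>T (m * n). emeasure (P \<Otimes>\<^sub>M \<nu>) (C j \<times> Y j))"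
    using C Y finite_T by (intro emeasure_subadditive_finite) auto
  also have "\<dots> = (\<Sum>j\<in>T (m * n). emeasure P (C j) * emeasure \<nu> (Y j))"
    using C Y by (intro sum.cong refl emeasure_pair_measure_Times)
  also have "\<dots> \<le> (\<Sum>j\<in>T (m * n). (X * I j) * (ennreal K * W))"
    by (intro sum_mono mult_mono emC emY zero_le)
  also have "\<dots> = (\<Sum>j\<in>T (m * n). (X * ennreal K) * (W * I j))"
    by (rule sum.cong[OF refl]) (rule mult_interchange)
  also have "\<dots> = (X * ennreal K) * (\<Sum>j\<in>T (m * n). W * I j)"
    by (rule sum_distrib_left[symmetric])
  also have "(\<Sum>j\<in>T (m * n). W * I j) = W * (\<Sum>j\<in>T (m * n). I j)"
    by (rule sum_distrib_left[symmetric])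
  also have "(X * ennreal K) * (W * (\<Sum>j\<in>T (m * n). I j)) \<le> (X * ennreal K) * ennreal (card (T 0) * (bb + 1) ^ n)"
    by (rule mult_left_mono[OF WI zero_le])
  also have "X * ennreal K = ennreal (\<zeta> ^ s * K)"
    unfolding X_def using K_ge_1 \<zeta> by (intro ennreal_mult[symmetric]) auto
  also have "ennreal (\<zeta> ^ s * K) * ennreal (card (T 0) * (bb + 1) ^ n) = ennreal (\<zeta> ^ s * K * (card (T 0) * (bb + 1) ^ n))"
    using K_ge_1 \<zeta> bb_ge_1 by (intro ennreal_mult[symmetric]) auto
  also have "\<zeta> ^ s * K * (card (T 0) * (bb + 1) ^ n) = K * card (T 0) * (bb + 1) ^ n * \<zeta> ^ s"
    by simp
  finally show ?thesis .
qed

end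

section \<open>Most steps are light\<close>

text \<open>The number of members of the dyadic shell at \<open>2 ^ i\<close> cancels the power with
  exponent \<open>- \<beta>\<close>, and the remaining power with exponent \<tau> is bounded by its
  value at the top scale. Each of the \<open>m + 1\<close> shells thus obeys the same bound.\<close>

lemma sum_powr_dyadic_le:
  fixes S :: "int set" and g :: "int \<Rightarrow> nat" and C \<beta> \<tau> :: real
  assumes fin: "finite S" and g: "\<And>j. j \<in> S \<Longrightarrow> 1 \<le> g j \<and> g j \<le> 2 ^ m"
    and card: "\<And>i. real (card {j \<in> S. g j \<le> 2 ^ i}) \<le> C * (2 ^ i) powr \<beta>"
    and C: "0 \<le> C" and \<beta>: "0 < \<beta>" and \<tau>: "0 \<le> \<tau>"
  shows "(\<Sum>j\<in>S. real (g j) powr (\<tau> - \<beta>)) \<le> real (Suc m) * (C * 2 powr \<beta>) * (2 ^ m) powr \<tau>"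
proof -
  have "(\<Sum>j\<in>S. real (g j) powr (\<tau> - \<beta>)) \<le> (\<Sum>j\<in>S. (\<Sum>i\<le>m. if 2 ^ i \<le> g j \<and> g j \<le> 2 ^ Suc i then (2 ^ m) powr \<tau> * (2 ^ i) powr (- \<beta>) else 0))"
  proof (rule sum_mono)
    fix j assume j: "j \<in> S"
    obtain i where i: "2 ^ i \<le> g j" "g j < 2 ^ Suc i"
    proof -
      have "\<exists>i. 2 ^ i \<le> g j \<and> g j < 2 ^ (i + 1)"
        using ex_power_ivl1[of 2 "g j"] g[OF j] by simp
      then show ?thesis using that by auto
    qed
    have "(2::nat) ^ i \<le> 2 ^ m" using i(1) g[OF j] by linarith
    then have im: "i \<le> m" by simp
    have "real (g j) powr (\<tau> - \<beta>) = real (g j) powr \<tau> * real (g j) powr (- \<beta>)"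
      by (simp add: powr_add[symmetric])
    also have "\<dots> \<le> (2 ^ m) powr \<tau> * (2 ^ i) powr (- \<beta>)"
    proof (rule mult_mono)
      have "real (2 ^ i) \<le> real (g j)" "real (g j) \<le> real (2 ^ m)"
        using g[OF j] i(1) by (simp_all only: of_nat_le_iff)
      then have gr: "2 ^ i \<le> real (g j)" "real (g j) \<le> 2 ^ m" by simp_all
      show "real (g j) powr \<tau> \<le> (2 ^ m) powr \<tau>" by (rule powr_mono2[OF \<tau> _ gr(2)]) simp
      show "real (g j) powr (- \<beta>) \<le> (2 ^ i) powr (- \<beta>)" by (rule powr_mono2'[OF _ _ gr(1)]) (use \<beta> in simp_all)
    qed simp_all
    also have "\<dots> = (if 2 ^ i \<le> g j \<and> g j \<le> 2 ^ Suc i then (2 ^ m) powr \<tau> * (2 ^ i) powr (- \<beta>) else 0)"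
      using i by simp
    also have "\<dots> \<le> (\<Sum>i\<le>m. if 2 ^ i \<le> g j \<and> g j \<le> 2 ^ Suc i then (2 ^ m) powr \<tau> * (2 ^ i) powr (- \<beta>) else 0)"
      using im by (intro member_le_sum) auto
    finally show "real (g j) powr (\<tau> - \<beta>) \<le> (\<Sum>i\<le>m. if 2 ^ i \<le> g j \<and> g j \<le> 2 ^ Suc i then (2 ^ m) powr \<tau> * (2 ^ i) powr (- \<beta>) else 0)" .
  qed
  also have "\<dots> = (\<Sum>i\<le>m. \<Sum>j\<in>S. if 2 ^ i \<le> g j \<and> g j \<le> 2 ^ Suc i then (2 ^ m) powr \<tau> * (2 ^ i) powr (- \<beta>) else 0)"
    by (rule sum.swap)
  also have "\<dots> \<le> (\<Sum>i\<le>m. C * 2 powr \<beta> * (2 ^ m) powr \<tau>)"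
  proof (rule sum_mono)
    fix i
    have "(\<Sum>j\<in>S. if 2 ^ i \<le> g j \<and> g j \<le> 2 ^ Suc i then (2 ^ m) powr \<tau> * (2 ^ i) powr (- \<beta>) else 0) =
        real (card {j \<in> S. 2 ^ i \<le> g j \<and> g j \<le> 2 ^ Suc i}) * ((2 ^ m) powr \<tau> * (2 ^ i) powr (- \<beta>))"
      using fin by (simp add: sum.If_cases Int_def)
    also have "\<dots> \<le> real (card {j \<in> S. g j \<le> 2 ^ Suc i}) * ((2 ^ m) powr \<tau> * (2 ^ i) powr (- \<beta>))"
      using fin by (intro mult_right_mono of_nat_mono card_mono) auto
    also have "\<dots> \<le> (C * (2 ^ Suc i) powr \<beta>) * ((2 ^ m) powr \<tau> * (2 ^ i) powr (- \<beta>))"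
      by (intro mult_right_mono card) auto
    also have "\<dots> = C * 2 powr \<beta> * (2 ^ m) powr \<tau> * ((2 ^ i) powr \<beta> * (2 ^ i) powr (- \<beta>))"
      by (simp add: powr_mult mult_ac)
    also have "(2 ^ i) powr \<beta> * (2 ^ i) powr (- \<beta>) = (1::real)" by (simp add: powr_minus)
    finally show "(\<Sum>j\<in>S. if 2 ^ i \<le> g j \<and> g j \<le> 2 ^ Suc i then (2 ^ m) powr \<tau> * (2 ^ i) powr (- \<beta>) else 0)
        \<le> C * 2 powr \<beta> * (2 ^ m) powr \<tau>" by simp
  qed
  also have "\<dots> = real (Suc m) * (C * 2 powr \<beta>) * (2 ^ m) powr \<tau>" by simp
  finally show ?thesis .
qed

section \<open>Longer windows and lagged events\<close>

context weighted_ifs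
begin

text \<open>The threshold \<open>T\<close> of the renewal bound belongs to one window length, so a
  longer window is covered by windows of that length. Rounding their number up at most doubles
  it.\<close>

lemma hit_le_length:
  assumes T: "\<And>t. t \<ge> T \<Longrightarrow> measure P (hit \<eta> t) \<le> C * \<eta>" and \<eta>: "0 < \<eta>" "\<eta> \<le> l" and "t \<ge> T" and C: "0 \<le> C"
  shows "measure P (hit l t) \<le> 2 * C * l"
proof -
  define N where "N = nat \<lceil>l / \<eta>\<rceil>"
  have l\<eta>: "1 \<le> l / \<eta>" using \<eta> by simp
  then have N: "l / \<eta> \<le> real N" "real N \<le> 2 * (l / \<eta>)"
    unfolding N_def by (auto simp: of_nat_nat) linarith+
  have "hit l t \<subseteq> (\<Union>j<N. hit \<eta> (t + real j * \<eta>))"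
  proof
    fix a assume "a \<in> hit l t"
    then obtain n where n: "t \<le> - ln (sc a n)" "- ln (sc a n) \<le> t + l" by (auto simp: hit_def)
    define x where "x = - ln (sc a n) - t"
    have x: "0 \<le> x" "x \<le> l" using n by (auto simp: x_def)
    show "a \<in> (\<Union>j<N. hit \<eta> (t + real j * \<eta>))"
    proof (cases "x = l")
      \<comment> \<open>The right end point is separate: if \<open>l\<close> is a multiple of
        \<eta>, the floor of \<open>x / \<eta>\<close> would be \<open>N\<close>, one too
        large.\<close>
      case True
      have "N > 0" using N(1) l\<eta> by (cases N) auto
      have "real (N - 1) * \<eta> \<le> x"
      proof -
        have "real N < l / \<eta> + 1" unfolding N_def using l\<eta> by (simp add: of_nat_nat) linarith
        then have "real (N - 1) \<le> l / \<eta>" using \<open>N > 0\<close> by (simp add: of_nat_diff)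
        then show ?thesis using True \<eta>(1) by (simp add: le_divide_eq)
      qed
      moreover have "x \<le> real (N - 1) * \<eta> + \<eta>"
      proof -
        have "l \<le> real N * \<eta>" using N(1) \<eta>(1) by (simp add: divide_le_eq)
        then show ?thesis using True \<open>N > 0\<close> by (simp add: of_nat_diff algebra_simps)
      qed
      ultimately have "a \<in> hit \<eta> (t + real (N - 1) * \<eta>)"
        unfolding hit_def x_def by (intro CollectI exI[of _ n]) linarith
      then show ?thesis using \<open>N > 0\<close> by (intro UN_I[of "N - 1"]) auto
    next
      case False
      define j where "j = nat \<lfloor>x / \<eta>\<rfloor>"
      have "0 \<le> x / \<eta>" using x \<eta> by simp
      then have j: "real j \<le> x / \<eta>" "x / \<eta> < real j + 1" unfolding j_def by (auto simp: of_nat_nat)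
      then have "real j * \<eta> \<le> x" "x \<le> real j * \<eta> + \<eta>"
        using \<eta>(1) by (simp_all add: field_simps)
      then have "a \<in> hit \<eta> (t + real j * \<eta>)"
        unfolding hit_def x_def by (intro CollectI exI[of _ n]) linarith
      moreover have "x / \<eta> < l / \<eta>" using x False \<eta>(1) by (simp add: divide_strict_right_mono)
      then have "real j < real N" using j(1) N(1) by linarith
      then have "j < N" by simp
      ultimately show ?thesis by blast
    qed
  qed
  then have "measure P (hit l t) \<le> measure P (\<Union>j<N. hit \<eta> (t + real j * \<eta>))"
    by (intro seq.P.finite_measure_mono) auto
  also have "\<dots> \<le> (\<Sum>j<N. measure P (hit \<eta> (t + real j * \<eta>)))"
    by (intro seq.P.finite_measure_subadditive_finite) auto
  also have "\<dots> \<le> (\<Sum>j<N. C * \<eta>)"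
    using \<open>t \<ge> T\<close> \<eta> by (intro sum_mono T) (auto intro: add_increasing2)
  also have "\<dots> = real N * (C * \<eta>)" by simp
  also have "\<dots> \<le> 2 * (l / \<eta>) * (C * \<eta>)" using N(2) C \<eta> by (intro mult_right_mono) auto
  also have "\<dots> = 2 * C * l" using \<eta> by simp
  finally show ?thesis .
qed

text \<open>For \<open>d > 0\<close> the condition puts the contraction of the stopped word between
  two numbers of ratio \<open>(e + 3 * c) / (e - 3 * c)\<close>, and the logarithm of this ratio is
  at most \<open>12 * c / e\<close> because \<open>e\<close> exceeds \<open>6 * c\<close>. For
  \<open>d = 0\<close> the event is empty.\<close>

lemma measure_scale_window_le:
  assumes T: "\<And>t. t \<ge> T \<Longrightarrow> measure P (hit \<eta> t) \<le> C * \<eta>" and \<eta>: "0 < \<eta>" "\<eta> \<le> 12 * c / e" and C: "0 \<le> C"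
    and \<theta>: "0 < \<theta>" "\<theta> \<le> exp (- T)" and s: "0 < s" and d: "0 \<le> d" and c: "0 < c" and e: "6 * c < e" and x: "0 < x"
  shows "measure P {b. \<bar>s * sc b (stop \<theta> b) * d - e * x\<bar> \<le> 3 * c * x} \<le> 2 * C * (12 * c / e)"
proof -
  define l where "l = 12 * c / e"
  have e0: "0 < e" using e c by simp
  have l0: "0 < l" using c e0 by (simp add: l_def)
  show ?thesis
  proof (cases "d = 0")
    case True
    have "{b. \<bar>s * sc b (stop \<theta> b) * d - e * x\<bar> \<le> 3 * c * x} = {}"
    proof -
      have "3 * c * x < e * x" using x e c by (intro mult_strict_right_mono) auto
      then show ?thesis using True x e0 by auto
    qed
    moreover have "0 \<le> 2 * C * (12 * c / e)"
      using C c e0 by (intro mult_nonneg_nonneg divide_nonneg_pos) auto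
    ultimately show ?thesis by (simp only: measure_empty)
  next
    case False
    then have d0: "0 < d" using d by simp
    define x1 x2 where "x1 = (e - 3 * c) * x / (s * d)" and "x2 = (e + 3 * c) * x / (s * d)"
    have x12: "0 < x1" "0 < x2" using e c x s d0 by (auto simp: x1_def x2_def)
    have "ln x2 - ln x1 = ln (x2 / x1)" using x12 by (simp add: ln_div)
    also have "x2 / x1 = (e + 3 * c) / (e - 3 * c)" using s d0 x by (simp add: x1_def x2_def)
    also have "ln ((e + 3 * c) / (e - 3 * c)) \<le> (e + 3 * c) / (e - 3 * c) - 1"
      using e c by (intro ln_le_minus_one divide_pos_pos) auto
    also have "\<dots> = 6 * c / (e - 3 * c)" using e c by (simp add: field_simps)
    also have "\<dots> \<le> 6 * c / (e / 2)" using e c by (intro divide_left_mono mult_pos_pos) auto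
    also have "\<dots> = l" by (simp add: l_def)
    finally have len: "ln x2 - ln x1 \<le> l" .
    \<comment> \<open>At the stopping time the walk is already beyond \<open>T\<close>, so the
      window can be started at \<open>T\<close> when its natural start lies earlier.\<close>
    have sub: "{b. \<bar>s * sc b (stop \<theta> b) * d - e * x\<bar> \<le> 3 * c * x} \<subseteq> hit l (max T (- ln x2))"
    proof
      fix b assume b: "b \<in> {b. \<bar>s * sc b (stop \<theta> b) * d - e * x\<bar> \<le> 3 * c * x}"
      define y where "y = sc b (stop \<theta> b)"
      have y0: "0 < y" using sc_pos by (simp add: y_def)
      have "\<bar>s * y * d - e * x\<bar> \<le> 3 * c * x" using b by (simp add: y_def)
      then have "(e - 3 * c) * x \<le> y * (s * d)" "y * (s * d) \<le> (e + 3 * c) * x" by (auto simp: algebra_simps abs_le_iff)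
      then have "x1 \<le> y" "y \<le> x2" unfolding x1_def x2_def using s d0
        by (simp_all add: divide_le_eq le_divide_eq)
      then have 1: "ln x1 \<le> ln y" "ln y \<le> ln x2" using x12 y0 by (auto intro: ln_mono)
      have "y \<le> exp (- T)" using sc_stop_le[OF \<theta>(1), of b] \<theta>(2) unfolding y_def by linarith
      then have "ln y \<le> ln (exp (- T))" using y0 by (intro ln_mono) auto
      then have "T \<le> - ln y" by simp
      then show "b \<in> hit l (max T (- ln x2))" unfolding hit_def
        using 1 len by (intro CollectI exI[of _ "stop \<theta> b"]) (auto simp: y_def)
    qed
    then have "measure P {b. \<bar>s * sc b (stop \<theta> b) * d - e * x\<bar> \<le> 3 * c * x} \<le> measure P (hit l (max T (- ln x2)))"
      by (intro seq.P.finite_measure_mono) auto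
    also have "\<dots> \<le> 2 * C * l"
      by (rule hit_le_length[OF T \<eta>(1)]) (use \<eta> C in \<open>auto simp: l_def\<close>)
    finally show ?thesis by (simp add: l_def)
  qed
qed

text \<open>Events with a lag: given the letters read up to scale \<open>\<rho> ^ (k - L)\<close>, the \<open>k\<close>-th event has
  probability at most \<open>\<epsilon>\<close>, while it is itself decided at scale \<open>\<rho> ^ (k + 1)\<close>.\<close>

lemma measure_lagged_intersection_le:
  assumes \<rho>: "0 < \<rho>" "\<rho> < 1" and ad: "\<And>k. adapted (\<rho> ^ Suc k) (\<lambda>a. B k a)"
    and le: "\<And>k a. L \<le> k \<Longrightarrow> measure P {b. B k (join (\<rho> ^ (k - L)) a b)} \<le> \<epsilon>" and "0 \<le> \<epsilon>"
    and S: "finite S" "\<And>k. k \<in> S \<Longrightarrow> L \<le> k" "\<And>k k'. k \<in> S \<Longrightarrow> k' \<in> S \<Longrightarrow> k' < k \<Longrightarrow> k' + L < k"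
  shows "measure P {a. \<forall>k\<in>S. B k a} \<le> \<epsilon> ^ card S"
  using S
proof (induction S rule: finite_linorder_max_induct)
  case empty
  show ?case by simp
next
  case (insert k S)
  have \<rho>k: "0 < \<rho> ^ i" for i using \<rho> by simp
  let ?Q = "\<lambda>a. \<forall>k\<in>S. B k a"
  have adQ: "adapted (\<rho> ^ (k - L)) ?Q"
  proof -
    \<comment> \<open>The spacing of \<open>S\<close> makes all earlier events decided at scale
      \<open>\<rho> ^ (k - L)\<close>, where the conditional bound for step \<open>k\<close>
      applies.\<close>
    have "adapted (\<rho> ^ (k - L)) (B k')" if "k' \<in> S" for k'
    proof (rule adapted_mono[OF ad \<rho>k])
      have "k' + L < k" using insert.prems(2)[of k k'] insert.hyps(2) that by auto
      then show "\<rho> ^ (k - L) \<le> \<rho> ^ Suc k'" using \<rho> by (intro power_decreasing) auto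
    qed
    then show ?thesis unfolding adapted_def by blast
  qed
  have mB: "{b. B k (join (\<rho> ^ (k - L)) a b)} \<in> sets P" for a
    using measurable_sets[OF measurable_join_right sets_adapted[OF ad \<rho>k], of "\<rho> ^ (k - L)" a k] by (simp add: vimage_def)
  have mQ: "{a. ?Q a} \<in> sets P" by (rule sets_adapted[OF adQ \<rho>k])
  have m: "{a. \<forall>k\<in>insert k S. B k a} \<in> sets P"
  proof -
    have "{a. \<forall>k\<in>insert k S. B k a} = {a. B k a} \<inter> {a. ?Q a}" by auto
    then show ?thesis using sets_adapted[OF ad \<rho>k, of k] mQ by simp
  qed
  have "emeasure P {a. \<forall>k\<in>insert k S. B k a} =
      (\<integral>\<^sup>+a. emeasure P {b. join (\<rho> ^ (k - L)) a b \<in> {a. \<forall>k\<in>insert k S. B k a}} \<partial>P)"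
    by (rule emeasure_join[OF \<rho>k m])
  also have "\<dots> \<le> (\<integral>\<^sup>+a. ennreal \<epsilon> * indicator {a. ?Q a} a \<partial>P)"
  proof (rule nn_integral_mono)
    fix a
    show "emeasure P {b. join (\<rho> ^ (k - L)) a b \<in> {a. \<forall>k\<in>insert k S. B k a}} \<le> ennreal \<epsilon> * indicator {a. ?Q a} a"
    proof (cases "?Q a")
      case True
      have "emeasure P {b. join (\<rho> ^ (k - L)) a b \<in> {a. \<forall>k\<in>insert k S. B k a}} \<le> emeasure P {b. B k (join (\<rho> ^ (k - L)) a b)}"
        by (intro emeasure_mono mB) auto
      also have "\<dots> \<le> ennreal \<epsilon>"
        using le[of k a] insert.prems(1) by (simp add: seq.P.emeasure_eq_measure ennreal_leI)
      finally show ?thesis using True by simp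
    next
      case False
      have "?Q (join (\<rho> ^ (k - L)) a b) = ?Q a" for b by (rule adapted_join[OF adQ])
      then have "{b. join (\<rho> ^ (k - L)) a b \<in> {a. \<forall>k\<in>insert k S. B k a}} = {}" using False by blast
      then show ?thesis by (simp only: emeasure_empty zero_le)
    qed
  qed
  also have "\<dots> = ennreal \<epsilon> * emeasure P {a. ?Q a}" using mQ by (simp add: nn_integral_cmult_indicator)
  also have "\<dots> \<le> ennreal \<epsilon> * ennreal (\<epsilon> ^ card S)"
    using insert.IH insert.prems by (intro mult_left_mono) (auto simp: seq.P.emeasure_eq_measure ennreal_leI)
  also have "\<dots> = ennreal (\<epsilon> ^ card (insert k S))"
    using insert.hyps \<open>0 \<le> \<epsilon>\<close> by (subst card_insert_disjoint) (auto simp: ennreal_mult)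
  finally show ?case using \<open>0 \<le> \<epsilon>\<close> by (simp add: seq.P.emeasure_eq_measure del: ball_simps)
qed

text \<open>Times are split into residue classes modulo \<open>q = L + 1\<close>, within which the
  bounds multiply. Too many events put at least \<open>\<delta> * n / q\<close> of them into one
  class. A union bound has at most \<open>2 * q * 2 powr (n / q)\<close> index sets, each of
  probability at most \<open>(1 / 4) powr (n / q)\<close> by the condition on \<epsilon>, so the
  product is summable. The first \<open>L\<close> times account for the added constant.\<close>

lemma AE_lagged_frequency_le:
  assumes \<rho>: "0 < \<rho>" "\<rho> < 1" and ad: "\<And>k. adapted (\<rho> ^ Suc k) (\<lambda>a. B k a)"
    and le: "\<And>k a. L \<le> k \<Longrightarrow> measure P {b. B k (join (\<rho> ^ (k - L)) a b)} \<le> \<epsilon>"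
    and \<epsilon>: "0 < \<epsilon>" "\<epsilon> \<le> 1" and \<delta>: "0 < \<delta>" "\<epsilon> powr \<delta> \<le> 1 / 4"
  shows "AE a in P. \<forall>\<^sub>F n in sequentially. real (card {k. k < n \<and> B k a}) \<le> \<delta> * real n + real L"
proof -
  define q where "q = Suc L"
  define R where "R c n = {k. k < n \<and> L \<le> k \<and> k mod q = c}" for c n
  define F where "F n = {S. \<exists>c<q. S \<subseteq> R c n \<and> \<delta> * real n / real q \<le> real (card S)}" for n
  define X where "X n = (\<Union>S\<in>F n. {a. \<forall>k\<in>S. B k a})" for n
  have \<rho>k: "0 < \<rho> ^ i" for i using \<rho> by simp
  have finR: "finite (R c n)" for c n by (simp add: R_def)
  have F_sub: "F n \<subseteq> (\<Union>c<q. Pow (R c n))" for n by (auto simp: F_def)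
  have finF: "finite (F n)" for n by (rule finite_subset[OF F_sub]) (use finR in auto)
  have mS: "{a. \<forall>k\<in>S. B k a} \<in> sets P" if "finite S" for S
  proof -
    have "{a \<in> space P. \<forall>k\<in>S. B k a} \<in> sets P"
      using sets_adapted[OF ad \<rho>k] by (intro sets.sets_Collect_finite_All' sets.sets_Collect_finite_All that) simp
    then show ?thesis by simp
  qed
  have finS: "finite S" if "S \<in> F n" for S n using that finR by (auto simp: F_def intro: finite_subset)
  have mX: "X n \<in> sets P" for n
    unfolding X_def using finF mS finS by (intro sets.finite_UN) auto
  have cardR: "real (card (R c n)) \<le> real n / real q + 1" if "c < q" for c n
  proof -
    have "inj_on (\<lambda>k. k div q) (R c n)"
    proof (rule inj_onI)
      fix x y assume "x \<in> R c n" "y \<in> R c n" "x div q = y div q"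
      then have "x div q * q + x mod q = y div q * q + y mod q" by (simp add: R_def)
      then show "x = y" by (simp only: div_mult_mod_eq)
    qed
    moreover have "(\<lambda>k. k div q) ` R c n \<subseteq> {..n div q}" by (auto simp: R_def intro!: div_le_mono)
    ultimately have "card (R c n) \<le> card {..n div q}" by (intro card_inj_on_le) auto
    then have "real (card (R c n)) \<le> real (n div q) + 1" by simp
    also have "real (n div q) \<le> real n / real q"
    proof -
      have "real (n div q * q) \<le> real n" by (simp only: of_nat_le_iff div_times_less_eq_dividend)
      moreover have "0 < real q" by (simp add: q_def)
      ultimately show ?thesis by (simp only: pos_le_divide_eq of_nat_mult)
    qed
    finally show ?thesis by simp
  qed
  have "measure P (X n) \<le> 2 * real q * (2 powr (- 1 / real q)) ^ n" for n
  proof -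
    have "measure P (X n) \<le> (\<Sum>S\<in>F n. measure P {a. \<forall>k\<in>S. B k a})"
      unfolding X_def using finF mS finS by (intro seq.P.finite_measure_subadditive_finite) auto
    also have "\<dots> \<le> (\<Sum>S\<in>F n. (1 / 4) powr (real n / real q))"
    proof (rule sum_mono)
      fix S assume S: "S \<in> F n"
      then obtain c where c: "S \<subseteq> R c n" "\<delta> * real n / real q \<le> real (card S)" by (auto simp: F_def)
      have "measure P {a. \<forall>k\<in>S. B k a} \<le> \<epsilon> ^ card S"
      proof (rule measure_lagged_intersection_le[OF \<rho> ad le _ finS[OF S]])
        fix k k' assume "k \<in> S" "k' \<in> S" "k' < k"
        then have "k mod q = k' mod q" using c(1) by (auto simp: R_def)
        then have "q dvd k - k'" by (simp add: mod_eq_dvd_iff_nat \<open>k' < k\<close> less_imp_le)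
        then have "q \<le> k - k'" using \<open>k' < k\<close> by (intro dvd_imp_le) auto
        then show "k' + L < k" unfolding q_def by simp
      qed (use c \<epsilon> in \<open>auto simp: R_def\<close>)
      also have "\<dots> = \<epsilon> powr real (card S)" using \<epsilon> by (simp add: powr_realpow)
      also have "\<dots> \<le> \<epsilon> powr (\<delta> * real n / real q)" using c \<epsilon> by (intro powr_mono') auto
      also have "\<dots> = (\<epsilon> powr \<delta>) powr (real n / real q)" by (simp add: powr_powr)
      also have "\<dots> \<le> (1 / 4) powr (real n / real q)" using \<delta> by (intro powr_mono2) auto
      finally show "measure P {a. \<forall>k\<in>S. B k a} \<le> (1 / 4) powr (real n / real q)" .
    qed
    also have "\<dots> = real (card (F n)) * (1 / 4) powr (real n / real q)" by simp
    also have "real (card (F n)) \<le> real q * (2 * 2 powr (real n / real q))"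
    proof -
      have "card (F n) \<le> card (\<Union>c<q. Pow (R c n))"
        by (rule card_mono[OF _ F_sub]) (use finR in auto)
      also have "\<dots> \<le> (\<Sum>c<q. card (Pow (R c n)))" by (rule card_UN_le) simp
      finally have "real (card (F n)) \<le> real (\<Sum>c<q. card (Pow (R c n)))"
        by (simp only: of_nat_le_iff)
      also have "\<dots> = (\<Sum>c<q. real (card (Pow (R c n))))" by (rule of_nat_sum)
      also have "\<dots> \<le> (\<Sum>c<q. 2 * 2 powr (real n / real q))"
      proof (rule sum_mono)
        fix c assume "c \<in> {..<q}"
        have "real (card (Pow (R c n))) = 2 powr real (card (R c n))"
          using finR by (simp add: card_Pow powr_realpow)
        also have "\<dots> \<le> 2 powr (real n / real q + 1)"
          using cardR[of c n] \<open>c \<in> {..<q}\<close> by (intro powr_mono) auto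
        finally show "real (card (Pow (R c n))) \<le> 2 * 2 powr (real n / real q)" by (simp add: powr_add)
      qed
      finally show ?thesis by simp
    qed
    also have "real q * (2 * 2 powr (real n / real q)) * (1 / 4) powr (real n / real q) =
        2 * real q * (2 powr (real n / real q) * (1 / 4) powr (real n / real q))" by simp
    also have "2 powr (real n / real q) * (1 / 4) powr (real n / real q) = (1 / 2) powr (real n / real q)"
      by (subst powr_mult[symmetric]) auto
    also have "(1 / 2) powr (real n / real q) = (2 powr (- 1 / real q)) ^ n"
    proof -
      have "(2 powr (- 1 / real q)) ^ n = 2 powr (- (real n / real q))"
        by (simp add: powr_realpow[symmetric] powr_powr)
      also have "\<dots> = (1 / 2) powr (real n / real q)" by (simp only: powr_minus_divide powr_divide powr_one_eq_one)
      finally show ?thesis by simp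
    qed
    finally show ?thesis by (simp add: mult_right_mono)
  qed
  note X_le = this
  have "2 powr (- 1 / real q) < (2::real) powr 0" by (rule powr_less_mono) (auto simp: q_def)
  then have "norm (2 powr (- 1 / real q)) < (1::real)" by simp
  then have "summable (\<lambda>n. 2 * real q * (2 powr (- 1 / real q)) ^ n)" by (intro summable_mult summable_geometric)
  then have "summable (\<lambda>n. measure P (X n))"
    by (rule summable_comparison_test'[of _ 0]) (use X_le in simp)
  then have "AE a in P. \<forall>\<^sub>F n in sequentially. a \<in> space P - X n"
    by (intro borel_cantelli_AE1 mX) (auto simp: seq.P.emeasure_eq_measure)
  then show ?thesis
  proof eventually_elim
    case (elim a)
    then show ?case
    proof eventually_elim
      case (elim n)
      then have nX: "a \<notin> X n" by simp
      have small: "real (card {k \<in> R c n. B k a}) < \<delta> * real n / real q" if "c < q" for c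
      proof (rule ccontr)
        assume "\<not> ?thesis"
        then have "{k \<in> R c n. B k a} \<in> F n" using that by (auto simp: F_def)
        then have "a \<in> X n" unfolding X_def by (intro UN_I[of "{k \<in> R c n. B k a}"]) auto
        with nX show False by simp
      qed
      have "{k. k < n \<and> B k a} \<subseteq> {..<L} \<union> (\<Union>c<q. {k \<in> R c n. B k a})"
      proof
        fix k assume k: "k \<in> {k. k < n \<and> B k a}"
        show "k \<in> {..<L} \<union> (\<Union>c<q. {k \<in> R c n. B k a})"
        proof (cases "k < L")
          case False
          have "k mod q < q" by (simp add: q_def)
          moreover have "k \<in> {k' \<in> R (k mod q) n. B k' a}" using k False by (simp add: R_def)
          ultimately show ?thesis by blast
        qed simp
      qed
      then have "card {k. k < n \<and> B k a} \<le> card ({..<L} \<union> (\<Union>c<q. {k \<in> R c n. B k a}))"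
        using finR by (intro card_mono) auto
      also have "\<dots> \<le> card {..<L} + card (\<Union>c<q. {k \<in> R c n. B k a})" by (rule card_Un_le)
      also have "\<dots> \<le> L + (\<Sum>c<q. card {k \<in> R c n. B k a})"
        using card_UN_le[of "{..<q}" "\<lambda>c. {k \<in> R c n. B k a}"] by simp
      finally have "real (card {k. k < n \<and> B k a}) \<le> real (L + (\<Sum>c<q. card {k \<in> R c n. B k a}))"
        by (simp only: of_nat_le_iff)
      also have "\<dots> = real L + (\<Sum>c<q. real (card {k \<in> R c n. B k a}))" by (simp only: of_nat_add of_nat_sum)
      also have "(\<Sum>c<q. real (card {k \<in> R c n. B k a})) \<le> (\<Sum>c<q. \<delta> * real n / real q)"
        using small by (intro sum_mono less_imp_le) auto
      also have "\<dots> = \<delta> * real n" by (simp add: q_def)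
      finally show ?case by simp
    qed
  qed
qed

end

section \<open>The averaged window estimate\<close>

context weighted_ifs
begin

lemma adapted_sc_stop: "0 < \<theta> \<Longrightarrow> adapted \<theta> (\<lambda>a. sc a (stop \<theta> a))"
  unfolding adapted_def
proof (intro allI impI)
  fix a b assume "0 < \<theta>" and eq: "\<forall>i<stop \<theta> a. b i = a i"
  then have "stop \<theta> b = stop \<theta> a" by (intro stop_prefix) auto
  then show "sc b (stop \<theta> b) = sc a (stop \<theta> a)" using eq prefix_cong(1)[of "stop \<theta> a" b a] by simp
qed

text \<open>For fixed \<open>b'\<close> and \<open>b''\<close> the condition on \<open>b\<close> confines the contraction of the stopped word
  to a short window, which is where the renewal bound enters.\<close>

lemma integral_window_le:
  fixes C c e x s \<theta> \<eta> T0 :: real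
  assumes D: "D > 0" "\<And>a b. a 0 \<noteq> b 0 \<Longrightarrow> D \<le> \<bar>cod a - cod b\<bar>"
    and \<sigma>: "0 \<le> \<sigma>" and K: "0 \<le> K"
    and T: "\<And>t. t \<ge> T0 \<Longrightarrow> measure P (hit \<eta> t) \<le> C * \<eta>" and \<eta>: "0 < \<eta>" "6 * c < e \<Longrightarrow> \<eta> \<le> 12 * c / e" and C: "0 \<le> C"
    and \<theta>: "0 < \<theta>" "\<theta> \<le> exp (- T0)" and s: "0 < s" and c: "0 < c" and e: "0 \<le> e" and x: "0 < x"
    and low: "0 < low" "\<And>b. low \<le> s * sc b (stop \<theta> b)"
  defines "W b b' b'' \<equiv> \<bar>s * sc b (stop \<theta> b) * \<bar>cod b'' - cod b'\<bar> - e * x\<bar> \<le> 3 * c * x"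
  shows "(\<integral>\<^sup>+b. \<integral>\<^sup>+b'. indicator (good \<sigma> K) b' * emeasure P {b''. W b b' b''} \<partial>P \<partial>P) \<le>
    ennreal (if 6 * c < e then 2 * C * (12 * c / e) * (K * (3 / 2 * e * x / low / D) powr \<sigma>)
      else K * (9 * c * x / low / D) powr \<sigma>)"
proof -
  have S: "(\<lambda>b. s * sc b (stop \<theta> b)) \<in> borel_measurable P"
    by (rule measurable_adapted[OF adapted_comp[OF adapted_sc_stop[OF \<theta>(1)], where F = "\<lambda>x. s * x"] \<theta>(1)]) simp
  have W3: "(\<lambda>z. indicator {b''. W (fst (fst z)) (snd (fst z)) b''} (snd z) :: ennreal) \<in> borel_measurable ((P \<Otimes>\<^sub>M P) \<Otimes>\<^sub>M P)"
  proof -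
    have m1: "(\<lambda>z. s * sc (fst (fst z)) (stop \<theta> (fst (fst z)))) \<in> borel_measurable ((P \<Otimes>\<^sub>M P) \<Otimes>\<^sub>M P)"
      by (rule measurable_compose[OF _ S]) (rule measurable_compose[OF measurable_fst measurable_fst])
    have m2: "(\<lambda>z. cod (snd (fst z))) \<in> borel_measurable ((P \<Otimes>\<^sub>M P) \<Otimes>\<^sub>M P)"
      by (rule measurable_compose[OF _ measurable_cod]) (rule measurable_compose[OF measurable_fst measurable_snd])
    have m3: "(\<lambda>z. cod (snd z)) \<in> borel_measurable ((P \<Otimes>\<^sub>M P) \<Otimes>\<^sub>M P)"
      by (rule measurable_compose[OF measurable_snd measurable_cod])
    have "(\<lambda>z. \<bar>s * sc (fst (fst z)) (stop \<theta> (fst (fst z))) * \<bar>cod (snd z) - cod (snd (fst z))\<bar> - e * x\<bar>)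
        \<in> borel_measurable ((P \<Otimes>\<^sub>M P) \<Otimes>\<^sub>M P)"
      by (intro borel_measurable_abs borel_measurable_diff borel_measurable_times m1 m2 m3 borel_measurable_const)
    then have "{z \<in> space ((P \<Otimes>\<^sub>M P) \<Otimes>\<^sub>M P). W (fst (fst z)) (snd (fst z)) (snd z)} \<in> sets ((P \<Otimes>\<^sub>M P) \<Otimes>\<^sub>M P)"
      unfolding W_def by (rule borel_measurable_le) simp
    then have "(\<lambda>z. indicator {z \<in> space ((P \<Otimes>\<^sub>M P) \<Otimes>\<^sub>M P). W (fst (fst z)) (snd (fst z)) (snd z)} z :: ennreal) \<in> borel_measurable ((P \<Otimes>\<^sub>M P) \<Otimes>\<^sub>M P)"
      by (rule borel_measurable_indicator)
    then show ?thesis by (simp add: space_pair_measure indicator_def cong: measurable_cong)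
  qed
  define H where "H b b' = (\<integral>\<^sup>+b''. indicator {b''. W b b' b''} b'' \<partial>P)" for b b'
  have mono1: "(\<lambda>z. indicator {b''. W b b' b''} z :: ennreal) \<in> borel_measurable P" for b b'
    using measurable_compose[OF measurable_Pair1' W3, of "(b, b')"] by (simp add: space_pair_measure)
  have setW: "{b''. W b b' b''} \<in> sets P" for b b'
  proof -
    have "(\<lambda>z. indicator {b''. W b b' b''} z :: ennreal) -` {1} \<inter> space P \<in> sets P"
      by (rule measurable_sets[OF mono1]) simp
    also have "(\<lambda>z. indicator {b''. W b b' b''} z :: ennreal) -` {1} \<inter> space P = {b''. W b b' b''}"
      by (auto split: split_indicator_asm)
    finally show ?thesis .
  qed
  have setW': "{b. W b b' b''} \<in> sets P" for b' b''
  proof -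
    have "{b \<in> space P. W b b' b''} \<in> sets P"
      unfolding W_def by (intro borel_measurable_le borel_measurable_abs borel_measurable_diff borel_measurable_times S borel_measurable_const)
    then show ?thesis by simp
  qed
  have HE: "emeasure P {b''. W b b' b''} = H b b'" for b b'
    unfolding H_def using setW by simp
  have mH: "(\<lambda>z. H (fst z) (snd z)) \<in> borel_measurable (P \<Otimes>\<^sub>M P)"
    unfolding H_def using seq.P.borel_measurable_nn_integral_fst[OF W3] by simp
  have "(\<integral>\<^sup>+b. \<integral>\<^sup>+b'. indicator (good \<sigma> K) b' * emeasure P {b''. W b b' b''} \<partial>P \<partial>P) =
      (\<integral>\<^sup>+b. \<integral>\<^sup>+b'. indicator (good \<sigma> K) b' * H b b' \<partial>P \<partial>P)" by (simp only: HE)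
  also have "\<dots> = (\<integral>\<^sup>+b'. \<integral>\<^sup>+b. indicator (good \<sigma> K) b' * H b b' \<partial>P \<partial>P)"
  proof (rule PP.Fubini'[symmetric])
    have "(\<lambda>z. indicator (good \<sigma> K) (snd z) :: ennreal) \<in> borel_measurable (P \<Otimes>\<^sub>M P)"
      by (rule measurable_compose[OF measurable_snd]) (rule borel_measurable_indicator[OF good_measurable])
    then have "(\<lambda>z. indicator (good \<sigma> K) (snd z) * H (fst z) (snd z)) \<in> borel_measurable (P \<Otimes>\<^sub>M P)"
      by (rule borel_measurable_times_ennreal[OF _ mH])
    then show "(\<lambda>(b, b'). indicator (good \<sigma> K) b' * H b b') \<in> borel_measurable (P \<Otimes>\<^sub>M P)"
      by (simp add: split_beta')
  qed
  also have "\<dots> \<le> (\<integral>\<^sup>+b'. ennreal (if 6 * c < e then 2 * C * (12 * c / e) * (K * (3 / 2 * e * x / low / D) powr \<sigma>)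
      else K * (9 * c * x / low / D) powr \<sigma>) \<partial>P)"
  proof (rule nn_integral_mono)
    fix b' :: "nat \<Rightarrow> 'i"
    define V where "V = (if 6 * c < e then 2 * C * (12 * c / e) * (K * (3 / 2 * e * x / low / D) powr \<sigma>)
      else K * (9 * c * x / low / D) powr \<sigma>)"
    have "(\<integral>\<^sup>+b. H b b' \<partial>P) \<le> ennreal V" if gd: "b' \<in> good \<sigma> K"
    proof -
      \<comment> \<open>On the window event, \<open>low\<close> times the distance of the two codes
        is at most \<open>e * x + 3 * c * x\<close>; \<open>R\<close> is the resulting bound on the
        distance. The value \<open>6 * c\<close> separates the case of a short window from that
        where only the distance is used.\<close>
      define R where "R = (if 6 * c < e then 3 / 2 * e * x / low else 9 * c * x / low)"
      define Q where "Q = (if 6 * c < e then 2 * C * (12 * c / e) else 1)"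
      have R: "0 < R" using c x low e by (auto simp: R_def)
      have Q: "0 \<le> Q" using C c e by (auto simp: Q_def)
      have bound: "emeasure P {b. W b b' b''} \<le> ennreal Q * indicator {b''. \<bar>cod b' - cod b''\<bar> \<le> R} b''" for b''
      proof (cases "{b. W b b' b''} = {}")
        case False
        then obtain b where b: "W b b' b''" by blast
        let ?d = "\<bar>cod b'' - cod b'\<bar>"
        have "low * ?d \<le> s * sc b (stop \<theta> b) * ?d" using low(2) by (intro mult_right_mono) auto
        also have "\<dots> \<le> e * x + 3 * c * x" using b unfolding W_def by linarith
        also have "\<dots> \<le> R * low"
        proof (cases "6 * c < e")
          case True
          then have "3 * c * x \<le> 1 / 2 * e * x" using x by (intro mult_right_mono) auto
          then have "e * x + 3 * c * x \<le> 3 / 2 * e * x" by simp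
          then show ?thesis using True low(1) by (simp add: R_def)
        next
          case False
          then have "e * x \<le> 6 * c * x" using x by (intro mult_right_mono) auto
          then show ?thesis using False low(1) by (simp add: R_def)
        qed
        finally have "?d \<le> R" using low(1) by (simp add: mult.commute)
        then have ind: "indicator {b''. \<bar>cod b' - cod b''\<bar> \<le> R} b'' = (1::ennreal)" by (simp add: abs_minus_commute)
        have "measure P {b. W b b' b''} \<le> Q"
        proof (cases "6 * c < e")
          case True
          then show ?thesis unfolding Q_def W_def
            using measure_scale_window_le[OF T \<eta>(1) \<eta>(2)[OF True] C \<theta> s abs_ge_zero c True x, of "cod b'' - cod b'"] by simp
        next
          case False
          then show ?thesis unfolding Q_def by simp
        qed
        then show ?thesis unfolding ind mult_1_right seq.P.emeasure_eq_measure by (rule ennreal_leI)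
      next
        case True
        then have "emeasure P {b. W b b' b''} = 0" by (simp only: emeasure_empty)
        then show ?thesis by (rule ord_eq_le_trans) (rule zero_le)
      qed
      have setR: "{b''. \<bar>cod b' - cod b''\<bar> \<le> R} \<in> sets P"
      proof -
        have "{b'' \<in> space P. \<bar>cod b' - cod b''\<bar> \<le> R} \<in> sets P" by measurable
        then show ?thesis by simp
      qed
      have "(\<integral>\<^sup>+b. H b b' \<partial>P) = (\<integral>\<^sup>+b''. \<integral>\<^sup>+b. indicator {b''. W b b' b''} b'' \<partial>P \<partial>P)"
        unfolding H_def
      proof (rule PP.Fubini'[symmetric])
        have m: "(\<lambda>z. ((fst z, b'), snd z)) \<in> measurable (P \<Otimes>\<^sub>M P) ((P \<Otimes>\<^sub>M P) \<Otimes>\<^sub>M P)"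
          by (intro measurable_Pair measurable_fst measurable_snd measurable_const) simp
        from measurable_compose[OF m W3]
        show "(\<lambda>(b, b''). indicator {b''. W b b' b''} b'' :: ennreal) \<in> borel_measurable (P \<Otimes>\<^sub>M P)"
          by (simp add: split_beta')
      qed
      also have "\<dots> = (\<integral>\<^sup>+b''. emeasure P {b. W b b' b''} \<partial>P)"
      proof (rule nn_integral_cong)
        fix b''
        have "(\<integral>\<^sup>+b. indicator {b''. W b b' b''} b'' \<partial>P) = (\<integral>\<^sup>+b. indicator {b. W b b' b''} b \<partial>P)"
          by (rule nn_integral_cong) (simp add: indicator_def)
        also have "\<dots> = emeasure P {b. W b b' b''}" using setW' by simp
        finally show "(\<integral>\<^sup>+b. indicator {b''. W b b' b''} b'' \<partial>P) = emeasure P {b. W b b' b''}" .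
      qed
      also have "\<dots> \<le> (\<integral>\<^sup>+b''. ennreal Q * indicator {b''. \<bar>cod b' - cod b''\<bar> \<le> R} b'' \<partial>P)"
        by (rule nn_integral_mono) (rule bound)
      also have "\<dots> = ennreal Q * ennreal (measure P {b''. \<bar>cod b' - cod b''\<bar> \<le> R})"
        using setR by (simp add: nn_integral_cmult_indicator seq.P.emeasure_eq_measure)
      also have "\<dots> \<le> ennreal Q * ennreal (K * (R / D) powr \<sigma>)"
        by (intro mult_left_mono ennreal_leI good_ball[OF D(2,1) gd \<sigma> R] zero_le)
      also have "\<dots> = ennreal V"
        using Q K by (simp add: ennreal_mult[symmetric] V_def Q_def R_def)
      finally show ?thesis .
    qed
    then show "(\<integral>\<^sup>+b. indicator (good \<sigma> K) b' * H b b' \<partial>P) \<le> ennreal (if 6 * c < e then 2 * C * (12 * c / e) * (K * (3 / 2 * e * x / low / D) powr \<sigma>)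
      else K * (9 * c * x / low / D) powr \<sigma>)"
      unfolding V_def by (cases "b' \<in> good \<sigma> K") simp_all
  qed
  also have "\<dots> = ennreal (if 6 * c < e then 2 * C * (12 * c / e) * (K * (3 / 2 * e * x / low / D) powr \<sigma>)
      else K * (9 * c * x / low / D) powr \<sigma>)"
    using seq.P.emeasure_space_1 by simp
  finally show ?thesis .
qed

end

section \<open>The probability that a step is not light\<close>

context scheme
begin

text \<open>\<open>b\<close> continues the word from scale \<open>rho ^ (k - L)\<close> to
  \<open>rho ^ k\<close>, \<open>b'\<close> is its actual tail, and \<open>b''\<close> is the fresh
  tail inside \<open>mass\<close>. Apart from tails outside \<open>good \<sigma> K2\<close>,
  Markov's inequality bounds the probability by the expected mass over \<zeta>. The lag makes
  \<open>b\<close> long enough for the renewal bound, and \<open>12 * cc * rho\<close> is the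
  shortest window that is needed, since indices of siblings differ by at most
  \<open>1 / rho\<close>. Siblings at distance up to \<open>6 * cc\<close> are bounded in number;
  the others are summed over dyadic shells.\<close>

lemma measure_not_light_le:
  fixes C T0 D K2 \<sigma> :: real
  assumes D: "D > 0" "\<And>a b. a 0 \<noteq> b 0 \<Longrightarrow> D \<le> \<bar>cod a - cod b\<bar>"
    and \<sigma>: "0 \<le> \<sigma>" and K2: "0 \<le> K2"
    and T0: "\<And>t. t \<ge> T0 \<Longrightarrow> measure P (hit (12 * cc * rho) t) \<le> C * (12 * cc * rho)" and C: "0 \<le> C"
    and L: "rho ^ L / rmin \<le> exp (- T0)" "L \<le> k"
    and i0: "6 * cc \<le> 2 ^ i0" and j: "j \<in> T (m * Suc k)"
  defines "\<tau> \<equiv> max (\<sigma> + \<beta> - 1) 0"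
  shows "measure P {b. \<not> light k (join (rho ^ (k - L)) a b) j} \<le> (1 - measure P (good \<sigma> K2)) +
    bb * K2 * ((2 ^ i0) powr \<beta> * (9 * cc / (rmin * D)) powr \<sigma> + 24 * C * cc * (3 / 2 / (rmin * D)) powr \<sigma> * 2 powr \<beta>) *
      real (Suc m) * rho powr (\<beta> + \<sigma> - \<tau>) / \<zeta>"
proof -
  define \<theta>0 where "\<theta>0 = rho ^ (k - L)"
  define n0 where "n0 = stop \<theta>0 a"
  define s0 where "s0 = sc a n0"
  \<comment> \<open>The factor by which \<open>b\<close> still has to contract in order to reach
    scale \<open>rho ^ k\<close>.\<close>
  define \<theta>1 where "\<theta>1 = rho ^ k / s0"
  define r' where "r' = rho ^ Suc k"
  define w where "w = rho powr \<beta>"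
  define Ch where "Ch = {j' \<in> T (m * Suc k). j' div 2 ^ m = j div 2 ^ m}"
  define c where "c b b' = join \<theta>0 a (join \<theta>1 b b')" for b b'
  define W where "W e b b' b'' \<longleftrightarrow> \<bar>s0 * sc b (stop \<theta>1 b) * \<bar>cod b'' - cod b'\<bar> - e * r'\<bar> \<le> 3 * cc * r'" for e b b' b''
  have cc: "0 < cc" "2 * bnd \<le> cc" using bnd_ge_1 by (auto simp: cc_def)
  have \<theta>0: "0 < \<theta>0" "\<theta>0 \<le> 1" by (auto simp: \<theta>0_def rho_power_pos rho_power_le_1)
  have s0: "0 < s0" "rmin * \<theta>0 \<le> s0"
    using sc_pos sc_stop_ge[OF \<theta>0] by (auto simp: s0_def n0_def)
  have \<theta>1: "0 < \<theta>1" using s0 rho_power_pos by (simp add: \<theta>1_def)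
  have r': "0 < r'" "r' = rho * rho ^ k" by (auto simp: r'_def rho_power_pos simp del: power_Suc intro!: rho_power_pos) simp
  have w: "0 < w" using rho by (simp add: w_def)
  have \<theta>1_le: "\<theta>1 \<le> exp (- T0)"
  proof -
    have "\<theta>1 \<le> rho ^ k / (rmin * \<theta>0)"
      unfolding \<theta>1_def using s0 rmin_pos \<theta>0 rho_power_pos less_imp_le[OF rho_power_pos] by (intro divide_left_mono mult_pos_pos) auto
    also have "rho ^ k = rho ^ L * \<theta>0" unfolding \<theta>0_def using L(2) by (simp add: power_add[symmetric])
    also have "rho ^ L * \<theta>0 / (rmin * \<theta>0) = rho ^ L / rmin" using \<theta>0 by simp
    finally show ?thesis using L(1) by simp
  qed
  have kL: "rho ^ k \<le> \<theta>0" unfolding \<theta>0_def by (rule rho_power_mono) simp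
  have stop_c: "stop (rho ^ k) (c b b') = n0 + stop \<theta>1 b" for b b'
    unfolding c_def n0_def stop_join_smaller[OF rho_power_pos kL] \<theta>1_def[unfolded s0_def n0_def, symmetric]
    by (simp only: stop_join[OF \<theta>1])
  have shift_c: "shift (n0 + stop \<theta>1 b) (c b b') = b'" for b b'
    unfolding shift_shift[symmetric] c_def n0_def shift_join ..
  have sc_c: "sc (c b b') (n0 + stop \<theta>1 b) = s0 * sc b (stop \<theta>1 b)" for b b'
  proof -
    have "sc (c b b') n0 = s0" unfolding s0_def c_def n0_def by (rule prefix_cong) (rule join_less)
    moreover have "sc (shift n0 (c b b')) (stop \<theta>1 b) = sc b (stop \<theta>1 b)"
      unfolding c_def n0_def shift_join by (rule prefix_cong) (rule join_less)
    ultimately show ?thesis by (simp add: sc_add)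
  qed
  \<comment> \<open>Each code differs from its position by at most \<open>r' * bnd\<close>, which
    turns the bound \<open>2 * cc\<close> for positions into \<open>3 * cc\<close> for
    codes.\<close>
  have event: "W \<bar>real_of_int (j' - j)\<bar> b b' b''"
    if "\<bar>pos (Suc k) (join (rho ^ k) (c b b') b'') + j' * rho ^ Suc k - (pos (Suc k) (c b b') + j * rho ^ Suc k)\<bar> \<le> 2 * cc * rho ^ Suc k"
    for j' b b' b''
  proof -
    let ?n = "n0 + stop \<theta>1 b" let ?c = "c b b'" let ?c' = "join (rho ^ k) (c b b') b''"
    have "cod ?c' = tr ?c ?n + sg ?c ?n * cod b''"
      unfolding join_def stop_c by (rule cod_comb_seq)
    moreover have "cod ?c = tr ?c ?n + sg ?c ?n * cod b'"
      using cod_split[of ?c ?n] by (simp only: shift_c)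
    ultimately have d: "cod ?c' - cod ?c = sg ?c ?n * (cod b'' - cod b')" by (simp add: right_diff_distrib)
    have aux: "\<bar>(x1 - x2) - - (y1 - y2)\<bar> \<le> t + t'"
      if "\<bar>x1 - p1\<bar> \<le> e" "\<bar>x2 - p2\<bar> \<le> e" "\<bar>p1 + y1 - (p2 + y2)\<bar> \<le> t" "2 * e \<le> t'" for x1 x2 y1 y2 p1 p2 e t t' :: real
      using that by linarith
    have "2 * bnd * r' \<le> cc * r'" using cc r' by (intro mult_right_mono) auto
    moreover have "2 * (r' * bnd) = 2 * bnd * r'" by simp
    ultimately have "2 * (r' * bnd) \<le> cc * r'" by (simp only:)
    from aux[OF cod_pos[of ?c' "Suc k", folded r'_def] cod_pos[of ?c "Suc k", folded r'_def] that[folded r'_def] this]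
    have "\<bar>(cod ?c' - cod ?c) - - (j' * r' - j * r')\<bar> \<le> 2 * cc * r' + cc * r'" .
    moreover have "2 * cc * r' + cc * r' = 3 * cc * r'" by (simp add: algebra_simps)
    ultimately have le: "\<bar>(cod ?c' - cod ?c) - - (j' * r' - j * r')\<bar> \<le> 3 * cc * r'" by (simp only:)
    have e1: "\<bar>cod ?c' - cod ?c\<bar> = s0 * sc b (stop \<theta>1 b) * \<bar>cod b'' - cod b'\<bar>"
      unfolding d abs_mult abs_sg sc_c ..
    have "j' * r' - j * r' = real_of_int (j' - j) * r'" by (simp add: left_diff_distrib)
    then have e2: "\<bar>- (j' * r' - j * r')\<bar> = \<bar>real_of_int (j' - j)\<bar> * r'"
      by (simp only: abs_minus_cancel abs_mult abs_of_pos[OF r'(1)])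
    have "\<bar>\<bar>cod ?c' - cod ?c\<bar> - \<bar>- (j' * r' - j * r')\<bar>\<bar> \<le> 3 * cc * r'"
      by (rule order_trans[OF abs_triangle_ineq3 le])
    then show ?thesis unfolding W_def e1 e2 .
  qed
  have sS: "(\<lambda>b. s0 * sc b (stop \<theta>1 b)) \<in> borel_measurable P"
    by (rule measurable_adapted[OF adapted_comp[OF adapted_sc_stop[OF \<theta>1], where F = "\<lambda>x. s0 * x"] \<theta>1]) simp
  have setW: "{b''. W e b b' b''} \<in> sets P" for e b b'
  proof -
    have "{b'' \<in> space P. W e b b' b''} \<in> sets P" unfolding W_def
      by (intro borel_measurable_le borel_measurable_abs borel_measurable_diff borel_measurable_times
          measurable_cod borel_measurable_const)
    then show ?thesis by simp
  qed
  have mass_le: "mass k (c b b') j \<le> w * (\<Sum>j'\<in>Ch. measure P {b''. W \<bar>real_of_int (j' - j)\<bar> b b' b''})" for b b'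
    unfolding mass_def w_def[symmetric] Ch_def[symmetric]
    using w event by (intro mult_left_mono sum_mono seq.P.finite_measure_mono setW) auto
  define V where "V e = (if 6 * cc < e then 2 * C * (12 * cc / e) * (K2 * (3 / 2 * e * r' / (rmin * rho ^ k) / D) powr \<sigma>)
      else K2 * (9 * cc * r' / (rmin * rho ^ k) / D) powr \<sigma>)" for e
  have Ch_le: "\<bar>real_of_int (j' - j)\<bar> \<le> 1 / rho" if "j' \<in> Ch" for j'
  proof -
    have "j' = 2 ^ m * (j div 2 ^ m) + j' mod 2 ^ m" "j = 2 ^ m * (j div 2 ^ m) + j mod 2 ^ m"
      using that unfolding Ch_def by (metis (mono_tags, lifting) mem_Collect_eq mult_div_mod_eq, simp)
    moreover have "0 \<le> j mod 2 ^ m" "j mod 2 ^ m < 2 ^ m" "0 \<le> j' mod 2 ^ m" "j' mod 2 ^ m < 2 ^ m" by auto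
    ultimately have "\<bar>j' - j\<bar> \<le> 2 ^ m" by linarith
    then have "real_of_int \<bar>j' - j\<bar> \<le> real_of_int (2 ^ m)" by (simp only: of_int_le_iff)
    then show ?thesis by (simp add: rho_def)
  qed
  have VI: "(\<integral>\<^sup>+b. \<integral>\<^sup>+b'. indicator (good \<sigma> K2) b' * emeasure P {b''. W \<bar>real_of_int (j' - j)\<bar> b b' b''} \<partial>P \<partial>P) \<le> ennreal (V \<bar>real_of_int (j' - j)\<bar>)"
    if j': "j' \<in> Ch" for j'
    unfolding W_def V_def
  proof (rule integral_window_le[OF D \<sigma> K2 T0 _ _ C \<theta>1 \<theta>1_le s0(1) cc(1) abs_ge_zero r'(1)])
    show "0 < 12 * cc * rho" using cc rho by simp
    show "12 * cc * rho \<le> 12 * cc / \<bar>real_of_int (j' - j)\<bar>" if "6 * cc < \<bar>real_of_int (j' - j)\<bar>"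
    proof -
      have e0: "0 < \<bar>real_of_int (j' - j)\<bar>" using that cc by linarith
      have "rho * \<bar>real_of_int (j' - j)\<bar> \<le> 1"
        using Ch_le[OF j'] rho(1) by (simp add: le_divide_eq mult.commute)
      then have "12 * cc * (rho * \<bar>real_of_int (j' - j)\<bar>) \<le> 12 * cc * 1" using cc by (intro mult_left_mono) auto
      then show ?thesis using e0 by (subst pos_le_divide_eq) (simp_all add: mult_ac)
    qed
    show "0 < rmin * rho ^ k" using rmin_pos rho_power_pos by simp
    show "rmin * rho ^ k \<le> s0 * sc b (stop \<theta>1 b)" for b
      using sc_stop_ge[OF rho_power_pos rho_power_le_1, of k "c b b"] by (simp add: stop_c sc_c)
  qed
  have finCh: "finite Ch" using finite_T by (simp add: Ch_def)
  have V0: "0 \<le> V e" if "0 \<le> e" for e using C K2 cc that by (auto simp: V_def)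
  let ?N = "{b. \<not> light k (join \<theta>0 a b) j}"
  have mN: "?N \<in> sets P"
    using measurable_sets[OF measurable_join_right sets_adapted[OF adapted_comp[OF adapted_light, where F = Not] rho_power_pos], of \<theta>0 a k j]
    by (simp add: vimage_def)
  \<comment> \<open>Markov's inequality in pointwise form: on good tails a step that is not light
    makes the second term at least 1.\<close>
  have pw: "indicator ?N (join \<theta>1 b b') \<le> indicator (UNIV - good \<sigma> K2) b' +
      ennreal (w / \<zeta>) * (\<Sum>j'\<in>Ch. indicator (good \<sigma> K2) b' * emeasure P {b''. W \<bar>real_of_int (j' - j)\<bar> b b' b''})" for b b'
  proof (cases "b' \<in> good \<sigma> K2 \<and> join \<theta>1 b b' \<in> ?N")
    case True
    then have "\<zeta> < mass k (c b b') j" by (simp add: light_def c_def)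
    then have "\<zeta> \<le> w * (\<Sum>j'\<in>Ch. measure P {b''. W \<bar>real_of_int (j' - j)\<bar> b b' b''})" using mass_le[of b b'] by linarith
    then have "1 \<le> w / \<zeta> * (\<Sum>j'\<in>Ch. measure P {b''. W \<bar>real_of_int (j' - j)\<bar> b b' b''})"
      using \<zeta> by (simp add: field_simps)
    then have "ennreal 1 \<le> ennreal (w / \<zeta> * (\<Sum>j'\<in>Ch. measure P {b''. W \<bar>real_of_int (j' - j)\<bar> b b' b''}))"
      by (rule ennreal_leI)
    also have "\<dots> = ennreal (w / \<zeta>) * (\<Sum>j'\<in>Ch. emeasure P {b''. W \<bar>real_of_int (j' - j)\<bar> b b' b''})"
    proof -
      have "ennreal (w / \<zeta> * (\<Sum>j'\<in>Ch. measure P {b''. W \<bar>real_of_int (j' - j)\<bar> b b' b''})) =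
          ennreal (w / \<zeta>) * ennreal (\<Sum>j'\<in>Ch. measure P {b''. W \<bar>real_of_int (j' - j)\<bar> b b' b''})"
        by (intro ennreal_mult sum_nonneg measure_nonneg) (use w \<zeta> in simp)
      moreover have "ennreal (\<Sum>j'\<in>Ch. measure P {b''. W \<bar>real_of_int (j' - j)\<bar> b b' b''}) =
          (\<Sum>j'\<in>Ch. emeasure P {b''. W \<bar>real_of_int (j' - j)\<bar> b b' b''})"
        by (simp only: seq.P.emeasure_eq_measure sum_ennreal measure_nonneg)
      ultimately show ?thesis by (simp only:)
    qed
    finally show ?thesis using True by simp
  next
    case False
    then show ?thesis by (auto split: split_indicator)
  qed
  have mgood: "UNIV - good \<sigma> K2 \<in> sets P" using sets.compl_sets[OF good_measurable] by simp
  have mH: "(\<lambda>z. emeasure P {b''. W e (fst z) (snd z) b''}) \<in> borel_measurable (P \<Otimes>\<^sub>M P)" for e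
  proof -
    have m1: "(\<lambda>z. s0 * sc (fst (fst z)) (stop \<theta>1 (fst (fst z)))) \<in> borel_measurable ((P \<Otimes>\<^sub>M P) \<Otimes>\<^sub>M P)"
      by (rule measurable_compose[OF _ sS]) (rule measurable_compose[OF measurable_fst measurable_fst])
    have m2: "(\<lambda>z. cod (snd (fst z))) \<in> borel_measurable ((P \<Otimes>\<^sub>M P) \<Otimes>\<^sub>M P)"
      by (rule measurable_compose[OF _ measurable_cod]) (rule measurable_compose[OF measurable_fst measurable_snd])
    have m3: "(\<lambda>z. cod (snd z)) \<in> borel_measurable ((P \<Otimes>\<^sub>M P) \<Otimes>\<^sub>M P)"
      by (rule measurable_compose[OF measurable_snd measurable_cod])
    have "{z \<in> space ((P \<Otimes>\<^sub>M P) \<Otimes>\<^sub>M P). W e (fst (fst z)) (snd (fst z)) (snd z)} \<in> sets ((P \<Otimes>\<^sub>M P) \<Otimes>\<^sub>M P)"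
      unfolding W_def by (intro borel_measurable_le borel_measurable_abs borel_measurable_diff borel_measurable_times m1 m2 m3 borel_measurable_const)
    from seq.P.measurable_emeasure_Pair[OF this] show ?thesis
      by (simp add: space_pair_measure vimage_def split_beta')
  qed
  have mH1: "(\<lambda>b'. emeasure P {b''. W e b b' b''}) \<in> borel_measurable P" for e b
  proof -
    have "Pair b \<in> measurable P (P \<Otimes>\<^sub>M P)" by (rule measurable_Pair1') simp
    from measurable_compose[OF this mH] show ?thesis by simp
  qed
  have mF: "(\<lambda>b'. indicator (good \<sigma> K2) b' * emeasure P {b''. W e b b' b''}) \<in> borel_measurable P" for e b
    by (intro borel_measurable_times_ennreal borel_measurable_indicator good_measurable mH1)
  have mF2: "(\<lambda>b. \<integral>\<^sup>+b'. indicator (good \<sigma> K2) b' * emeasure P {b''. W e b b' b''} \<partial>P) \<in> borel_measurable P" for e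
  proof -
    have "(\<lambda>z. indicator (good \<sigma> K2) (snd z) :: ennreal) \<in> borel_measurable (P \<Otimes>\<^sub>M P)"
      by (rule measurable_compose[OF measurable_snd]) (rule borel_measurable_indicator[OF good_measurable])
    from seq.P.borel_measurable_nn_integral_fst[OF borel_measurable_times_ennreal[OF this mH, of e]]
    show ?thesis by simp
  qed
  have "emeasure P ?N = (\<integral>\<^sup>+b. indicator ?N b \<partial>P)" using mN by simp
  also have "\<dots> = (\<integral>\<^sup>+b. \<integral>\<^sup>+b'. indicator ?N (join \<theta>1 b b') \<partial>P \<partial>P)"
    by (rule nn_integral_join[OF \<theta>1]) (rule borel_measurable_indicator[OF mN])
  also have "\<dots> \<le> (\<integral>\<^sup>+b. \<integral>\<^sup>+b'. indicator (UNIV - good \<sigma> K2) b' +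
      ennreal (w / \<zeta>) * (\<Sum>j'\<in>Ch. indicator (good \<sigma> K2) b' * emeasure P {b''. W \<bar>real_of_int (j' - j)\<bar> b b' b''}) \<partial>P \<partial>P)"
    by (intro nn_integral_mono pw)
  also have "\<dots> = (\<integral>\<^sup>+b. emeasure P (UNIV - good \<sigma> K2) +
      ennreal (w / \<zeta>) * (\<Sum>j'\<in>Ch. \<integral>\<^sup>+b'. indicator (good \<sigma> K2) b' * emeasure P {b''. W \<bar>real_of_int (j' - j)\<bar> b b' b''} \<partial>P) \<partial>P)"
  proof (rule nn_integral_cong)
    fix b
    have "(\<lambda>b'. \<Sum>j'\<in>Ch. indicator (good \<sigma> K2) b' * emeasure P {b''. W \<bar>real_of_int (j' - j)\<bar> b b' b''}) \<in> borel_measurable P"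
      by (intro borel_measurable_sum mF)
    then show "(\<integral>\<^sup>+b'. indicator (UNIV - good \<sigma> K2) b' +
      ennreal (w / \<zeta>) * (\<Sum>j'\<in>Ch. indicator (good \<sigma> K2) b' * emeasure P {b''. W \<bar>real_of_int (j' - j)\<bar> b b' b''}) \<partial>P) =
      emeasure P (UNIV - good \<sigma> K2) +
      ennreal (w / \<zeta>) * (\<Sum>j'\<in>Ch. \<integral>\<^sup>+b'. indicator (good \<sigma> K2) b' * emeasure P {b''. W \<bar>real_of_int (j' - j)\<bar> b b' b''} \<partial>P)"
      using mgood mF
      by (subst nn_integral_add) (auto simp: nn_integral_cmult nn_integral_sum intro!: borel_measurable_times_ennreal)
  qed
  also have "\<dots> = emeasure P (UNIV - good \<sigma> K2) + ennreal (w / \<zeta>) * (\<Sum>j'\<in>Ch. \<integral>\<^sup>+b. \<integral>\<^sup>+b'. indicator (good \<sigma> K2) b' * emeasure P {b''. W \<bar>real_of_int (j' - j)\<bar> b b' b''} \<partial>P \<partial>P)"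
  proof -
    have "(\<lambda>b. \<Sum>j'\<in>Ch. \<integral>\<^sup>+b'. indicator (good \<sigma> K2) b' * emeasure P {b''. W \<bar>real_of_int (j' - j)\<bar> b b' b''} \<partial>P) \<in> borel_measurable P"
      by (intro borel_measurable_sum mF2)
    then show ?thesis using mF2 seq.P.emeasure_space_1
      by (subst nn_integral_add) (auto simp: nn_integral_cmult nn_integral_sum intro!: borel_measurable_times_ennreal)
  qed
  also have "\<dots> \<le> emeasure P (UNIV - good \<sigma> K2) + ennreal (w / \<zeta>) * (\<Sum>j'\<in>Ch. ennreal (V \<bar>real_of_int (j' - j)\<bar>))"
    by (intro add_left_mono mult_left_mono sum_mono VI) auto
  also have "\<dots> = ennreal ((1 - measure P (good \<sigma> K2)) + w / \<zeta> * (\<Sum>j'\<in>Ch. V \<bar>real_of_int (j' - j)\<bar>))"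
  proof -
    have "measure P (UNIV - good \<sigma> K2) = 1 - measure P (good \<sigma> K2)"
      using seq.P.prob_compl[OF good_measurable[of \<sigma> K2]] by simp
    then show ?thesis using w \<zeta> V0
      by (simp add: seq.P.emeasure_eq_measure sum_ennreal ennreal_mult[symmetric] sum_nonneg ennreal_plus[symmetric] del: ennreal_plus)
  qed
  finally have em: "emeasure P ?N \<le> ennreal ((1 - measure P (good \<sigma> K2)) + w / \<zeta> * (\<Sum>j'\<in>Ch. V \<bar>real_of_int (j' - j)\<bar>))" .
  have X0: "0 \<le> (1 - measure P (good \<sigma> K2)) + w / \<zeta> * (\<Sum>j'\<in>Ch. V \<bar>real_of_int (j' - j)\<bar>)"
    by (intro add_nonneg_nonneg mult_nonneg_nonneg sum_nonneg V0 abs_ge_zero) (use w \<zeta> seq.P.prob_le_1 in simp_all)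
  have main: "measure P ?N \<le> (1 - measure P (good \<sigma> K2)) + w / \<zeta> * (\<Sum>j'\<in>Ch. V \<bar>real_of_int (j' - j)\<bar>)"
    using em unfolding seq.P.emeasure_eq_measure by (simp only: ennreal_le_iff[OF X0])
  \<comment> \<open>\<open>A1\<close> belongs to the close siblings and \<open>A2\<close> to the far
    ones; the powers of \<open>rho\<close> and of the distance are kept outside.\<close>
  define A1 where "A1 = K2 * (9 * cc / (rmin * D)) powr \<sigma>"
  define A2 where "A2 = 24 * C * cc * K2 * (3 / 2 / (rmin * D)) powr \<sigma>"
  have A12: "0 \<le> A1" "0 \<le> A2" using K2 C cc by (auto simp: A1_def A2_def)
  have V_small: "V e = A1 * rho powr \<sigma>" if "\<not> 6 * cc < e" for e
  proof -
    have "9 * cc * r' / (rmin * rho ^ k) / D = 9 * cc / (rmin * D) * rho"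
      using rho_power_pos[of k] by (simp add: r'(2) field_simps)
    then have "V e = K2 * (9 * cc / (rmin * D) * rho) powr \<sigma>" using that by (simp add: V_def)
    also have "(9 * cc / (rmin * D) * rho) powr \<sigma> = (9 * cc / (rmin * D)) powr \<sigma> * rho powr \<sigma>"
      by (rule powr_mult)
    finally show ?thesis by (simp add: A1_def)
  qed
  have V_large: "V e \<le> A2 * rho powr \<sigma> * e powr (\<tau> - \<beta>)" if "6 * cc < e" for e
  proof -
    have e1: "1 \<le> e" using that bnd_ge_1 by (simp add: cc_def)
    have "3 / 2 * e * r' / (rmin * rho ^ k) / D = 3 / 2 / (rmin * D) * rho * e"
      using rho_power_pos[of k] by (simp add: r'(2) field_simps)
    then have "V e = 2 * C * (12 * cc / e) * (K2 * (3 / 2 / (rmin * D) * rho * e) powr \<sigma>)" using that by (simp add: V_def)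
    also have "(3 / 2 / (rmin * D) * rho * e) powr \<sigma> = (3 / 2 / (rmin * D)) powr \<sigma> * rho powr \<sigma> * e powr \<sigma>"
      by (simp only: powr_mult)
    also have "2 * C * (12 * cc / e) * (K2 * ((3 / 2 / (rmin * D)) powr \<sigma> * rho powr \<sigma> * e powr \<sigma>)) = A2 * rho powr \<sigma> * (e powr \<sigma> / e)"
      by (simp add: A2_def)
    also have "e powr \<sigma> / e = e powr (\<sigma> - 1)" using e1 by (simp add: powr_diff)
    \<comment> \<open>As a positive part, \<tau> is at least \<open>\<sigma> + \<beta> - 1\<close>,
      and \<open>e\<close> is at least 1.\<close>
    also have "A2 * rho powr \<sigma> * e powr (\<sigma> - 1) \<le> A2 * rho powr \<sigma> * e powr (\<tau> - \<beta>)"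
      using A12 e1 by (intro mult_left_mono powr_mono) (auto simp: \<tau>_def)
    finally show ?thesis .
  qed
  define S1 where "S1 = {j' \<in> Ch. \<not> 6 * cc < \<bar>real_of_int (j' - j)\<bar>}"
  define S2 where "S2 = {j' \<in> Ch. 6 * cc < \<bar>real_of_int (j' - j)\<bar>}"
  have fin12: "finite S1" "finite S2" using finCh by (auto simp: S1_def S2_def)
  have near_card: "real (card {j' \<in> S. \<bar>j' - j\<bar> \<le> 2 ^ i}) \<le> bb * (2 ^ i) powr \<beta>" if "S \<subseteq> Ch" for S i
  proof -
    have "card {j' \<in> S. \<bar>j' - j\<bar> \<le> 2 ^ i} \<le> card {j' \<in> T (m * Suc k). \<bar>j' - j\<bar> \<le> 2 ^ i}"
      using that finite_T by (intro card_mono) (auto simp: Ch_def)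
    then have "real (card {j' \<in> S. \<bar>j' - j\<bar> \<le> 2 ^ i}) \<le> real (card {j' \<in> T (m * Suc k). \<bar>j' - j\<bar> \<le> 2 ^ i})" by simp
    also have "\<dots> \<le> bb * (2 ^ i) powr \<beta>" by (rule card_T_near[OF j])
    finally show ?thesis .
  qed
  have sum1: "(\<Sum>j'\<in>S1. V \<bar>real_of_int (j' - j)\<bar>) \<le> bb * (2 ^ i0) powr \<beta> * (A1 * rho powr \<sigma>)"
  proof -
    have "S1 = {j' \<in> S1. \<bar>j' - j\<bar> \<le> 2 ^ i0}"
    proof -
      have "\<bar>j' - j\<bar> \<le> 2 ^ i0" if "j' \<in> S1" for j'
      proof -
        have "real_of_int \<bar>j' - j\<bar> \<le> real_of_int (2 ^ i0)" using that i0 by (simp add: S1_def)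
        then show ?thesis by (simp only: of_int_le_iff)
      qed
      then show ?thesis by blast
    qed
    then have card1: "real (card S1) \<le> bb * (2 ^ i0) powr \<beta>" using near_card[of S1 i0] by (auto simp: S1_def)
    have "(\<Sum>j'\<in>S1. V \<bar>real_of_int (j' - j)\<bar>) = (\<Sum>j'\<in>S1. A1 * rho powr \<sigma>)"
      by (intro sum.cong refl V_small) (simp add: S1_def)
    also have "\<dots> = real (card S1) * (A1 * rho powr \<sigma>)" by simp
    also have "\<dots> \<le> bb * (2 ^ i0) powr \<beta> * (A1 * rho powr \<sigma>)" using card1 A12 by (intro mult_right_mono) auto
    finally show ?thesis .
  qed
  have sum2: "(\<Sum>j'\<in>S2. V \<bar>real_of_int (j' - j)\<bar>) \<le> A2 * rho powr \<sigma> * (real (Suc m) * (bb * 2 powr \<beta>) * (2 ^ m) powr \<tau>)"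
  proof -
    have eqn: "\<bar>real_of_int (j' - j)\<bar> = real (nat \<bar>j' - j\<bar>)" for j' by simp
    have "(\<Sum>j'\<in>S2. V \<bar>real_of_int (j' - j)\<bar>) \<le> (\<Sum>j'\<in>S2. A2 * rho powr \<sigma> * real (nat \<bar>j' - j\<bar>) powr (\<tau> - \<beta>))"
      unfolding eqn[symmetric] by (intro sum_mono V_large) (simp add: S2_def)
    also have "\<dots> = A2 * rho powr \<sigma> * (\<Sum>j'\<in>S2. real (nat \<bar>j' - j\<bar>) powr (\<tau> - \<beta>))"
      by (rule sum_distrib_left[symmetric])
    also have "\<dots> \<le> A2 * rho powr \<sigma> * (real (Suc m) * (bb * 2 powr \<beta>) * (2 ^ m) powr \<tau>)"
    proof (intro mult_left_mono sum_powr_dyadic_le fin12)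
      fix j' assume j': "j' \<in> S2"
      then have "6 * cc < \<bar>real_of_int (j' - j)\<bar>" "j' \<in> Ch" by (auto simp: S2_def)
      then have "0 < \<bar>real_of_int (j' - j)\<bar>" using cc by linarith
      then have "1 \<le> nat \<bar>j' - j\<bar>" by auto
      moreover have "real (nat \<bar>j' - j\<bar>) \<le> real (2 ^ m)"
        using Ch_le[OF \<open>j' \<in> Ch\<close>] unfolding eqn by (simp add: rho_def)
      then have "nat \<bar>j' - j\<bar> \<le> 2 ^ m" by (simp only: of_nat_le_iff)
      ultimately show "1 \<le> nat \<bar>j' - j\<bar> \<and> nat \<bar>j' - j\<bar> \<le> 2 ^ m" by simp
    next
      fix i
      have "nat \<bar>j' - j\<bar> \<le> 2 ^ i \<longleftrightarrow> \<bar>j' - j\<bar> \<le> 2 ^ i" for j' by (simp add: nat_le_iff)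
      then show "real (card {j' \<in> S2. nat \<bar>j' - j\<bar> \<le> 2 ^ i}) \<le> bb * (2 ^ i) powr \<beta>"
        using near_card[of S2 i] by (simp add: S2_def)
    qed (use bb_ge_1 \<beta>_pos A12 in \<open>auto simp: \<tau>_def\<close>)
    finally show ?thesis .
  qed
  have m\<tau>: "(2 ^ m) powr \<tau> = rho powr (- \<tau>)" by (simp add: rho_def powr_minus powr_divide)
  \<comment> \<open>This allows the close siblings to be bounded with the same factor as the far
    ones.\<close>
  have one: "1 \<le> real (Suc m) * rho powr (- \<tau>)"
  proof -
    have "rho powr 0 \<le> rho powr (- \<tau>)" using rho by (intro powr_mono') (auto simp: \<tau>_def)
    then have "1 \<le> rho powr (- \<tau>)" using rho by simp
    then have "1 * 1 \<le> real (Suc m) * rho powr (- \<tau>)" by (intro mult_mono) auto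
    then show ?thesis by simp
  qed
  have "(\<Sum>j'\<in>Ch. V \<bar>real_of_int (j' - j)\<bar>) = (\<Sum>j'\<in>S1. V \<bar>real_of_int (j' - j)\<bar>) + (\<Sum>j'\<in>S2. V \<bar>real_of_int (j' - j)\<bar>)"
    using fin12 by (subst sum.union_disjoint[symmetric]) (auto simp: S1_def S2_def intro!: sum.cong)
  also have "\<dots> \<le> bb * (2 ^ i0) powr \<beta> * (A1 * rho powr \<sigma>) * (real (Suc m) * rho powr (- \<tau>)) +
      A2 * rho powr \<sigma> * (real (Suc m) * (bb * 2 powr \<beta>) * rho powr (- \<tau>))"
  proof (intro add_mono)
    have "bb * (2 ^ i0) powr \<beta> * (A1 * rho powr \<sigma>) * 1 \<le> bb * (2 ^ i0) powr \<beta> * (A1 * rho powr \<sigma>) * (real (Suc m) * rho powr (- \<tau>))"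
      using one A12 bb_ge_1 by (intro mult_left_mono) auto
    then show "(\<Sum>j'\<in>S1. V \<bar>real_of_int (j' - j)\<bar>) \<le> bb * (2 ^ i0) powr \<beta> * (A1 * rho powr \<sigma>) * (real (Suc m) * rho powr (- \<tau>))"
      using sum1 by simp
  qed (use sum2 in \<open>simp add: m\<tau>\<close>)
  finally have "w / \<zeta> * (\<Sum>j'\<in>Ch. V \<bar>real_of_int (j' - j)\<bar>) \<le> w / \<zeta> * (bb * (2 ^ i0) powr \<beta> * (A1 * rho powr \<sigma>) * (real (Suc m) * rho powr (- \<tau>)) +
      A2 * rho powr \<sigma> * (real (Suc m) * (bb * 2 powr \<beta>) * rho powr (- \<tau>)))"
    using w \<zeta> by (intro mult_left_mono) auto
  also have "\<dots> = bb * K2 * ((2 ^ i0) powr \<beta> * (9 * cc / (rmin * D)) powr \<sigma> + 24 * C * cc * (3 / 2 / (rmin * D)) powr \<sigma> * 2 powr \<beta>) *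
      real (Suc m) * (rho powr \<beta> * rho powr \<sigma> * rho powr (- \<tau>)) / \<zeta>"
    by (simp add: A1_def A2_def w_def algebra_simps add_divide_distrib)
  also have "rho powr \<beta> * rho powr \<sigma> * rho powr (- \<tau>) = rho powr (\<beta> + \<sigma> - \<tau>)"
    by (simp add: powr_add[symmetric])
  finally show ?thesis using main unfolding \<theta>0_def by linarith
qed

end

section \<open>The convolution\<close>

lemma AE_fst_prod:
  assumes "prob_space N" "AE x in M. Q x"
  shows "AE z in M \<Otimes>\<^sub>M N. Q (fst z)"
proof -
  interpret prob_space N by fact
  have "AE x in distr (M \<Otimes>\<^sub>M N) M fst. Q x" using assms(2) by (simp only: distr_pair_fst)
  then show ?thesis by (rule AE_distrD[OF measurable_fst])
qed

lemma AE_snd_prod: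
  assumes "prob_space M" "prob_space N" "AE y in N. Q y"
  shows "AE z in M \<Otimes>\<^sub>M N. Q (snd z)"
proof -
  interpret M: prob_space M by fact
  interpret N: prob_space N by fact
  interpret pair_prob_space M N ..
  interpret Q: pair_prob_space N M ..
  have "AE z in N \<Otimes>\<^sub>M M. Q (fst z)" by (rule AE_fst_prod) fact+
  then have "AE z in distr (M \<Otimes>\<^sub>M N) (N \<Otimes>\<^sub>M M) (\<lambda>(x, y). (y, x)). Q (fst z)"
    by (simp only: Q.distr_pair_swap[symmetric])
  from AE_distrD[OF measurable_pair_swap' this] show ?thesis by (simp add: split_beta')
qed

lemma local_dim_le_add:
  fixes \<mu> \<nu> \<theta> :: "real measure"
  assumes le: "\<And>R. measure \<mu> (cball x R) * measure \<nu> (cball y R) \<le> measure \<theta> (cball (x + y) (2 * R))"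
    and 1: "local_dim_le \<mu> \<alpha> x" and 2: "local_dim_le \<nu> \<beta> y"
  shows "local_dim_le \<theta> (\<alpha> + \<beta>) (x + y)"
  unfolding local_dim_le_def
proof
  fix j :: nat
  \<comment> \<open>Half of the permitted loss \<open>1 / Suc j\<close> goes to each of the two
    factors.\<close>
  define i where "i = 2 * j + 1"
  have i: "1 / Suc i + 1 / Suc i = 1 / Suc j" by (simp add: i_def field_simps)
  obtain k1 :: nat where k1: "\<And>n. (1 / 2 ^ n) powr (\<alpha> + 1 / Suc i) \<le> k1 * measure \<mu> (cball x (1 / 2 ^ n))"
    using 1 unfolding local_dim_le_def by blast
  obtain k2 :: nat where k2: "\<And>n. (1 / 2 ^ n) powr (\<beta> + 1 / Suc i) \<le> k2 * measure \<nu> (cball y (1 / 2 ^ n))"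
    using 2 unfolding local_dim_le_def by blast
  define s where "s = \<alpha> + \<beta> + 1 / Suc j"
  obtain k :: nat where k: "2 powr s * (k1 * k2) \<le> real k" using real_arch_simple by blast
  have "(1 / 2 ^ n) powr s \<le> k * measure \<theta> (cball (x + y) (1 / 2 ^ n))" for n :: nat
  proof -
    \<comment> \<open>The radius is halved beforehand, because the sum of two balls has twice their
      radius.\<close>
    let ?t = "1 / 2 ^ Suc n :: real"
    have "(1 / 2 ^ n) powr s = (2 * ?t) powr s" by simp
    also have "\<dots> = 2 powr s * ?t powr s" by (rule powr_mult)
    also have "?t powr s = ?t powr (\<alpha> + 1 / Suc i) * ?t powr (\<beta> + 1 / Suc i)"
      unfolding powr_add[symmetric] s_def i[symmetric] by (simp add: algebra_simps)
    also have "\<dots> \<le> (k1 * measure \<mu> (cball x ?t)) * (k2 * measure \<nu> (cball y ?t))"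
      by (intro mult_mono k1 k2) auto
    also have "\<dots> = k1 * k2 * (measure \<mu> (cball x ?t) * measure \<nu> (cball y ?t))" by simp
    also have "\<dots> \<le> k1 * k2 * measure \<theta> (cball (x + y) (2 * ?t))" by (intro mult_left_mono le) simp
    finally have "(1 / 2 ^ n) powr s \<le> 2 powr s * (k1 * k2 * measure \<theta> (cball (x + y) (2 * ?t)))" by simp
    also have "\<dots> = 2 powr s * (k1 * k2) * measure \<theta> (cball (x + y) (1 / 2 ^ n))" by simp
    also have "\<dots> \<le> k * measure \<theta> (cball (x + y) (1 / 2 ^ n))" using k by (intro mult_right_mono) auto
    finally show ?thesis .
  qed
  then show "\<exists>k::nat. \<forall>n. (1 / 2 ^ n) powr (\<alpha> + \<beta> + 1 / Suc j) \<le> k * measure \<theta> (cball (x + y) (1 / 2 ^ n))"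
    unfolding s_def by blast
qed

text \<open>Every dyadic radius is within a factor \<open>2 ^ m\<close> of a larger power of
  \<open>1 / 2 ^ m\<close>, and this factor goes into the constant.\<close>

lemma dyadic_bound_from_coarse_scales:
  fixes \<theta> :: "real measure"
  assumes "finite_measure \<theta>" and S: "sets \<theta> = sets borel" and m: "0 < m" and g: "0 \<le> g" "\<gamma> \<le> g"
    and ev: "\<forall>\<^sub>F n in sequentially. measure \<theta> (cball x ((1 / 2 ^ m) ^ n)) \<le> ((1 / 2 ^ m) ^ n) powr g"
  shows "\<exists>k::nat. \<forall>l::nat. measure \<theta> (cball x (1 / 2 ^ l)) \<le> k * (1 / 2 ^ l) powr \<gamma>"
proof (rule eventually_le_imp_bounded_ratio)
  interpret finite_measure \<theta> by fact
  obtain N where N: "\<And>n. n \<ge> N \<Longrightarrow> measure \<theta> (cball x ((1 / 2 ^ m) ^ n)) \<le> ((1 / 2 ^ m) ^ n) powr g"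
    using ev unfolding eventually_sequentially by blast
  have "measure \<theta> (cball x (1 / 2 ^ l)) \<le> (2 ^ m) powr g * (1 / 2 ^ l) powr \<gamma>" if l: "l \<ge> m * N" for l
  proof -
    define n where "n = l div m"
    have "N \<le> n" using l m unfolding n_def by (simp add: less_eq_div_iff_mult_less_eq mult.commute)
    have n1: "m * n \<le> l" unfolding n_def by simp
    have n2: "l \<le> m + m * n" unfolding n_def using m mod_less_divisor[OF m, of l] mult_div_mod_eq[of m l] by linarith
    have r: "((1 / 2 ^ m) ^ n :: real) = 1 / 2 ^ (m * n)" by (simp add: power_divide power_mult)
    have "(1 / 2 ^ l :: real) \<le> 1 / 2 ^ (m * n)" using n1 by (intro divide_left_mono power_increasing) auto
    then have "measure \<theta> (cball x (1 / 2 ^ l)) \<le> measure \<theta> (cball x ((1 / 2 ^ m) ^ n))"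
      unfolding r by (intro finite_measure_mono subset_cball) (auto simp: S)
    also have "\<dots> \<le> ((1 / 2 ^ m) ^ n) powr g" by (rule N[OF \<open>N \<le> n\<close>])
    also have "\<dots> \<le> (2 ^ m * (1 / 2 ^ l)) powr g"
    proof (rule powr_mono2[OF g(1)])
      have "(2::real) ^ l \<le> 2 ^ (m + m * n)" using n2 by (intro power_increasing) auto
      then show "(1 / 2 ^ m) ^ n \<le> (2 ^ m * (1 / 2 ^ l) :: real)" unfolding r by (simp add: field_simps power_add)
    qed simp
    also have "\<dots> = (2 ^ m) powr g * (1 / 2 ^ l) powr g" by (rule powr_mult)
    also have "\<dots> \<le> (2 ^ m) powr g * (1 / 2 ^ l) powr \<gamma>" using g by (intro mult_left_mono powr_mono') auto
    finally show ?thesis .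
  qed
  then show "\<forall>\<^sub>F l in sequentially. measure \<theta> (cball x (1 / 2 ^ l)) \<le> (2 ^ m) powr g * (1 / 2 ^ l) powr \<gamma>"
    unfolding eventually_sequentially by blast
qed simp

context scheme
begin

text \<open>The set of pairs with many light steps projects to a measure with small balls, so no probability
  measure can give large mass to the balls around most of its points.\<close>

lemma emeasure_heavy_balls_le:
  fixes \<theta> :: "real measure"
  assumes "prob_space \<theta>" and S: "sets \<theta> = sets borel" and lev: "0 < lev"
  shows "emeasure (P \<Otimes>\<^sub>M \<nu>) {(a, y). y \<in> A \<and> s \<le> cnt n a (idx (m * n) y) \<and> lev \<le> measure \<theta> (cball (cod a + y) (rho ^ n))}
    \<le> ennreal (K * card (T 0) * (bb + 1) ^ n * \<zeta> ^ s / lev)"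
    and "{(a, y). y \<in> A \<and> s \<le> cnt n a (idx (m * n) y)} \<in> sets (P \<Otimes>\<^sub>M \<nu>)"
    and "{(a, y). y \<in> A \<and> s \<le> cnt n a (idx (m * n) y) \<and> lev \<le> measure \<theta> (cball (cod a + y) (rho ^ n))} \<in> sets (P \<Otimes>\<^sub>M \<nu>)"
proof -
  interpret th: prob_space \<theta> by fact
  interpret nn: prob_space \<nu> by unfold_locales
  interpret Pn: pair_prob_space P \<nu> ..
  interpret PT: pair_prob_space "P \<Otimes>\<^sub>M \<nu>" \<theta> ..
  define F where "F = {(a, y). y \<in> A \<and> s \<le> cnt n a (idx (m * n) y)}"
  define g where "g z = cod (fst z) + snd z" for z :: "(nat \<Rightarrow> 'i) \<times> real"
  define q where "q = K * card (T 0) * (bb + 1) ^ n * \<zeta> ^ s"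
  have sp: "space (P \<Otimes>\<^sub>M \<nu>) = UNIV" "space \<theta> = UNIV" "space \<nu> = UNIV"
    using sets_eq_imp_space_eq[OF sets_nu] sets_eq_imp_space_eq[OF S] by (auto simp: space_pair_measure)
  have mF: "F \<in> sets (P \<Otimes>\<^sub>M \<nu>)"
  proof -
    have "F = (\<Union>j\<in>T (m * n). {a. s \<le> cnt n a j} \<times> {y \<in> A. idx (m * n) y = j})"
      by (auto simp: F_def T_def)
    moreover have "{a. s \<le> cnt n a j} \<in> sets P" for j
      by (rule sets_adapted[OF adapted_comp[OF adapted_cnt, where F = "\<lambda>x. s \<le> x"] rho_power_pos])
    moreover have "{y \<in> A. idx (m * n) y = j} \<in> sets \<nu>" for j
    proof -
      have "{y \<in> A. idx (m * n) y = j} = A \<inter> {y \<in> space borel. \<lfloor>y * 2 ^ (m * n)\<rfloor> = j}" by (auto simp: idx_def)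
      also have "\<dots> \<in> sets borel" using A_sets by measurable
      finally show ?thesis by (simp add: sets_nu)
    qed
    ultimately show ?thesis using finite_T by (auto intro!: sets.finite_UN pair_measureI)
  qed
  then show "{(a, y). y \<in> A \<and> s \<le> cnt n a (idx (m * n) y)} \<in> sets (P \<Otimes>\<^sub>M \<nu>)" unfolding F_def .
  have m_snd: "snd \<in> borel_measurable (P \<Otimes>\<^sub>M \<nu>)"
    using measurable_snd[of P \<nu>] by (simp add: measurable_cong_sets[OF refl sets_nu])
  have mg: "g \<in> borel_measurable (P \<Otimes>\<^sub>M \<nu>)"
    unfolding g_def[abs_def] by (intro borel_measurable_add measurable_compose[OF measurable_fst measurable_cod] m_snd)
  have mball: "(\<lambda>z. measure \<theta> (cball (g z) (rho ^ n))) \<in> borel_measurable (P \<Otimes>\<^sub>M \<nu>)"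
    by (rule measurable_compose[OF mg measurable_measure_cball[OF _ S]]) unfold_locales
  define H where "H = {z \<in> F. lev \<le> measure \<theta> (cball (g z) (rho ^ n))}"
  have H_eq: "{(a, y). y \<in> A \<and> s \<le> cnt n a (idx (m * n) y) \<and> lev \<le> measure \<theta> (cball (cod a + y) (rho ^ n))} = H"
    by (auto simp: H_def F_def g_def)
  have mH: "H \<in> sets (P \<Otimes>\<^sub>M \<nu>)"
  proof -
    have "{z \<in> space (P \<Otimes>\<^sub>M \<nu>). lev \<le> measure \<theta> (cball (g z) (rho ^ n))} \<in> sets (P \<Otimes>\<^sub>M \<nu>)"
      by (intro borel_measurable_le borel_measurable_const mball)
    from sets.Int[OF mF this] show ?thesis by (simp add: H_def sp Int_def)
  qed
  then show "{(a, y). y \<in> A \<and> s \<le> cnt n a (idx (m * n) y) \<and> lev \<le> measure \<theta> (cball (cod a + y) (rho ^ n))} \<in> sets (P \<Otimes>\<^sub>M \<nu>)"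
    unfolding H_eq .
  have "ennreal lev * emeasure (P \<Otimes>\<^sub>M \<nu>) H = (\<integral>\<^sup>+z. ennreal lev * indicator H z \<partial>(P \<Otimes>\<^sub>M \<nu>))"
    using mH by (simp add: nn_integral_cmult_indicator)
  \<comment> \<open>The mass of the ball is written as an integral over its points \<open>w\<close>.
    After the integrals are exchanged, \<open>w\<close> is the fixed point of the line to which
    \<open>emeasure_near_le\<close> applies.\<close>
  also have "\<dots> \<le> (\<integral>\<^sup>+z. \<integral>\<^sup>+w. indicator F z * indicator (cball (g z) (rho ^ n)) w \<partial>\<theta> \<partial>(P \<Otimes>\<^sub>M \<nu>))"
  proof (rule nn_integral_mono)
    fix z
    have "(\<integral>\<^sup>+w. indicator F z * indicator (cball (g z) (rho ^ n)) w \<partial>\<theta>) = indicator F z * emeasure \<theta> (cball (g z) (rho ^ n))"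
      by (rule nn_integral_cmult_indicator) (simp add: S)
    then show "ennreal lev * indicator H z \<le> (\<integral>\<^sup>+w. indicator F z * indicator (cball (g z) (rho ^ n)) w \<partial>\<theta>)"
      by (auto simp: H_def th.emeasure_eq_measure ennreal_leI split: split_indicator)
  qed
  also have "\<dots> = (\<integral>\<^sup>+w. \<integral>\<^sup>+z. indicator F z * indicator (cball (g z) (rho ^ n)) w \<partial>(P \<Otimes>\<^sub>M \<nu>) \<partial>\<theta>)"
  proof (rule PT.Fubini'[symmetric])
    have m1: "(\<lambda>x. indicator F (fst x) :: ennreal) \<in> borel_measurable ((P \<Otimes>\<^sub>M \<nu>) \<Otimes>\<^sub>M \<theta>)"
      by (rule measurable_compose[OF measurable_fst borel_measurable_indicator[OF mF]])
    have m2: "(\<lambda>x. g (fst x)) \<in> borel_measurable ((P \<Otimes>\<^sub>M \<nu>) \<Otimes>\<^sub>M \<theta>)"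
      by (rule measurable_compose[OF measurable_fst mg])
    have m3: "snd \<in> borel_measurable ((P \<Otimes>\<^sub>M \<nu>) \<Otimes>\<^sub>M \<theta>)"
      using measurable_snd[of "P \<Otimes>\<^sub>M \<nu>" \<theta>] by (simp add: measurable_cong_sets[OF refl S])
    have "{x \<in> space ((P \<Otimes>\<^sub>M \<nu>) \<Otimes>\<^sub>M \<theta>). \<bar>g (fst x) - snd x\<bar> \<le> rho ^ n} \<in> sets ((P \<Otimes>\<^sub>M \<nu>) \<Otimes>\<^sub>M \<theta>)"
      by (intro borel_measurable_le borel_measurable_abs borel_measurable_diff m2 m3 borel_measurable_const)
    from borel_measurable_times_ennreal[OF m1 borel_measurable_indicator[OF this]]
    show "(\<lambda>(z, w). indicator F z * indicator (cball (g z) (rho ^ n)) w :: ennreal) \<in> borel_measurable ((P \<Otimes>\<^sub>M \<nu>) \<Otimes>\<^sub>M \<theta>)"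
      by (rule measurable_cong[THEN iffD1, rotated])
        (auto simp: space_pair_measure sp dist_real_def split: split_indicator)
  qed
  also have "\<dots> \<le> (\<integral>\<^sup>+w. ennreal q \<partial>\<theta>)"
  proof (rule nn_integral_mono)
    fix w
    have eq: "{(a, y). y \<in> A \<and> s \<le> cnt n a (idx (m * n) y) \<and> \<bar>cod a + y - w\<bar> \<le> rho ^ n} =
        {z \<in> F. w \<in> cball (g z) (rho ^ n)}"
      by (auto simp: F_def g_def dist_real_def)
    have mE: "{z \<in> F. w \<in> cball (g z) (rho ^ n)} \<in> sets (P \<Otimes>\<^sub>M \<nu>)"
    proof -
      have "{z \<in> space (P \<Otimes>\<^sub>M \<nu>). \<bar>g z - w\<bar> \<le> rho ^ n} \<in> sets (P \<Otimes>\<^sub>M \<nu>)"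
        by (intro borel_measurable_le borel_measurable_abs borel_measurable_diff mg borel_measurable_const)
      from sets.Int[OF mF this] show ?thesis by (simp add: sp Int_def dist_real_def)
    qed
    have "(\<integral>\<^sup>+z. indicator F z * indicator (cball (g z) (rho ^ n)) w \<partial>(P \<Otimes>\<^sub>M \<nu>)) =
        (\<integral>\<^sup>+z. indicator {z \<in> F. w \<in> cball (g z) (rho ^ n)} z \<partial>(P \<Otimes>\<^sub>M \<nu>))"
      by (rule nn_integral_cong) (auto split: split_indicator)
    also have "\<dots> = emeasure (P \<Otimes>\<^sub>M \<nu>) {z \<in> F. w \<in> cball (g z) (rho ^ n)}" using mE by simp
    also have "\<dots> \<le> ennreal q" unfolding eq[symmetric] q_def by (rule emeasure_near_le)
    finally show "(\<integral>\<^sup>+z. indicator F z * indicator (cball (g z) (rho ^ n)) w \<partial>(P \<Otimes>\<^sub>M \<nu>)) \<le> ennreal q" .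
  qed
  also have "\<dots> = ennreal q" using th.emeasure_space_1 by simp
  finally have "ennreal (lev * measure (P \<Otimes>\<^sub>M \<nu>) H) \<le> ennreal q"
    using lev by (simp add: Pn.emeasure_eq_measure ennreal_mult)
  moreover have q0: "0 \<le> q" using K_ge_1 bb_ge_1 \<zeta> by (simp add: q_def)
  ultimately have "lev * measure (P \<Otimes>\<^sub>M \<nu>) H \<le> q" by (simp add: ennreal_le_iff)
  then have "measure (P \<Otimes>\<^sub>M \<nu>) H \<le> q / lev" using lev by (simp add: field_simps)
  then have "emeasure (P \<Otimes>\<^sub>M \<nu>) H \<le> ennreal (q / lev)" by (simp add: Pn.emeasure_eq_measure ennreal_leI)
  then show "emeasure (P \<Otimes>\<^sub>M \<nu>) {(a, y). y \<in> A \<and> s \<le> cnt n a (idx (m * n) y) \<and> lev \<le> measure \<theta> (cball (cod a + y) (rho ^ n))}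
    \<le> ennreal (K * card (T 0) * (bb + 1) ^ n * \<zeta> ^ s / lev)"
    unfolding H_eq q_def .
qed

lemma cnt_idx: "cnt n a (idx (m * n) y) = n - card {k. k < n \<and> \<not> light k a (idx (m * Suc k) y)}"
proof -
  have "idx (m * n) y div 2 ^ (m * (n - Suc k)) = idx (m * Suc k) y" if "k < n" for k
  proof -
    have "m * n = m * Suc k + m * (n - Suc k)" using that by (simp only: distrib_left[symmetric]) simp
    then show ?thesis using idx_div[of "m * Suc k" "m * (n - Suc k)" y] by simp
  qed
  then have "cnt n a (idx (m * n) y) = card {k. k < n \<and> light k a (idx (m * Suc k) y)}"
    unfolding cnt_def by (intro arg_cong[of _ _ card] Collect_cong conj_cong) auto
  also have "{k. k < n \<and> light k a (idx (m * Suc k) y)} = {..<n} - {k. k < n \<and> \<not> light k a (idx (m * Suc k) y)}" by auto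
  also have "card \<dots> = card {..<n} - card {k. k < n \<and> \<not> light k a (idx (m * Suc k) y)}"
    by (intro card_Diff_subset) auto
  finally show ?thesis by simp
qed

text \<open>Exponents of \<open>rho\<close> per step: \<open>bb + 1\<close> costs \<delta>, the
  light steps yield \<open>(\<gamma> - 2 * \<delta>) * (1 - \<delta>)\<close>, and the level of a
  heavy ball takes \<open>\<gamma> - 4 * \<delta>\<close>. As \<gamma> is at most 1, the surplus is
  at least \<open>2 * \<delta>\<^sup>2\<close>, so the events of heavy balls are summable and
  Borel-Cantelli applies.\<close>

lemma AE_small_balls:
  fixes \<theta> :: "real measure"
  assumes "prob_space \<theta>" and S: "sets \<theta> = sets borel"
    and freq: "\<And>y. y \<in> A \<Longrightarrow> AE a in P. \<forall>\<^sub>F n in sequentially.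
      real (card {k. k < n \<and> \<not> light k a (idx (m * Suc k) y)}) \<le> \<delta> * real n + real L"
    and \<delta>: "0 < \<delta>" and \<gamma>: "2 * \<delta> \<le> \<gamma>" "\<gamma> \<le> 1" and \<zeta>_eq: "\<zeta> = rho powr (\<gamma> - 2 * \<delta>)" and bb_le: "bb + 1 \<le> rho powr (- \<delta>)"
  shows "AE z in P \<Otimes>\<^sub>M \<nu>. snd z \<in> A \<longrightarrow> (\<forall>\<^sub>F n in sequentially.
    measure \<theta> (cball (cod (fst z) + snd z) (rho ^ n)) \<le> (rho ^ n) powr (\<gamma> - 4 * \<delta>))"
proof -
  interpret nn: prob_space \<nu> by unfold_locales
  interpret Pn: pair_prob_space P \<nu> ..
  have sp: "space (P \<Otimes>\<^sub>M \<nu>) = UNIV" using sets_eq_imp_space_eq[OF sets_nu] by (auto simp: space_pair_measure)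
  define s where "s n = nat \<lceil>(1 - \<delta>) * real n - real L\<rceil>" for n
  define lev where "lev n = (rho ^ n) powr (\<gamma> - 4 * \<delta>)" for n
  define F where "F n = {(a, y). y \<in> A \<and> s n \<le> cnt n a (idx (m * n) y)}" for n
  define H where "H n = {(a, y). y \<in> A \<and> s n \<le> cnt n a (idx (m * n) y) \<and> lev n \<le> measure \<theta> (cball (cod a + y) (rho ^ n))}" for n
  have lev: "0 < lev n" for n unfolding lev_def powr_gt_zero using rho_power_pos[of n] by linarith
  note heavy = emeasure_heavy_balls_le[OF assms(1) S lev]
  have mF: "F n \<in> sets (P \<Otimes>\<^sub>M \<nu>)" for n unfolding F_def by (rule heavy(2))
  have mH: "H n \<in> sets (P \<Otimes>\<^sub>M \<nu>)" for n unfolding H_def by (rule heavy(3))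
  define q where "q = rho powr (2 * \<delta>\<^sup>2)"
  have q: "0 \<le> q" "q < 1"
  proof -
    have "rho powr (2 * \<delta>\<^sup>2) < rho powr 0" using rho \<delta> by (intro powr_less_mono') auto
    then show "q < 1" using rho by (simp add: q_def)
  qed (simp add: q_def)
  have pw: "(rho ^ n) powr t = rho powr (real n * t)" for n t
    using rho by (simp add: powr_realpow[symmetric] powr_powr)
  have Hle: "measure (P \<Otimes>\<^sub>M \<nu>) (H n) \<le> K * card (T 0) * rho powr (- real L) * q ^ n" for n
  proof -
    have nonneg: "0 \<le> K * card (T 0) * (bb + 1) ^ n * \<zeta> ^ s n / lev n"
      using K_ge_1 bb_ge_1 \<zeta> lev[of n] by (intro divide_nonneg_pos mult_nonneg_nonneg) auto
    have "measure (P \<Otimes>\<^sub>M \<nu>) (H n) \<le> K * card (T 0) * (bb + 1) ^ n * \<zeta> ^ s n / lev n"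
      using heavy(1)[of "s n" n n] nonneg unfolding H_def by (simp add: Pn.emeasure_eq_measure ennreal_le_iff)
    also have "\<dots> = K * card (T 0) * ((bb + 1) ^ n * \<zeta> ^ s n / lev n)" by simp
    also have "(bb + 1) ^ n * \<zeta> ^ s n / lev n \<le> rho powr (- real L) * q ^ n"
    proof -
      have "(bb + 1) ^ n \<le> (rho powr (- \<delta>)) ^ n" using bb_le bb_ge_1 by (intro power_mono) auto
      also have "\<dots> = rho powr (- \<delta> * real n)" using rho by (simp add: powr_realpow[symmetric] powr_powr)
      finally have 1: "(bb + 1) ^ n \<le> rho powr (- \<delta> * real n)" .
      have "\<zeta> ^ s n = \<zeta> powr real (s n)" using \<zeta> by (simp add: powr_realpow)
      also have "\<dots> \<le> \<zeta> powr ((1 - \<delta>) * real n - real L)"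
        using \<zeta> by (intro powr_mono') (auto simp: s_def real_nat_ceiling_ge)
      also have "\<dots> = rho powr ((\<gamma> - 2 * \<delta>) * ((1 - \<delta>) * real n - real L))" by (simp add: \<zeta>_eq powr_powr)
      finally have 2: "\<zeta> ^ s n \<le> rho powr ((\<gamma> - 2 * \<delta>) * ((1 - \<delta>) * real n - real L))" .
      have 3: "1 / lev n = rho powr (- (real n * (\<gamma> - 4 * \<delta>)))" unfolding lev_def pw by (simp add: powr_minus divide_inverse)
      have "(bb + 1) ^ n * \<zeta> ^ s n / lev n = (bb + 1) ^ n * \<zeta> ^ s n * (1 / lev n)" by simp
      also have "\<dots> \<le> rho powr (- \<delta> * real n) * rho powr ((\<gamma> - 2 * \<delta>) * ((1 - \<delta>) * real n - real L)) * rho powr (- (real n * (\<gamma> - 4 * \<delta>)))"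
        unfolding 3 using 1 2 \<zeta> bb_ge_1 by (intro mult_right_mono mult_mono) auto
      also have "\<dots> = rho powr (- \<delta> * real n + (\<gamma> - 2 * \<delta>) * ((1 - \<delta>) * real n - real L) - real n * (\<gamma> - 4 * \<delta>))"
        by (simp add: powr_add[symmetric])
      also have "\<dots> \<le> rho powr (2 * \<delta>\<^sup>2 * real n - real L)"
      proof (rule powr_mono')
        have "\<gamma> * \<delta> * real n \<le> 1 * \<delta> * real n" using \<gamma> \<delta> by (intro mult_right_mono) auto
        moreover have "(\<gamma> - 2 * \<delta>) * real L \<le> 1 * real L" using \<gamma> \<delta> by (intro mult_right_mono) auto
        moreover have "- \<delta> * real n + (\<gamma> - 2 * \<delta>) * ((1 - \<delta>) * real n - real L) - real n * (\<gamma> - 4 * \<delta>) =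
          \<delta> * real n - \<gamma> * \<delta> * real n + 2 * \<delta>\<^sup>2 * real n - (\<gamma> - 2 * \<delta>) * real L"
          by (simp add: algebra_simps power2_eq_square)
        ultimately show "2 * \<delta>\<^sup>2 * real n - real L \<le> - \<delta> * real n + (\<gamma> - 2 * \<delta>) * ((1 - \<delta>) * real n - real L) - real n * (\<gamma> - 4 * \<delta>)"
          by linarith
      qed (use rho in auto)
      also have "\<dots> = rho powr (- real L) * rho powr (2 * \<delta>\<^sup>2 * real n)" by (simp add: powr_add[symmetric])
      also have "rho powr (2 * \<delta>\<^sup>2 * real n) = q ^ n" unfolding q_def using rho by (simp add: powr_realpow[symmetric] powr_powr)
      finally show ?thesis .
    qed
    then have "K * card (T 0) * ((bb + 1) ^ n * \<zeta> ^ s n / lev n) \<le> K * card (T 0) * (rho powr (- real L) * q ^ n)"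
      using K_ge_1 by (intro mult_left_mono) auto
    finally show ?thesis by simp
  qed
  have "summable (\<lambda>n. K * card (T 0) * rho powr (- real L) * q ^ n)"
    using q by (intro summable_mult summable_geometric) auto
  then have "summable (\<lambda>n. measure (P \<Otimes>\<^sub>M \<nu>) (H n))"
    by (rule summable_comparison_test'[of _ 0]) (use Hle in simp)
  then have "AE z in P \<Otimes>\<^sub>M \<nu>. \<forall>\<^sub>F n in sequentially. z \<in> space (P \<Otimes>\<^sub>M \<nu>) - H n"
    by (intro borel_cantelli_AE1 mH) (auto simp: Pn.emeasure_eq_measure)
  moreover have "AE z in P \<Otimes>\<^sub>M \<nu>. snd z \<in> A \<longrightarrow> (\<forall>\<^sub>F n in sequentially. z \<in> F n)"
  proof -
    have FA: "\<forall>\<^sub>F n in sequentially. (a, y) \<in> F n"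
      if "y \<in> A" "\<forall>\<^sub>F n in sequentially. real (card {k. k < n \<and> \<not> light k a (idx (m * Suc k) y)}) \<le> \<delta> * real n + real L" for a y
      using that(2)
    proof eventually_elim
      case (elim n)
      have "card {k. k < n \<and> \<not> light k a (idx (m * Suc k) y)} \<le> card {..<n}" by (intro card_mono) auto
      then have "real (cnt n a (idx (m * n) y)) = real n - real (card {k. k < n \<and> \<not> light k a (idx (m * Suc k) y)})"
        unfolding cnt_idx by (simp add: of_nat_diff)
      then have "(1 - \<delta>) * real n - real L \<le> real (cnt n a (idx (m * n) y))" using elim by (simp add: algebra_simps)
      then have "s n \<le> cnt n a (idx (m * n) y)" unfolding s_def by (simp add: nat_le_iff ceiling_le_iff)
      then show ?case using that(1) by (simp add: F_def)
    qed
    \<comment> \<open>The frequency bound is given for each fixed \<open>y\<close>, almost surely in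
      the word. Measurability of \<open>U\<close> carries it to the product measure.\<close>
    define U where "U = {z. snd z \<in> A \<longrightarrow> (\<forall>\<^sub>F n in sequentially. z \<in> F n)}"
    have mA: "UNIV \<times> A \<in> sets (P \<Otimes>\<^sub>M \<nu>)"
      using A_sets sets.top[of P] by (intro pair_measureI) (auto simp: sets_nu)
    have "U = (UNIV - UNIV \<times> A) \<union> (\<Union>N. \<Inter>n\<in>{N..}. F n)"
      by (auto simp: U_def eventually_sequentially)
    moreover have "(\<Union>N. \<Inter>n\<in>{N..}. F n) \<in> sets (P \<Otimes>\<^sub>M \<nu>)"
      using mF by (intro sets.countable_UN sets.countable_INT'') (auto intro!: sets.countable_INT')
    moreover have "UNIV - UNIV \<times> A \<in> sets (P \<Otimes>\<^sub>M \<nu>)" using sets.compl_sets[OF mA] by (simp add: sp)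
    ultimately have mU: "U \<in> sets (P \<Otimes>\<^sub>M \<nu>)" by auto
    have "AE y in \<nu>. AE a in P. (a, y) \<in> U"
    proof (rule AE_I2)
      fix y
      show "AE a in P. (a, y) \<in> U"
      proof (cases "y \<in> A")
        case True
        from freq[OF this] show ?thesis by eventually_elim (use FA[OF True] in \<open>simp add: U_def\<close>)
      qed (simp add: U_def)
    qed
    then have "AE a in P. AE y in \<nu>. (a, y) \<in> U"
      using mU by (subst Pn.AE_commute) (simp_all add: sp)
    then have "AE z in P \<Otimes>\<^sub>M \<nu>. z \<in> U" using mU by (intro Pn.AE_pair_measure) (auto simp: sp)
    then show ?thesis by (simp add: U_def)
  qed
  ultimately show ?thesis
  proof eventually_elim
    case (elim z)
    show ?case
    proof
      assume "snd z \<in> A"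
      with elim(2) have "\<forall>\<^sub>F n in sequentially. z \<in> F n" by simp
      with elim(1) show "\<forall>\<^sub>F n in sequentially. measure \<theta> (cball (cod (fst z) + snd z) (rho ^ n)) \<le> (rho ^ n) powr (\<gamma> - 4 * \<delta>)"
        by eventually_elim (auto simp: F_def H_def lev_def not_le intro: less_imp_le)
    qed
  qed
qed

end

section \<open>Choice of the parameters and exhaustion by regular sets\<close>

lemma ex_fine_grid:
  fixes \<delta> a b c \<epsilon> :: real
  assumes "0 < \<delta>" "0 < \<epsilon>"
  obtains m :: nat where "0 < m" "a * (1 / 2 ^ m) \<le> 1" "b * (real (Suc m) * (1 / 2 ^ m) powr \<delta>) \<le> \<epsilon>"
    "c * (1 / 2 ^ m) powr \<delta> \<le> 1"
proof -
  define x where "x = (1 / 2) powr \<delta>"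
  have x: "0 < x" "x < 1" using powr_less_mono'[of "1 / 2" 0 \<delta>] assms by (auto simp: x_def)
  have xm: "(1 / 2 ^ m) powr \<delta> = x ^ m" for m :: nat
  proof -
    have "(1 / 2 ^ m :: real) = (1 / 2) powr real m" by (simp add: powr_realpow power_divide)
    then show ?thesis using x by (simp add: x_def powr_realpow[symmetric] powr_powr mult.commute)
  qed
  have l1: "(\<lambda>m. (1 / 2 :: real) ^ m) \<longlonglongrightarrow> 0" "(\<lambda>m. x ^ m) \<longlonglongrightarrow> 0"
    using x by (intro LIMSEQ_realpow_zero; simp)+
  have l2: "(\<lambda>m. real m * x ^ m) \<longlonglongrightarrow> 0" using x by (intro powser_times_n_limit_0) simp
  have "(\<lambda>m. b * (real m * x ^ m + x ^ m)) \<longlonglongrightarrow> b * (0 + 0)" by (intro tendsto_intros l1 l2)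
  then have "\<forall>\<^sub>F m in sequentially. b * (real m * x ^ m + x ^ m) < \<epsilon>"
    using assms(2) by (auto dest: order_tendstoD)
  moreover have "(\<lambda>m. a * (1 / 2) ^ m) \<longlonglongrightarrow> a * 0" by (intro tendsto_intros l1)
  then have "\<forall>\<^sub>F m in sequentially. a * (1 / 2) ^ m < 1" by (rule order_tendstoD(2)) simp
  moreover have "(\<lambda>m. c * x ^ m) \<longlonglongrightarrow> c * 0" by (intro tendsto_intros l1)
  then have "\<forall>\<^sub>F m in sequentially. c * x ^ m < 1" by (rule order_tendstoD(2)) simp
  moreover have "\<forall>\<^sub>F m in sequentially. 0 < m" by (rule eventually_gt_at_top)
  ultimately have "\<forall>\<^sub>F m in sequentially. 0 < m \<and> a * (1 / 2 ^ m) \<le> 1 \<and>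
      b * (real (Suc m) * (1 / 2 ^ m) powr \<delta>) \<le> \<epsilon> \<and> c * (1 / 2 ^ m) powr \<delta> \<le> 1"
    by eventually_elim (simp add: xm power_divide algebra_simps)
  from eventually_happens'[OF sequentially_bot this] that show ?thesis by blast
qed

context weighted_ifs
begin

text \<open>The order of the choices matters. \<open>\<epsilon>\<close>, \<open>K2\<close>,
  \<open>C\<close>, \<open>i0\<close> and \<open>B\<close> are fixed before \<open>m\<close>, which
  is then taken so large that \<open>rho powr \<delta>\<close> beats them. The threshold
  \<open>T0\<close> and the lag \<open>L\<close> come after \<open>m\<close>; \<open>L\<close> only
  adds a constant to the number of steps that are not light.\<close>

lemma AE_regular_dyadic_bound:
  fixes \<nu> \<theta> :: "real measure" and \<beta> K \<delta> :: real
  assumes sep: "strong_separation f" and dense: "generates_dense_subgroup (range r)"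
    and reg: "regular_set \<nu> \<beta> K A" and th: "prob_space \<theta>" and S: "sets \<theta> = sets borel"
    and \<delta>: "0 < \<delta>" "4 * \<delta> \<le> min 1 (\<alpha> + \<beta>)"
  shows "AE z in P \<Otimes>\<^sub>M \<nu>. snd z \<in> A \<longrightarrow> (\<exists>k::nat. \<forall>l::nat.
    measure \<theta> (cball (cod (fst z) + snd z) (1 / 2 ^ l)) \<le> k * (1 / 2 ^ l) powr (min 1 (\<alpha> + \<beta>) - 4 * \<delta>))"
proof -
  interpret R: regular_set \<nu> \<beta> K A by (rule reg)
  interpret th: prob_space \<theta> by (rule th)
  define \<gamma> where "\<gamma> = min 1 (\<alpha> + \<beta>)"
  have \<gamma>: "4 * \<delta> \<le> \<gamma>" "\<gamma> \<le> 1" "\<gamma> \<le> \<alpha> + \<beta>" using \<delta> by (auto simp: \<gamma>_def)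
  obtain D where D: "D > 0" "\<And>a b. a 0 \<noteq> b 0 \<Longrightarrow> D \<le> \<bar>cod a - cod b\<bar>"
    by (rule separation_gap[OF sep]) blast
  define \<sigma> where "\<sigma> = max 0 (\<alpha> - \<delta>)"
  have \<sigma>: "0 \<le> \<sigma>" "\<sigma> < \<alpha>" using \<alpha>_pos[OF dense] \<delta> by (auto simp: \<sigma>_def)
  define \<tau> where "\<tau> = max (\<sigma> + \<beta> - 1) 0"
  \<comment> \<open>Replacing \<alpha> by \<sigma> costs at most one \<delta>, while the threshold
    \<zeta> gives away two. The difference pays for \<open>B * real (Suc m)\<close>.\<close>
  have expo: "\<gamma> - \<delta> \<le> \<beta> + \<sigma> - \<tau>" using \<gamma> \<delta> by (auto simp: \<tau>_def \<sigma>_def max_def)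
  \<comment> \<open>Makes \<open>\<epsilon> powr \<delta>\<close> equal to 1/4, the value that
    \<open>AE_lagged_frequency_le\<close> requires.\<close>
  define \<epsilon> where "\<epsilon> = (1 / 4 :: real) powr (1 / \<delta>)"
  have \<epsilon>: "0 < \<epsilon>" "\<epsilon> \<le> 1" "\<epsilon> powr \<delta> \<le> 1 / 4"
    using \<delta> by (auto simp: \<epsilon>_def powr_powr powr_le1)
  obtain K2 where K2: "K2 \<ge> 1" "1 - \<epsilon> / 2 < measure P (good \<sigma> K2)"
    using ex_good[OF \<sigma>(2), of "\<epsilon> / 2"] \<epsilon>(1) by auto
  define C where "C = 3 * (3 / (- ln rmax) + 1) + 1"
  have C: "0 \<le> C"
    unfolding C_def using ln_rmax_neg by (intro add_nonneg_nonneg mult_nonneg_nonneg divide_nonneg_pos) auto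
  define c where "c = 4 * (bnd + 1)"
  have c: "0 < c" using bnd_ge_1 by (simp add: c_def)
  obtain i0 where i0: "6 * c < 2 ^ i0" using real_arch_pow[of 2 "6 * c"] by auto
  define B where "B = R.bb * K2 * ((2 ^ i0) powr \<beta> * (9 * c / (rmin * D)) powr \<sigma> + 24 * C * c * (3 / 2 / (rmin * D)) powr \<sigma> * 2 powr \<beta>)"
  have B: "0 \<le> B" using R.bb_ge_1 K2 C c by (simp add: B_def)
  have "0 < \<epsilon> / 2" using \<epsilon> by simp
  from ex_fine_grid[OF \<delta>(1) this, of "12 * c" B "R.bb + 1"]
  obtain m :: nat where m: "0 < m" "12 * c * (1 / 2 ^ m) \<le> 1" "B * (real (Suc m) * (1 / 2 ^ m) powr \<delta>) \<le> \<epsilon> / 2"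
    "(R.bb + 1) * (1 / 2 ^ m) powr \<delta> \<le> 1" by blast
  define \<zeta> where "\<zeta> = (1 / 2 ^ m :: real) powr (\<gamma> - 2 * \<delta>)"
  have \<zeta>: "0 < \<zeta>" "\<zeta> \<le> 1" using \<gamma> \<delta> by (auto simp: \<zeta>_def intro!: powr_le1)
  interpret Sc: scheme r u v p \<nu> \<beta> K A m \<zeta>
    by (intro scheme.intro scheme_axioms.intro weighted_ifs_axioms reg m(1) \<zeta>)
  have cc: "Sc.cc = c" by (simp add: Sc.cc_def c_def)
  have \<eta>: "0 < 12 * Sc.cc * Sc.rho" "12 * Sc.cc * Sc.rho \<le> 1"
    using m(2) c Sc.rho(1) by (auto simp: cc Sc.rho_def)
  obtain T0 where T0: "\<And>t. t \<ge> T0 \<Longrightarrow> measure P (hit (12 * Sc.cc * Sc.rho) t) \<le> C * (12 * Sc.cc * Sc.rho)"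
    using renewal_bound[OF dense \<eta>] unfolding C_def by blast
  have "0 < rmin * exp (- T0)" using rmin_pos by simp
  then obtain L where "Sc.rho ^ L < rmin * exp (- T0)"
    using real_arch_pow_inv[of "rmin * exp (- T0)" Sc.rho] Sc.rho by blast
  then have L: "Sc.rho ^ L / rmin \<le> exp (- T0)" using rmin_pos by (simp add: divide_le_eq mult.commute)
  have freq: "AE a in P. \<forall>\<^sub>F n in sequentially.
      real (card {k. k < n \<and> \<not> Sc.light k a (R.idx (m * Suc k) y)}) \<le> \<delta> * real n + real L" if y: "y \<in> A" for y
  proof (rule AE_lagged_frequency_le[OF Sc.rho(1,3) _ _ \<epsilon>(1,2) \<delta>(1) \<epsilon>(3)])
    show "adapted (Sc.rho ^ Suc k) (\<lambda>a. \<not> Sc.light k a (R.idx (m * Suc k) y))" for k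
      by (rule adapted_comp[OF Sc.adapted_light, where F = Not])
    show "measure P {b. \<not> Sc.light k (join (Sc.rho ^ (k - L)) a b) (R.idx (m * Suc k) y)} \<le> \<epsilon>" if "L \<le> k" for k a
    proof -
      have "measure P {b. \<not> Sc.light k (join (Sc.rho ^ (k - L)) a b) (R.idx (m * Suc k) y)} \<le>
        (1 - measure P (good \<sigma> K2)) + B * real (Suc m) * Sc.rho powr (\<beta> + \<sigma> - \<tau>) / \<zeta>"
        unfolding B_def \<tau>_def cc[symmetric]
        by (rule Sc.measure_not_light_le[OF D \<sigma>(1) _ T0 C L \<open>L \<le> k\<close>])
          (use K2 i0 y in \<open>auto simp: cc R.T_def\<close>)
      moreover have "B * real (Suc m) * Sc.rho powr (\<beta> + \<sigma> - \<tau>) / \<zeta> \<le> \<epsilon> / 2"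
      proof -
        have "Sc.rho powr (\<beta> + \<sigma> - \<tau>) / \<zeta> = Sc.rho powr (\<beta> + \<sigma> - \<tau> - (\<gamma> - 2 * \<delta>))"
          unfolding \<zeta>_def Sc.rho_def[symmetric] by (rule powr_diff[symmetric])
        also have "\<dots> \<le> Sc.rho powr \<delta>" using expo Sc.rho by (intro powr_mono') auto
        finally have "B * real (Suc m) * (Sc.rho powr (\<beta> + \<sigma> - \<tau>) / \<zeta>) \<le> B * real (Suc m) * Sc.rho powr \<delta>"
          using B by (intro mult_left_mono) auto
        also have "\<dots> \<le> \<epsilon> / 2" using m(3) unfolding Sc.rho_def by (simp only: mult.assoc)
        finally show ?thesis by simp
      qed
      ultimately show ?thesis using K2(2) by linarith
    qed
  qed
  have "R.bb + 1 \<le> Sc.rho powr (- \<delta>)"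
    using m(4) Sc.rho(1) unfolding Sc.rho_def[symmetric] by (simp add: powr_minus field_simps)
  then have "AE z in P \<Otimes>\<^sub>M \<nu>. snd z \<in> A \<longrightarrow> (\<forall>\<^sub>F n in sequentially.
    measure \<theta> (cball (cod (fst z) + snd z) (Sc.rho ^ n)) \<le> (Sc.rho ^ n) powr (\<gamma> - 4 * \<delta>))"
    using \<gamma> \<delta> by (intro Sc.AE_small_balls[OF th S freq \<delta>(1)]) (auto simp: \<zeta>_def Sc.rho_def)
  then show ?thesis
  proof eventually_elim
    case (elim z)
    show ?case
    proof
      assume "snd z \<in> A"
      with elim have "\<forall>\<^sub>F n in sequentially. measure \<theta> (cball (cod (fst z) + snd z) ((1 / 2 ^ m) ^ n)) \<le> ((1 / 2 ^ m) ^ n) powr (\<gamma> - 4 * \<delta>)"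
        unfolding Sc.rho_def by blast
      from dyadic_bound_from_coarse_scales[OF th.finite_measure_axioms S m(1) _ order_refl this]
      show "\<exists>k::nat. \<forall>l::nat. measure \<theta> (cball (cod (fst z) + snd z) (1 / 2 ^ l)) \<le> k * (1 / 2 ^ l) powr (min 1 (\<alpha> + \<beta>) - 4 * \<delta>)"
        using \<gamma> unfolding \<gamma>_def by simp
    qed
  qed
qed

text \<open>Almost every point of \<nu> lies in some \<open>A k\<close>, where one number bounds the
  point and both constants; \<open>Suc k\<close> keeps that number at least 1. The null sets for all
  \<open>k\<close> and all losses \<open>1 / Suc j\<close> are countably many and can be discarded
  together.\<close>

lemma AE_local_dim_ge_sum:
  fixes \<nu> \<theta> :: "real measure"
  assumes sep: "strong_separation f" and dense: "generates_dense_subgroup (range r)"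
    and nu: "prob_space \<nu>" "sets \<nu> = sets borel" and \<beta>: "0 < \<beta>"
    and ahlfors: "AE y in \<nu>. \<exists>c>0. \<forall>r. 0 < r \<and> r \<le> 1 \<longrightarrow>
      inverse c * r powr \<beta> \<le> measure \<nu> (cball y r) \<and> measure \<nu> (cball y r) \<le> c * r powr \<beta>"
    and th: "prob_space \<theta>" "sets \<theta> = sets borel"
  shows "AE z in P \<Otimes>\<^sub>M \<nu>. local_dim_ge \<theta> (min 1 (\<alpha> + \<beta>)) (cod (fst z) + snd z)"
proof -
  interpret nu: prob_space \<nu> by fact
  interpret th: prob_space \<theta> by fact
  define \<gamma> where "\<gamma> = min 1 (\<alpha> + \<beta>)"
  define A where "A k = {y \<in> {-real (Suc k)..real (Suc k)}. \<forall>i. (1 / 2 ^ i) powr \<beta> \<le> real (Suc k) * measure \<nu> (cball y (1 / 2 ^ i)) \<and>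
    measure \<nu> (cball y (1 / 2 ^ i)) \<le> real (Suc k) * (1 / 2 ^ i) powr \<beta>}" for k :: nat
  have A_sets: "A k \<in> sets borel" for k
  proof -
    have [measurable]: "(\<lambda>x. measure \<nu> (cball x R)) \<in> borel_measurable borel" for R
      by (rule measurable_measure_cball[OF nu.finite_measure_axioms nu(2)])
    have "{y \<in> space borel. y \<in> {-real (Suc k)..real (Suc k)} \<and> (\<forall>i. (1 / 2 ^ i) powr \<beta> \<le> real (Suc k) * measure \<nu> (cball y (1 / 2 ^ i)) \<and>
      measure \<nu> (cball y (1 / 2 ^ i)) \<le> real (Suc k) * (1 / 2 ^ i) powr \<beta>)} \<in> sets borel" by measurable
    then show ?thesis by (simp add: A_def)
  qed
  have reg: "regular_set \<nu> \<beta> (real (Suc k)) (A k)" for k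
    by (intro regular_set.intro regular_set_axioms.intro nu \<beta> A_sets) (auto simp: A_def)
  have AE1: "AE z in P \<Otimes>\<^sub>M \<nu>. snd z \<in> A k \<longrightarrow> (\<exists>K::nat. \<forall>l::nat.
      measure \<theta> (cball (cod (fst z) + snd z) (1 / 2 ^ l)) \<le> K * (1 / 2 ^ l) powr (\<gamma> - 1 / Suc j))" for k j :: nat
  proof (cases "1 / real (Suc j) \<le> \<gamma>")
    case True
    have four: "4 * (1 / (4 * real (Suc j))) = 1 / Suc j" by (simp add: field_simps)
    from True show ?thesis
      using AE_regular_dyadic_bound[OF sep dense reg[of k] th, of "1 / (4 * real (Suc j))"] unfolding \<gamma>_def four by simp
  next
    \<comment> \<open>The exponent is negative here, so the right-hand side is at least 1, the total
      mass of \<theta>.\<close>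
    case False
    have "measure \<theta> (cball x (1 / 2 ^ l)) \<le> real 1 * (1 / 2 ^ l) powr (\<gamma> - 1 / Suc j)" for x and l :: nat
    proof -
      have "1 powr (\<gamma> - 1 / Suc j) \<le> (1 / 2 ^ l) powr (\<gamma> - 1 / Suc j)" using False by (intro powr_mono2') auto
      then have "1 \<le> (1 / 2 ^ l) powr (\<gamma> - 1 / Suc j)" by simp
      then show ?thesis unfolding of_nat_1 mult_1 using th.prob_le_1[of "cball x (1 / 2 ^ l)"] by (rule order_trans[rotated])
    qed
    then have "\<exists>K::nat. \<forall>l::nat. measure \<theta> (cball x (1 / 2 ^ l)) \<le> K * (1 / 2 ^ l) powr (\<gamma> - 1 / Suc j)" for x by blast
    then show ?thesis by (intro AE_I2 impI)
  qed
  have "AE y in \<nu>. \<exists>k. y \<in> A k"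
    using ahlfors
  proof eventually_elim
    case (elim y)
    then obtain c where c: "c > 0" "\<And>r. 0 < r \<Longrightarrow> r \<le> 1 \<Longrightarrow> inverse c * r powr \<beta> \<le> measure \<nu> (cball y r) \<and> measure \<nu> (cball y r) \<le> c * r powr \<beta>"
      by blast
    obtain k :: nat where k: "max c \<bar>y\<bar> \<le> real k" using real_arch_simple by blast
    have "(1 / 2 ^ i) powr \<beta> \<le> real (Suc k) * measure \<nu> (cball y (1 / 2 ^ i))"
      "measure \<nu> (cball y (1 / 2 ^ i)) \<le> real (Suc k) * (1 / 2 ^ i) powr \<beta>" for i :: nat
    proof -
      have ci: "inverse c * (1 / 2 ^ i) powr \<beta> \<le> measure \<nu> (cball y (1 / 2 ^ i))" "measure \<nu> (cball y (1 / 2 ^ i)) \<le> c * (1 / 2 ^ i) powr \<beta>"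
        using c(2)[of "1 / 2 ^ i"] by auto
      have "(1 / 2 ^ i) powr \<beta> = c * (inverse c * (1 / 2 ^ i) powr \<beta>)" using c(1) by simp
      also have "\<dots> \<le> c * measure \<nu> (cball y (1 / 2 ^ i))" using ci(1) c(1) by (intro mult_left_mono) auto
      also have "\<dots> \<le> real (Suc k) * measure \<nu> (cball y (1 / 2 ^ i))" using k by (intro mult_right_mono) auto
      finally show "(1 / 2 ^ i) powr \<beta> \<le> real (Suc k) * measure \<nu> (cball y (1 / 2 ^ i))" .
      have "c * (1 / 2 ^ i) powr \<beta> \<le> real (Suc k) * (1 / 2 ^ i) powr \<beta>" using k by (intro mult_right_mono) auto
      with ci(2) show "measure \<nu> (cball y (1 / 2 ^ i)) \<le> real (Suc k) * (1 / 2 ^ i) powr \<beta>" by linarith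
    qed
    then have "y \<in> A k" using k unfolding A_def by auto
    then show ?case by blast
  qed
  then have "AE z in P \<Otimes>\<^sub>M \<nu>. \<exists>k. snd z \<in> A k"
    by (rule AE_snd_prod[OF seq.P.prob_space_axioms nu(1)])
  moreover have "AE z in P \<Otimes>\<^sub>M \<nu>. \<forall>k j. snd z \<in> A k \<longrightarrow> (\<exists>K::nat. \<forall>l::nat.
      measure \<theta> (cball (cod (fst z) + snd z) (1 / 2 ^ l)) \<le> K * (1 / 2 ^ l) powr (\<gamma> - 1 / Suc j))"
    unfolding AE_all_countable by (intro allI AE1)
  ultimately show ?thesis
    by eventually_elim (auto simp: local_dim_ge_def \<gamma>_def)
qed

section \<open>The law and the exact dimension of the convolution\<close>

lemma convolution_\<mu>_eq:
  fixes \<nu> :: "real measure"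
  assumes nu: "prob_space \<nu>" "sets \<nu> = sets borel"
  shows "(\<mu> \<star> \<nu>) = distr (P \<Otimes>\<^sub>M \<nu>) borel (\<lambda>z. cod (fst z) + snd z)"
proof -
  interpret nu: prob_space \<nu> by fact
  have id: "distr \<nu> borel (\<lambda>x. x) = \<nu>"
    using nu(2) by (intro measure_eqI) (auto simp: emeasure_distr measurable_cong_sets[OF nu(2) refl] sets_eq_imp_space_eq[OF nu(2)])
  have mid: "(\<lambda>x. x) \<in> measurable \<nu> borel" by (simp add: measurable_cong_sets[OF nu(2) refl])
  have "\<mu> \<Otimes>\<^sub>M distr \<nu> borel (\<lambda>x. x) = distr (P \<Otimes>\<^sub>M \<nu>) (borel \<Otimes>\<^sub>M borel) (\<lambda>(x, y). (cod x, y))"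
    by (rule pair_measure_distr[OF measurable_cod mid]) (unfold id, rule nu.sigma_finite_measure_axioms)
  then have eq: "\<mu> \<Otimes>\<^sub>M \<nu> = distr (P \<Otimes>\<^sub>M \<nu>) (borel \<Otimes>\<^sub>M borel) (\<lambda>(x, y). (cod x, y))" unfolding id .
  have m: "(\<lambda>(x, y). (cod x, y)) \<in> measurable (P \<Otimes>\<^sub>M \<nu>) (borel \<Otimes>\<^sub>M borel)"
    unfolding split_beta'
    by (intro measurable_Pair measurable_compose[OF measurable_fst measurable_cod] measurable_compose[OF measurable_snd mid])
  have "(\<mu> \<star> \<nu>) = distr (distr (P \<Otimes>\<^sub>M \<nu>) (borel \<Otimes>\<^sub>M borel) (\<lambda>(x, y). (cod x, y))) borel (\<lambda>(x, y). x + y)"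
    unfolding convolution_def eq ..
  also have "\<dots> = distr (P \<Otimes>\<^sub>M \<nu>) borel ((\<lambda>(x, y). x + y) \<circ> (\<lambda>(x, y). (cod x, y)))"
    by (rule distr_distr[OF _ m]) measurable
  also have "((\<lambda>(x, y). x + y) \<circ> (\<lambda>(x, y). (cod x, y))) = (\<lambda>z. cod (fst z) + snd z)"
    by (auto simp: fun_eq_iff)
  finally show ?thesis .
qed

text \<open>Points within \<open>R\<close> of \<open>x\<close> and of \<open>y\<close> have a sum
  within \<open>2 * R\<close> of \<open>x + y\<close>.\<close>

lemma measure_convolution_ge:
  fixes \<nu> :: "real measure"
  assumes nu: "prob_space \<nu>" "sets \<nu> = sets borel"
  shows "measure \<mu> (cball x R) * measure \<nu> (cball y R) \<le> measure (\<mu> \<star> \<nu>) (cball (x + y) (2 * R))"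
proof -
  interpret nu: prob_space \<nu> by fact
  interpret pair_prob_space \<mu> \<nu> ..
  have "(\<lambda>(x, y). x + y) \<in> borel_measurable (borel \<Otimes>\<^sub>M (borel :: real measure))" by measurable
  then have m: "(\<lambda>(x, y). x + y) \<in> borel_measurable (\<mu> \<Otimes>\<^sub>M \<nu>)"
    by (subst measurable_cong_sets[OF sets_pair_measure_cong[OF sets_distr nu(2)] refl])
  have "measure \<mu> (cball x R) * measure \<nu> (cball y R) = measure (\<mu> \<Otimes>\<^sub>M \<nu>) (cball x R \<times> cball y R)"
    by (simp add: measure_def nu.emeasure_pair_measure_Times nu(2) enn2real_mult)
  also have "\<dots> \<le> measure (\<mu> \<Otimes>\<^sub>M \<nu>) ((\<lambda>(x, y). x + y) -` cball (x + y) (2 * R) \<inter> space (\<mu> \<Otimes>\<^sub>M \<nu>))"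
  proof (rule finite_measure_mono)
    show "cball x R \<times> cball y R \<subseteq> (\<lambda>(x, y). x + y) -` cball (x + y) (2 * R) \<inter> space (\<mu> \<Otimes>\<^sub>M \<nu>)"
      using sets_eq_imp_space_eq[OF nu(2)] by (auto simp: space_pair_measure dist_real_def)
    show "(\<lambda>(x, y). x + y) -` cball (x + y) (2 * R) \<inter> space (\<mu> \<Otimes>\<^sub>M \<nu>) \<in> sets (\<mu> \<Otimes>\<^sub>M \<nu>)"
      by (rule measurable_sets[OF m]) simp
  qed
  also have "\<dots> = measure (\<mu> \<star> \<nu>) (cball (x + y) (2 * R))"
    unfolding convolution_def by (rule measure_distr[OF m, symmetric]) simp
  finally show ?thesis .
qed

text \<open>The lower bound on the dimension is taken with \<theta> equal to the convolution itself.
  The upper bound is the smaller of two: \<open>\<alpha> + \<beta>\<close>, from adding the local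
  dimensions of the factors, and 1, which holds for every finite Borel measure on the line.\<close>

lemma has_exact_dim_convolution:
  fixes \<nu> :: "real measure"
  assumes sep: "strong_separation f" and dense: "generates_dense_subgroup (range r)"
    and nu: "prob_space \<nu>" "sets \<nu> = sets borel" and \<beta>: "0 < \<beta>"
    and ahlfors: "AE y in \<nu>. \<exists>c>0. \<forall>r. 0 < r \<and> r \<le> 1 \<longrightarrow>
      inverse c * r powr \<beta> \<le> measure \<nu> (cball y r) \<and> measure \<nu> (cball y r) \<le> c * r powr \<beta>"
  shows "has_exact_dim (\<mu> \<star> \<nu>) (min 1 (\<alpha> + \<beta>))" and "prob_space (\<mu> \<star> \<nu>)"
proof -
  interpret nu: prob_space \<nu> by fact
  interpret Pn: pair_prob_space P \<nu> ..
  define \<theta> where "\<theta> = (\<mu> \<star> \<nu>)"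
  have mz: "(\<lambda>z. cod (fst z) + snd z) \<in> borel_measurable (P \<Otimes>\<^sub>M \<nu>)"
  proof -
    have "snd \<in> borel_measurable (P \<Otimes>\<^sub>M \<nu>)"
      using measurable_snd[of P \<nu>] by (simp add: measurable_cong_sets[OF refl nu(2)])
    then show ?thesis by (intro borel_measurable_add measurable_compose[OF measurable_fst measurable_cod])
  qed
  have \<theta>_eq: "\<theta> = distr (P \<Otimes>\<^sub>M \<nu>) borel (\<lambda>z. cod (fst z) + snd z)"
    unfolding \<theta>_def by (rule convolution_\<mu>_eq[OF nu])
  then have th: "prob_space \<theta>" using Pn.prob_space_distr[OF mz] by simp
  then show "prob_space (\<mu> \<star> \<nu>)" unfolding \<theta>_def .
  interpret th: prob_space \<theta> by (rule th)
  have S: "sets \<theta> = sets borel" by (simp add: \<theta>_def)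
  have fin: "finite_measure \<theta>" by unfold_locales
  have 1: "AE z in P \<Otimes>\<^sub>M \<nu>. local_dim_ge \<theta> (min 1 (\<alpha> + \<beta>)) (cod (fst z) + snd z)"
    by (rule AE_local_dim_ge_sum[OF sep dense nu \<beta> ahlfors th S])
  have "AE y in \<nu>. local_dim_le \<nu> \<beta> y"
    using ahlfors by eventually_elim (use ahlfors_point_local_dim in blast)
  then have "AE z in P \<Otimes>\<^sub>M \<nu>. local_dim_le \<nu> \<beta> (snd z)"
    by (rule AE_snd_prod[OF seq.P.prob_space_axioms nu(1)])
  moreover have "AE z in P \<Otimes>\<^sub>M \<nu>. local_dim_le \<mu> \<alpha> (cod (fst z))"
    by (rule AE_fst_prod[OF nu(1) AE_local_dim_le_\<mu>])
  ultimately have 2: "AE z in P \<Otimes>\<^sub>M \<nu>. local_dim_le \<theta> (\<alpha> + \<beta>) (cod (fst z) + snd z)"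
  proof eventually_elim
    case (elim z)
    show ?case unfolding \<theta>_def by (rule local_dim_le_add[OF measure_convolution_ge[OF nu] elim(2,1)])
  qed
  have "AE x in \<theta>. local_dim_ge \<theta> (min 1 (\<alpha> + \<beta>)) x"
    using 1 sets_local_dim(1)[OF fin S, of "min 1 (\<alpha> + \<beta>)"]
    by (subst (1) \<theta>_eq) (subst AE_distr_iff[OF mz], auto)
  moreover have "AE x in \<theta>. local_dim_le \<theta> (\<alpha> + \<beta>) x"
    using 2 sets_local_dim(2)[OF fin S, of "\<alpha> + \<beta>"]
    by (subst (1) \<theta>_eq) (subst AE_distr_iff[OF mz], auto)
  moreover have "AE x in \<theta>. local_dim_le \<theta> 1 x" by (rule AE_local_dim_le_1[OF fin S])
  ultimately have "AE x in \<theta>. ((\<lambda>r. ln (measure \<theta> (cball x r)) / ln r) \<longlongrightarrow> min 1 (\<alpha> + \<beta>)) (at_right 0)"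
  proof eventually_elim
    case (elim x)
    then have "local_dim_le \<theta> (min 1 (\<alpha> + \<beta>)) x" by (simp add: min_def)
    with elim(1) show ?case by (rule local_dim_imp_tendsto[OF fin S])
  qed
  then show "has_exact_dim (\<mu> \<star> \<nu>) (min 1 (\<alpha> + \<beta>))" unfolding has_exact_dim_def \<theta>_def .
qed

end

lemma ahlfors_has_exact_dim:
  fixes \<nu> :: "real measure"
  assumes nu: "prob_space \<nu>" "sets \<nu> = sets borel"
    and ahlfors: "AE y in \<nu>. \<exists>c>0. \<forall>r. 0 < r \<and> r \<le> 1 \<longrightarrow>
      inverse c * r powr \<beta> \<le> measure \<nu> (cball y r) \<and> measure \<nu> (cball y r) \<le> c * r powr \<beta>"
  shows "has_exact_dim \<nu> \<beta>"
  unfolding has_exact_dim_def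
  using ahlfors
proof eventually_elim
  case (elim y)
  interpret prob_space \<nu> by fact
  from elim have "local_dim_ge \<nu> \<beta> y \<and> local_dim_le \<nu> \<beta> y" using ahlfors_point_local_dim by blast
  then show ?case by (intro local_dim_imp_tendsto[OF finite_measure_axioms nu(2)]) auto
qed

theorem theorem1p39:
  fixes r u v p :: "'i::finite \<Rightarrow> real" and \<mu> \<nu> :: "real measure"
  assumes "is_ifs r u v"
    and "strong_separation (ifs_map r u v)"
    and "generates_dense_subgroup (range r)"
    and "positive_prob_vector p"
    and "\<mu> = self_similar_measure (ifs_map r u v) p"
    and "prob_space \<nu>" and "sets \<nu> = sets borel"
    and "ae_ahlfors \<nu>"
  shows "dissonate \<mu> \<nu>"
proof -
  interpret W: weighted_ifs r u v p by unfold_locales fact+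
  obtain \<beta> where \<beta>: "\<beta> > 0" and ahlfors: "AE y in \<nu>. \<exists>c>0. \<forall>r. 0 < r \<and> r \<le> 1 \<longrightarrow>
      inverse c * r powr \<beta> \<le> measure \<nu> (cball y r) \<and> measure \<nu> (cball y r) \<le> c * r powr \<beta>"
    using assms(8) unfolding ae_ahlfors_def by blast
  have \<mu>: "\<mu> = W.\<mu>" unfolding assms(5) by (rule W.self_similar_measure_eq)
  have dim_\<mu>: "has_exact_dim \<mu> W.\<alpha>" unfolding \<mu> by (rule W.has_exact_dim_\<mu>[OF assms(2)])
  have dim_\<nu>: "has_exact_dim \<nu> \<beta>" by (rule ahlfors_has_exact_dim[OF assms(6,7) ahlfors])
  have dim_conv: "has_exact_dim (\<mu> \<star> \<nu>) (min 1 (W.\<alpha> + \<beta>))" and conv: "prob_space (\<mu> \<star> \<nu>)"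
    unfolding \<mu> by (rule W.has_exact_dim_convolution[OF assms(2,3,6,7) \<beta> ahlfors])+
  have "measure_dim \<mu> = W.\<alpha>"
    using dim_\<mu> W.mu.prob_space_axioms unfolding \<mu> by (intro measure_dim_eqI)
  moreover have "measure_dim \<nu> = \<beta>" by (rule measure_dim_eqI[OF assms(6) dim_\<nu>])
  moreover have "measure_dim (\<mu> \<star> \<nu>) = min 1 (W.\<alpha> + \<beta>)" by (rule measure_dim_eqI[OF conv dim_conv])
  ultimately show ?thesis
    unfolding dissonate_def exact_dimensional_def using dim_\<mu> dim_\<nu> dim_conv by auto
qed

end
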